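(* Let $F$ be a finitely ramified fractal with a resistance form $\mathcal E$ on $V_*$ for which all harmonic functions are continuous, and assume (HC): the harmonic coordinate map $\psi:F\to F_H=\psi(F)\subset\mathbb R^m$, $m=|V_0|$, is a homeomorphism. Identify $F$ with $F_H$, so that $\psi(x)=x$ and $F\subset\mathbb R^m$, and identify $\ell(V_0)$ with $\mathbb R^m$. If $f$ is the restriction to $F$ of a $C^1(\mathbb R^m)$ function, then $f\in\mathrm{Dom}\,\mathcal E$, and such functions are dense in $\mathrm{Dom}\,\mathcal E$. Moreover, if $f\in C^1(\mathbb R^m)$ then $$\mathrm{Grad} f=\nabla f$$ in the sense of the Hilbert space $L^2_Z$. In particular, $$\mathcal E(f,f)=\|\nabla f\|_{L^2_Z}^2=\int_F\langle\nabla f,Z\nabla f\rangle\,d\nu$$ for any $f\in C^1(\mathbb R^m)$.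
   Context: **Finitely ramified fractal.** A finitely ramified fractal is a compact metric space $F$ with a cell structure $\{F_\alpha\}_{\alpha\in\mathcal A}$ and a vertex (boundary) structure $\{V_\alpha\}_{\alpha\in\mathcal A}$ such that: (A) $\mathcal A$ is a countable index set; (B) the $F_\alpha$ are pairwise distinct compact connected subsets of $F$; (C) each $V_\alpha$ is a finite subset of $F_\alpha$ with at least two elements; (D) if $F_\alpha=\bigcup_{j=1}^kF_{\alpha_j}$ then $V_\alpha\subset\bigcup_{j=1}^kV_{\alpha_j}$; (E) there is a filtration $\{\mathcal A_n\}_{n\ge0}$, $\mathcal A=\bigcup_n\mathcal A_n$, by pairwise disjoint finite sets $\mathcal A_n\subset\mathcal A$ with $\mathcal A_0=\{0\}$, $F_0=F$, and such that for every $\alpha\in\mathcal A_n$ there are $\alpha_1,\dots,\alpha_k\in\mathcal A_{n+1}$ with $F_\alpha=\bigcup_{j=1}^kF_{\alpha_j}$; (F) $F_{\alpha'}\cap F_\alpha=V_{\alpha'}\cap V_\alpha$ for any two distinct $\alpha,\alpha'\in\mathcal A_n$; (G) for any strictly decreasing infinite cell sequence $F_{\alpha_1}\supsetneq F_{\alpha_2}\supsetneq\cdots$ there is $x\in F$ with $\bigcap_{n\ge1}F_{\alpha_n}=\{x\}$. A filtration is fixed. Put $V_n=\bigcup_{\alpha\in\mathcal A_n}V_\alpha$ (so $V_n\subset V_{n+1}$) and $V_*=\bigcup_nV_n$. **Resistance form.** $\ell(V)$ is the space of real functions on $V$. A resistance form on the countable set $V_*$ is a pair $(\mathcal E,\mathrm{Dom}\,\mathcal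 E)$ such that: (RF1) $\mathrm{Dom}\,\mathcal E$ is a linear subspace of $\ell(V_* )$ containing constants, $\mathcal E$ is a nonnegative symmetric quadratic form on it, and $\mathcal E(u,u)=0$ iff $u$ is constant; (RF2) $\mathrm{Dom}\,\mathcal E$ modulo constants is a Hilbert space with respect to $\mathcal E$; (RF3) for every finite $V\subset V_*$ and $v\in\ell(V)$ there is $u\in\mathrm{Dom}\,\mathcal E$ with $u|_V=v$; (RF4) for all $p,q\in V_*$, $\sup\{(u(p)-u(q))^2/\mathcal E(u,u):u\in\mathrm{Dom}\,\mathcal E,\ \mathcal E(u,u)>0\}<\infty$; (RF5) for $u\in\mathrm{Dom}\,\mathcal E$, the function $\bar u=\max(0,\min(u,1))$ satisfies $\mathcal E(\bar u,\bar u)\le\mathcal E(u,u)$. For finite $U\subset V_*$ the trace is $\mathcal E_U(f,f)=\min\{\mathcal E(g,g):g\in\mathrm{Dom}\,\mathcal E,\ g|_U=f\}$. A function on $F$ is said to be in $\mathrm{Dom}\,\mathcal E$ if its restriction to $V_*$ is; density in $\mathrm{Dom}\,\mathcal E$ is with respect to the energy seminorm. **Standing assumption.** $\mathcal E$ splits over cells: for each $\alpha$ the restriction $\mathcal E_\alpha$ of $\mathcal E$ to $F_\alpha$ is a resistance form on $V_*\cap F_\alpha$, and for each $n$, $f\in\mathrm{Dom}\,\mathcal E$ iff $f|_{V_*\cap F_\alpha}\in\mathrm{Dom}\,\mathcal E_\alpha$ for all $\alpha\in\mathcal A_n$, with $\mathcal E(f,f)=\sum_{\alpha\in\mathcal A_n}\mathcal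 E_\alpha(f|_{F_\alpha},f|_{F_\alpha})$ (and likewise each $\mathcal E_\alpha$ splits over the subcells of $F_\alpha$). With $\mathcal E_{V_\alpha}$ the trace of $\mathcal E_\alpha$ on $V_\alpha$ one has $\mathcal E_{V_n}=\sum_{\alpha\in\mathcal A_n}\mathcal E_{V_\alpha}$. **Harmonic functions.** $h\in\mathrm{Dom}\,\mathcal E$ is harmonic if it minimizes $\mathcal E$ among all functions in $\mathrm{Dom}\,\mathcal E$ with the same values on $V_0$; each function on $V_0$ has a unique harmonic extension. A function on $V_*$ is called continuous if it extends to a continuous function on $F$, and is then identified with this extension. Standing assumption: all harmonic functions are continuous. **Harmonic coordinates.** Let $V_0=\{v_1,\dots,v_m\}$ and let $h_j$ here denote the harmonic function with $h_j(v_i)=\delta_{i,j}$. The harmonic coordinate map is $\psi:F\to\mathbb R^m$, $\psi(x)=(h_1(x),\dots,h_m(x))$. $\ell(V_0)$ is identified with $\mathbb R^m$ via $f\mapsto(f(v_1),\dots,f(v_m))$. **Energy measure.** For harmonic $h$, $\nu_h$ is the unique atomless Borel measure on $F$ with $\nu_h(F_\alpha)=\mathcal E_{V_\alpha}(h|_{V_\alpha},h|_{V_\alpha})$ for all $\alpha\in\mathcal A$. The Kusuoka energy measure is $\nu=\nu_{g_1}+\dots+\nu_{g_k}$, $k=|V_0|-1$, where $g_1,\dots,g_k$ are fixed $\mathcal E$-orthonormal harmonic functions that together with constants span all harmonic functions. **The matrix $Z$.** $M_\alpha:\ell(V_0)\to\ell(V_\alpha)$ sends $f$ to $h_f|_{V_\alpha}$,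 where $h_f$ is the harmonic function with $h_f|_{V_0}=f$. $D_\alpha$ is the symmetric matrix with $\mathcal E_{V_\alpha}(f,f)=\langle f,D_\alpha f\rangle$ (standard inner product of $\ell(V_\alpha)$). If $\nu(F_\alpha)\ne0$, $Z_\alpha=M_\alpha^*D_\alpha M_\alpha/\nu(F_\alpha)$; $Z_n(x)=Z_\alpha$ if $\alpha\in\mathcal A_n$, $\nu(F_\alpha)\neq0$, $x\in F_\alpha\setminus V_\alpha$; and $Z(x)=\lim_{n\to\infty}Z_n(x)$, which exists for $\nu$-a.e. $x$. $L^2_Z$ is the Hilbert space of ($\nu$-measurable, modulo null vectors) $\ell(V_0)$-valued functions $u$ on $F$ with norm $\|u\|_{L^2_Z}^2=\int_F\langle u,Zu\rangle\,d\nu$. **Piecewise harmonic functions and Grad.** $f\in\mathrm{Dom}\,\mathcal E$ is $n$-piecewise harmonic if for every $\alpha\in\mathcal A_n$ there is a (globally) harmonic function that coincides with $f$ on $F_\alpha$; it is piecewise harmonic if it is $n$-piecewise harmonic for some $n$. For such $f$ and $\alpha\in\mathcal A_n$, $\mathrm{Tan}_\alpha f\in\ell(V_0)$ is the unique element such that the harmonic function with boundary values $\mathrm{Tan}_\alpha f$ on $V_0$ coincides with $f$ on $F_\alpha$ and has the smallest energy among all harmonic functions coinciding with $f$ on $F_\alpha$. $\mathrm{Grad} f\in L^2_Z$ is the element with $\mathrm{Grad} f(x)=\mathrm{Tan}_\alpha f$ (in the sense of $L^2_Z$) for $\nu$-a.e. $x\in F_\alpha$, $\alpha\in\mathcal A_n$.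 Under (HC) the piecewise harmonic functions are dense in $\mathrm{Dom}\,\mathcal E$, and $\mathrm{Grad}$ denotes also the extension to an isometry $\mathrm{Dom}\,\mathcal E\to L^2_Z$ (the weak gradient).
   Formalization: The density of the C¹ functions and Grad f = ∇f are stated on the assumption that piecewise harmonic functions are dense in Dom E, which (HC) alone does not imply and without which Grad is undefined; f ∈ Dom E and the energy formula need no such assumption. *)

theory Defs
  imports "HOL-Analysis.Analysis"
begin

text \<open>
  Real functions on a subset \<open>S\<close> of the ambient type are represented by total functions whose
  values outside \<open>S\<close> are irrelevant: two of them represent the same element of \<open>\<ell>(S)\<close> if they
  agree on \<open>S\<close>.
\<close>

definition agree_on :: "'a set \<Rightarrow> ('a \<Rightarrow> real) \<Rightarrow> ('a \<Rightarrow> real) \<Rightarrow> bool" where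
  "agree_on S u w \<longleftrightarrow> (\<forall>x\<in>S. u x = w x)"


section \<open>Finitely ramified fractals\<close>

record ('a, 'i) fractal =
  points :: "'a set"
  root :: 'i
  level :: "nat \<Rightarrow> 'i set"
  cell :: "'i \<Rightarrow> 'a set"
  vtx :: "'i \<Rightarrow> 'a set"

definition indices :: "('a, 'i, 'z) fractal_scheme \<Rightarrow> 'i set" where
  "indices X = (\<Union>n. level X n)"

definition level_vertices :: "('a, 'i, 'z) fractal_scheme \<Rightarrow> nat \<Rightarrow> 'a set" where
  "level_vertices X n = (\<Union>\<alpha>\<in>level X n. vtx X \<alpha>)"

definition all_vertices :: "('a, 'i, 'z) fractal_scheme \<Rightarrow> 'a set" where
  "all_vertices X = (\<Union>n. level_vertices X n)"

definition finitely_ramified :: "('a::metric_space, 'i, 'z) fractal_scheme \<Rightarrow> bool" where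
  "finitely_ramified X \<longleftrightarrow>
     compact (points X) \<and>
     countable (indices X) \<and>
     inj_on (cell X) (indices X) \<and>
     (\<forall>\<alpha>\<in>indices X. cell X \<alpha> \<subseteq> points X \<and> compact (cell X \<alpha>) \<and> connected (cell X \<alpha>)) \<and>
     (\<forall>\<alpha>\<in>indices X. finite (vtx X \<alpha>) \<and> vtx X \<alpha> \<subseteq> cell X \<alpha> \<and> card (vtx X \<alpha>) \<ge> 2) \<and>
     (\<forall>\<alpha>\<in>indices X. \<forall>J. finite J \<and> J \<subseteq> indices X \<and> cell X \<alpha> = (\<Union>\<beta>\<in>J. cell X \<beta>)
        \<longrightarrow> vtx X \<alpha> \<subseteq> (\<Union>\<beta>\<in>J. vtx X \<beta>)) \<and>
     (\<forall>n. finite (level X n)) \<and>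
     (\<forall>m n. m \<noteq> n \<longrightarrow> level X m \<inter> level X n = {}) \<and>
     level X 0 = {root X} \<and>
     cell X (root X) = points X \<and>
     (\<forall>n. \<forall>\<alpha>\<in>level X n. \<exists>J. J \<subseteq> level X (Suc n) \<and> cell X \<alpha> = (\<Union>\<beta>\<in>J. cell X \<beta>)) \<and>
     (\<forall>n. \<forall>\<alpha>\<in>level X n. \<forall>\<beta>\<in>level X n. \<alpha> \<noteq> \<beta>
        \<longrightarrow> cell X \<alpha> \<inter> cell X \<beta> = vtx X \<alpha> \<inter> vtx X \<beta>) \<and>
     (\<forall>a :: nat \<Rightarrow> 'i. (\<forall>k. a k \<in> indices X) \<and> (\<forall>k. cell X (a (Suc k)) \<subset> cell X (a k))
        \<longrightarrow> (\<exists>x\<in>points X. (\<Inter>k. cell X (a k)) = {x}))"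


section \<open>Resistance forms\<close>

text \<open>
  The first two conjuncts say that \<open>D\<close> and \<open>E\<close> live on \<open>\<ell>(S)\<close>, i.e. do not depend on values
  outside \<open>S\<close>.
\<close>

definition resistance_form ::
    "'a set \<Rightarrow> ('a \<Rightarrow> real) set \<Rightarrow> (('a \<Rightarrow> real) \<Rightarrow> ('a \<Rightarrow> real) \<Rightarrow> real) \<Rightarrow> bool" where
  "resistance_form S D E \<longleftrightarrow>
     (\<forall>u\<in>D. \<forall>w. agree_on S u w \<longrightarrow> w \<in> D) \<and>
     (\<forall>u\<in>D. \<forall>w\<in>D. \<forall>u'\<in>D. \<forall>w'\<in>D. agree_on S u u' \<and> agree_on S w w' \<longrightarrow> E u w = E u' w') \<and>
     (\<forall>c. (\<lambda>_. c) \<in> D) \<and>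
     (\<forall>u\<in>D. \<forall>w\<in>D. (\<lambda>x. u x + w x) \<in> D) \<and>
     (\<forall>u\<in>D. \<forall>c. (\<lambda>x. c * u x) \<in> D) \<and>
     (\<forall>u\<in>D. \<forall>w\<in>D. E u w = E w u) \<and>
     (\<forall>u\<in>D. \<forall>w\<in>D. \<forall>z\<in>D. E (\<lambda>x. u x + w x) z = E u z + E w z) \<and>
     (\<forall>u\<in>D. \<forall>w\<in>D. \<forall>c. E (\<lambda>x. c * u x) w = c * E u w) \<and>
     (\<forall>u\<in>D. E u u \<ge> 0) \<and>
     (\<forall>u\<in>D. E u u = 0 \<longleftrightarrow> (\<exists>c. agree_on S u (\<lambda>_. c))) \<and>
     (\<forall>u :: nat \<Rightarrow> 'a \<Rightarrow> real.
        (\<forall>k. u k \<in> D) \<and>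
        (\<forall>e>0. \<exists>K. \<forall>j\<ge>K. \<forall>k\<ge>K. E (\<lambda>x. u j x - u k x) (\<lambda>x. u j x - u k x) < e)
        \<longrightarrow> (\<exists>w\<in>D. (\<lambda>k. E (\<lambda>x. u k x - w x) (\<lambda>x. u k x - w x)) \<longlonglongrightarrow> 0)) \<and>
     (\<forall>U f. finite U \<and> U \<subseteq> S \<longrightarrow> (\<exists>u\<in>D. agree_on U u f)) \<and>
     (\<forall>p\<in>S. \<forall>q\<in>S. bdd_above {(u p - u q)\<^sup>2 / E u u | u. u \<in> D \<and> E u u > 0}) \<and>
     (\<forall>u\<in>D. (\<lambda>x. max 0 (min (u x) 1)) \<in> D \<and>
        E (\<lambda>x. max 0 (min (u x) 1)) (\<lambda>x. max 0 (min (u x) 1)) \<le> E u u)"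

text \<open>
  A fractal together with the forms \<open>(form_dom X \<alpha>, form X \<alpha>)\<close> of its cells; the form of the whole
  space is the one of the root cell.
\<close>

record ('a, 'i) form_fractal = "('a, 'i) fractal" +
  form_dom :: "'i \<Rightarrow> ('a \<Rightarrow> real) set"
  form :: "'i \<Rightarrow> ('a \<Rightarrow> real) \<Rightarrow> ('a \<Rightarrow> real) \<Rightarrow> real"

abbreviation Dom :: "('a, 'i, 'z) form_fractal_scheme \<Rightarrow> ('a \<Rightarrow> real) set" where
  "Dom X \<equiv> form_dom X (root X)"

abbreviation energy ::
    "('a, 'i, 'z) form_fractal_scheme \<Rightarrow> ('a \<Rightarrow> real) \<Rightarrow> ('a \<Rightarrow> real) \<Rightarrow> real" where
  "energy X \<equiv> form X (root X)"

definition splitting_form :: "('a, 'i, 'z) form_fractal_scheme \<Rightarrow> bool" where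
  "splitting_form X \<longleftrightarrow>
     (\<forall>\<alpha>\<in>indices X.
        resistance_form (all_vertices X \<inter> cell X \<alpha>) (form_dom X \<alpha>) (form X \<alpha>)) \<and>
     (\<forall>m n. \<forall>\<alpha>\<in>level X m. m \<le> n \<longrightarrow>
        (\<forall>f. f \<in> form_dom X \<alpha> \<longleftrightarrow>
           (\<forall>\<beta>\<in>level X n. cell X \<beta> \<subseteq> cell X \<alpha> \<longrightarrow> f \<in> form_dom X \<beta>)) \<and>
        (\<forall>f\<in>form_dom X \<alpha>.
           form X \<alpha> f f = (\<Sum>\<beta>\<in>{\<beta>\<in>level X n. cell X \<beta> \<subseteq> cell X \<alpha>}. form X \<beta> f f)))"

definition trace_energy ::
    "('a, 'i, 'z) form_fractal_scheme \<Rightarrow> 'i \<Rightarrow> 'a set \<Rightarrow> ('a \<Rightarrow> real) \<Rightarrow> real" where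
  "trace_energy X \<alpha> U f =
     (LEAST e. \<exists>u\<in>form_dom X \<alpha>. agree_on U u f \<and> e = form X \<alpha> u u)"

definition energy_dense ::
    "('a, 'i, 'z) form_fractal_scheme \<Rightarrow> ('a \<Rightarrow> real) set \<Rightarrow> bool" where
  "energy_dense X S \<longleftrightarrow>
     S \<subseteq> Dom X \<and>
     (\<forall>u\<in>Dom X. \<forall>e>0. \<exists>s\<in>S. energy X (\<lambda>x. u x - s x) (\<lambda>x. u x - s x) < e)"


section \<open>Harmonic functions and harmonic coordinates\<close>

definition harmonic :: "('a, 'i, 'z) form_fractal_scheme \<Rightarrow> ('a \<Rightarrow> real) \<Rightarrow> bool" where
  "harmonic X h \<longleftrightarrow> h \<in> Dom X \<and>
     (\<forall>u\<in>Dom X. agree_on (level_vertices X 0) u h \<longrightarrow> energy X h h \<le> energy X u u)"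

definition harmonic_continuous :: "('a::metric_space, 'i, 'z) form_fractal_scheme \<Rightarrow> bool" where
  "harmonic_continuous X \<longleftrightarrow>
     (\<forall>h. harmonic X h \<longrightarrow>
        (\<exists>k. continuous_on (points X) k \<and> agree_on (all_vertices X) k h))"

text \<open>
  An enumeration \<open>v\<close> of the boundary \<open>V\<^sub>0\<close> by a finite type \<open>'m\<close> identifies \<open>\<ell>(V\<^sub>0)\<close> with
  \<open>real ^ 'm\<close>. The harmonic extension below is already the one to all of \<open>points X\<close>,
  i.e. extended by continuity from \<open>V\<^sub>*\<close>.
\<close>

definition harmonic_ext ::
    "('a::metric_space, 'i, 'z) form_fractal_scheme \<Rightarrow> ('m \<Rightarrow> 'a) \<Rightarrow> real ^ 'm \<Rightarrow> 'a \<Rightarrow> real" where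
  "harmonic_ext X v t =
     (SOME h. harmonic X h \<and> continuous_on (points X) h \<and> (\<forall>i. h (v i) = t $ i))"

definition harmonic_coords ::
    "('a::metric_space, 'i, 'z) form_fractal_scheme \<Rightarrow> ('m::finite \<Rightarrow> 'a) \<Rightarrow> 'a \<Rightarrow> real ^ 'm" where
  "harmonic_coords X v x = (\<chi> j. harmonic_ext X v (axis j 1) x)"


section \<open>Energy measures\<close>

definition is_energy_measure ::
    "('a::metric_space, 'i, 'z) form_fractal_scheme \<Rightarrow> ('a \<Rightarrow> real) \<Rightarrow> 'a measure \<Rightarrow> bool" where
  "is_energy_measure X h N \<longleftrightarrow>
     sets N = sets (restrict_space borel (points X)) \<and>
     (\<forall>x\<in>points X. emeasure N {x} = 0) \<and>
     (\<forall>\<alpha>\<in>indices X. emeasure N (cell X \<alpha>) = ennreal (trace_energy X \<alpha> (vtx X \<alpha>) h))"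

definition orthonormal_harmonic_basis ::
    "('a, 'i, 'z) form_fractal_scheme \<Rightarrow> nat \<Rightarrow> (nat \<Rightarrow> 'a \<Rightarrow> real) \<Rightarrow> bool" where
  "orthonormal_harmonic_basis X k g \<longleftrightarrow>
     (\<forall>i<k. harmonic X (g i)) \<and>
     (\<forall>i<k. \<forall>j<k. energy X (g i) (g j) = (if i = j then 1 else 0)) \<and>
     (\<forall>h. harmonic X h \<longrightarrow>
        (\<exists>c0 c. agree_on (all_vertices X) h (\<lambda>x. c0 + (\<Sum>i<k. c i * g i x))))"

definition kusuoka_measure ::
    "('a::metric_space, 'i, 'z) form_fractal_scheme \<Rightarrow> nat \<Rightarrow> (nat \<Rightarrow> 'a measure) \<Rightarrow> 'a measure" where
  "kusuoka_measure X k \<mu> =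
     measure_of (points X) (sets (restrict_space borel (points X)))
       (\<lambda>B. \<Sum>i<k. emeasure (\<mu> i) B)"


section \<open>The matrix field and its Hilbert space\<close>

definition cell_matrix :: "('a, 'i, 'z) form_fractal_scheme \<Rightarrow> 'i \<Rightarrow> 'a \<Rightarrow> 'a \<Rightarrow> real" where
  "cell_matrix X \<alpha> =
     (THE D. (\<forall>p q. D p q = D q p) \<and>
             (\<forall>p q. p \<notin> vtx X \<alpha> \<or> q \<notin> vtx X \<alpha> \<longrightarrow> D p q = 0) \<and>
             (\<forall>f. trace_energy X \<alpha> (vtx X \<alpha>) f =
                (\<Sum>p\<in>vtx X \<alpha>. f p * (\<Sum>q\<in>vtx X \<alpha>. D p q * f q))))"

definition cell_map ::
    "('a::metric_space, 'i, 'z) form_fractal_scheme \<Rightarrow> ('m::finite \<Rightarrow> 'a) \<Rightarrow> 'i \<Rightarrow> 'a \<Rightarrow> 'm \<Rightarrow> real" where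
  "cell_map X v \<alpha> p j = (if p \<in> vtx X \<alpha> then harmonic_ext X v (axis j 1) p else 0)"

definition Z_cell ::
    "('a::metric_space, 'i, 'z) form_fractal_scheme \<Rightarrow> ('m::finite \<Rightarrow> 'a) \<Rightarrow> 'a measure
      \<Rightarrow> 'i \<Rightarrow> real ^ 'm ^ 'm" where
  "Z_cell X v N \<alpha> =
     (\<chi> i j. (\<Sum>p\<in>vtx X \<alpha>. \<Sum>q\<in>vtx X \<alpha>.
                 cell_map X v \<alpha> p i * cell_matrix X \<alpha> p q * cell_map X v \<alpha> q j)
              / measure N (cell X \<alpha>))"

text \<open>
  On the null set where no cell qualifies, \<open>Z_level\<close> is given the value 0; likewise \<open>lim\<close> is
  meaningful in \<open>Z_field\<close> only off a null set.
\<close>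

definition Z_level ::
    "('a::metric_space, 'i, 'z) form_fractal_scheme \<Rightarrow> ('m::finite \<Rightarrow> 'a) \<Rightarrow> 'a measure
      \<Rightarrow> nat \<Rightarrow> 'a \<Rightarrow> real ^ 'm ^ 'm" where
  "Z_level X v N n x =
     (let P = (\<lambda>\<alpha>. \<alpha> \<in> level X n \<and> measure N (cell X \<alpha>) \<noteq> 0 \<and> x \<in> cell X \<alpha> - vtx X \<alpha>)
      in if \<exists>\<alpha>. P \<alpha> then Z_cell X v N (THE \<alpha>. P \<alpha>) else 0)"

definition Z_field ::
    "('a::metric_space, 'i, 'z) form_fractal_scheme \<Rightarrow> ('m::finite \<Rightarrow> 'a) \<Rightarrow> 'a measure
      \<Rightarrow> 'a \<Rightarrow> real ^ 'm ^ 'm" where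
  "Z_field X v N x = lim (\<lambda>n. Z_level X v N n x)"

definition L2Z ::
    "('a::metric_space, 'i, 'z) form_fractal_scheme \<Rightarrow> ('m::finite \<Rightarrow> 'a) \<Rightarrow> 'a measure
      \<Rightarrow> ('a \<Rightarrow> real ^ 'm) set" where
  "L2Z X v N =
     {u \<in> borel_measurable N. integrable N (\<lambda>x. u x \<bullet> (Z_field X v N x *v u x))}"

definition L2Z_norm_sq ::
    "('a::metric_space, 'i, 'z) form_fractal_scheme \<Rightarrow> ('m::finite \<Rightarrow> 'a) \<Rightarrow> 'a measure
      \<Rightarrow> ('a \<Rightarrow> real ^ 'm) \<Rightarrow> real" where
  "L2Z_norm_sq X v N u = (LINT x|N. u x \<bullet> (Z_field X v N x *v u x))"

text \<open>The element of the Hilbert space (a class modulo null vectors) represented by \<open>u\<close>.\<close>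

definition L2Z_class ::
    "('a::metric_space, 'i, 'z) form_fractal_scheme \<Rightarrow> ('m::finite \<Rightarrow> 'a) \<Rightarrow> 'a measure
      \<Rightarrow> ('a \<Rightarrow> real ^ 'm) \<Rightarrow> ('a \<Rightarrow> real ^ 'm) set" where
  "L2Z_class X v N u = {w \<in> L2Z X v N. L2Z_norm_sq X v N (\<lambda>x. w x - u x) = 0}"


section \<open>Piecewise harmonic functions and the weak gradient\<close>

definition level_pw_harmonic ::
    "('a, 'i, 'z) form_fractal_scheme \<Rightarrow> nat \<Rightarrow> ('a \<Rightarrow> real) \<Rightarrow> bool" where
  "level_pw_harmonic X n f \<longleftrightarrow> f \<in> Dom X \<and>
     (\<forall>\<alpha>\<in>level X n. \<exists>h. harmonic X h \<and> agree_on (all_vertices X \<inter> cell X \<alpha>) h f)"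

definition pw_harmonic :: "('a, 'i, 'z) form_fractal_scheme \<Rightarrow> ('a \<Rightarrow> real) \<Rightarrow> bool" where
  "pw_harmonic X f \<longleftrightarrow> (\<exists>n. level_pw_harmonic X n f)"

definition Tan ::
    "('a::metric_space, 'i, 'z) form_fractal_scheme \<Rightarrow> ('m::finite \<Rightarrow> 'a) \<Rightarrow> 'i \<Rightarrow> ('a \<Rightarrow> real)
      \<Rightarrow> real ^ 'm" where
  "Tan X v \<alpha> f =
     (let coincides = (\<lambda>t. agree_on (all_vertices X \<inter> cell X \<alpha>) (harmonic_ext X v t) f);
          en = (\<lambda>t. energy X (harmonic_ext X v t) (harmonic_ext X v t))
      in THE t. coincides t \<and> (\<forall>s. coincides s \<longrightarrow> en t \<le> en s))"

text \<open>\<open>u\<close> represents the gradient of the piecewise harmonic function \<open>f\<close>.\<close>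

definition is_pw_grad ::
    "('a::metric_space, 'i, 'z) form_fractal_scheme \<Rightarrow> ('m::finite \<Rightarrow> 'a) \<Rightarrow> 'a measure
      \<Rightarrow> ('a \<Rightarrow> real) \<Rightarrow> ('a \<Rightarrow> real ^ 'm) \<Rightarrow> bool" where
  "is_pw_grad X v N f u \<longleftrightarrow> u \<in> L2Z X v N \<and>
     (\<exists>n. level_pw_harmonic X n f \<and>
        (\<forall>\<alpha>\<in>level X n. AE x in N. x \<in> cell X \<alpha> \<longrightarrow>
           (u x - Tan X v \<alpha> f) \<bullet> (Z_field X v N x *v (u x - Tan X v \<alpha> f)) = 0))"

text \<open>
  The extension by continuity from piecewise harmonic functions to \<open>Dom X\<close>; its value, an element
  of the Hilbert space, is the set of all representatives.
\<close>

definition Grad ::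
    "('a::metric_space, 'i, 'z) form_fractal_scheme \<Rightarrow> ('m::finite \<Rightarrow> 'a) \<Rightarrow> 'a measure
      \<Rightarrow> ('a \<Rightarrow> real) \<Rightarrow> ('a \<Rightarrow> real ^ 'm) set" where
  "Grad X v N f =
     {u \<in> L2Z X v N. f \<in> Dom X \<and>
        (\<exists>fs us. (\<forall>k::nat. is_pw_grad X v N (fs k) (us k)) \<and>
           (\<lambda>k. energy X (\<lambda>x. fs k x - f x) (\<lambda>x. fs k x - f x)) \<longlonglongrightarrow> 0 \<and>
           (\<lambda>k. L2Z_norm_sq X v N (\<lambda>x. us k x - u x)) \<longlonglongrightarrow> 0)}"


section \<open>Continuously differentiable functions\<close>

definition nabla :: "(real ^ 'm::finite \<Rightarrow> real) \<Rightarrow> real ^ 'm \<Rightarrow> real ^ 'm" where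
  "nabla \<phi> y = (\<chi> i. frechet_derivative \<phi> (at y) (axis i 1))"

definition C1 :: "(real ^ 'm::finite \<Rightarrow> real) \<Rightarrow> bool" where
  "C1 \<phi> \<longleftrightarrow> (\<forall>y. \<phi> differentiable (at y)) \<and> continuous_on UNIV (nabla \<phi>)"

end

theory Submission
  imports Defs
begin

text \<open>
  In harmonic coordinates the harmonic functions are the linear functionals, so a \<open>C1\<close> function
  \<open>\<phi>\<close> is, on a small cell with base point \<open>x\<close>, the harmonic function with gradient
  \<open>\<nabla>\<phi>(x)\<close> plus a remainder \<open>\<rho>\<close> whose differences are at most \<open>\<epsilon>\<close> times those of the
  coordinates. The trace of a resistance form on a finite set is a sum
  \<open>\<Sum> c(p,q) (f(p) - f(q))\<^sup>2 / 2\<close> with conductances \<open>c \<ge> 0\<close>; hence the trace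
  energy of \<open>\<rho>\<close> on the vertices of the cell is at most \<open>\<epsilon>\<^sup>2\<close> times that of the
  coordinates (\<open>trace_on_contraction\<close>). The trace energy of the linear part is the integral of
  \<open>\<langle>\<nabla>\<phi>(x), Z \<nabla>\<phi>(x)\<rangle>\<close> over the cell. Summing over all cells of a level and refining the
  level, the trace energies of \<open>\<phi>\<close> on the vertex sets converge to
  \<open>\<integral> \<langle>\<nabla>\<phi>, Z \<nabla>\<phi>\<rangle> d\<nu>\<close>. A function whose traces have bounded energies belongs to the
  domain, and its energy is their limit (\<open>bounded_traces\<close>). This gives both membership in the
  domain and the energy formula, on every cell (\<open>C1_cell_energy\<close>).

  The field \<open>Z\<close> is a limit of matrices that are constant on cells. Their entries are quotients of
  two additive functions of cells with the first dominated by the second, i.e. bounded martingales.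
  They are treated directly on the tree of cells: Kolmogorov's maximal inequality is an induction
  on the number of levels (\<open>maximal_inequality\<close>) and yields almost everywhere convergence, and
  dominated convergence identifies the integrals of the limit over cells.

  For the density of \<open>C1\<close> functions it suffices to approximate a piecewise harmonic function, which
  is linear in the coordinates on each cell of some level. After subtraction of a \<open>C1\<close> function it
  vanishes at the vertices of that level. Cutting off its small values is a contraction, and
  disconnects the pieces, because cells meet only in vertices and \<open>\<psi>\<close> is injective: the result
  is \<open>C1\<close> (\<open>threshold_is_C1\<close>). As the cut-off level tends to 0 it converges pointwise without gain
  of energy, hence in energy (\<open>energy_convergence\<close>).

  Finally, the energy formula on cells, applied to the difference of a linear functional and
  \<open>\<phi>\<close>, shows that the distance in energy from a piecewise harmonic function to \<open>\<phi>\<close> is the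
  distance of their gradients in the Hilbert space (\<open>pw_grad_isometry\<close>). So a sequence of
  piecewise harmonic functions tends to \<open>\<phi>\<close> iff their gradients tend to
  \<open>\<nabla>\<phi>\<close>, which determines the weak gradient.
\<close>

section \<open>Resistance forms and their traces on finite sets\<close>

locale resform =
  fixes S :: "'a set" and D :: "('a \<Rightarrow> real) set" and E :: "('a \<Rightarrow> real) \<Rightarrow> ('a \<Rightarrow> real) \<Rightarrow> real"
  assumes rf: "resistance_form S D E"
begin

lemma
  shows D_agree: "u \<in> D \<Longrightarrow> agree_on S u w \<Longrightarrow> w \<in> D"
    and E_agree: "\<lbrakk>u \<in> D; w \<in> D; u' \<in> D; w' \<in> D; agree_on S u u'; agree_on S w w'\<rbrakk> \<Longrightarrow> E u w = E u' w'"
    and D_const: "(\<lambda>_. c) \<in> D"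
    and D_add: "u \<in> D \<Longrightarrow> w \<in> D \<Longrightarrow> (\<lambda>x. u x + w x) \<in> D"
    and D_scale: "u \<in> D \<Longrightarrow> (\<lambda>x. c * u x) \<in> D"
    and E_sym: "u \<in> D \<Longrightarrow> w \<in> D \<Longrightarrow> E u w = E w u"
    and E_add_left: "u \<in> D \<Longrightarrow> w \<in> D \<Longrightarrow> z \<in> D \<Longrightarrow> E (\<lambda>x. u x + w x) z = E u z + E w z"
    and E_scale_left: "u \<in> D \<Longrightarrow> w \<in> D \<Longrightarrow> E (\<lambda>x. c * u x) w = c * E u w"
    and E_nonneg: "u \<in> D \<Longrightarrow> E u u \<ge> 0"
    and E_zero_iff: "u \<in> D \<Longrightarrow> E u u = 0 \<longleftrightarrow> (\<exists>c. agree_on S u (\<lambda>_. c))"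
    and E_complete: "\<lbrakk>\<And>k::nat. us k \<in> D;
        \<And>e. e > 0 \<Longrightarrow> \<exists>K. \<forall>j\<ge>K. \<forall>k\<ge>K. E (\<lambda>x. us j x - us k x) (\<lambda>x. us j x - us k x) < e\<rbrakk>
        \<Longrightarrow> \<exists>w\<in>D. (\<lambda>k. E (\<lambda>x. us k x - w x) (\<lambda>x. us k x - w x)) \<longlonglongrightarrow> 0"
    and D_interpolate: "finite U \<Longrightarrow> U \<subseteq> S \<Longrightarrow> \<exists>u\<in>D. agree_on U u f"
    and E_bdd: "p \<in> S \<Longrightarrow> q \<in> S \<Longrightarrow> bdd_above {(u p - u q)\<^sup>2 / E u u | u. u \<in> D \<and> E u u > 0}"
    and D_unit: "u \<in> D \<Longrightarrow> (\<lambda>x. max 0 (min (u x) 1)) \<in> D"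
    and E_unit: "u \<in> D \<Longrightarrow> E (\<lambda>x. max 0 (min (u x) 1)) (\<lambda>x. max 0 (min (u x) 1)) \<le> E u u"
proof -
  \<comment> \<open>the conjuncts of the definition, in order\<close>
  note r = rf[unfolded resistance_form_def]
  note r1 = r[THEN conjunct1, rule_format] and r = r[THEN conjunct2]
  note r2 = r[THEN conjunct1, rule_format] and r = r[THEN conjunct2]
  note r3 = r[THEN conjunct1, rule_format] and r = r[THEN conjunct2]
  note r4 = r[THEN conjunct1, rule_format] and r = r[THEN conjunct2]
  note r5 = r[THEN conjunct1, rule_format] and r = r[THEN conjunct2]
  note r6 = r[THEN conjunct1, rule_format] and r = r[THEN conjunct2]
  note r7 = r[THEN conjunct1, rule_format] and r = r[THEN conjunct2]
  note r8 = r[THEN conjunct1, rule_format] and r = r[THEN conjunct2]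
  note r9 = r[THEN conjunct1, rule_format] and r = r[THEN conjunct2]
  note r10 = r[THEN conjunct1, rule_format] and r = r[THEN conjunct2]
  note r11 = r[THEN conjunct1, rule_format] and r = r[THEN conjunct2]
  note r12 = r[THEN conjunct1, rule_format] and r = r[THEN conjunct2]
  note r13 = r[THEN conjunct1, rule_format] and r = r[THEN conjunct2]
  note r14 = r[rule_format]
  show "u \<in> D \<Longrightarrow> agree_on S u w \<Longrightarrow> w \<in> D" for u w
    by (rule r1)
  show "\<lbrakk>u \<in> D; w \<in> D; u' \<in> D; w' \<in> D; agree_on S u u'; agree_on S w w'\<rbrakk> \<Longrightarrow> E u w = E u' w'" for u w u' w'
    by (rule r2) auto
  show "(\<lambda>_. c) \<in> D" for c
    by (rule r3)
  show "u \<in> D \<Longrightarrow> w \<in> D \<Longrightarrow> (\<lambda>x. u x + w x) \<in> D" for u w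
    by (rule r4)
  show "u \<in> D \<Longrightarrow> (\<lambda>x. c * u x) \<in> D" for u c
    by (rule r5)
  show "u \<in> D \<Longrightarrow> w \<in> D \<Longrightarrow> E u w = E w u" for u w
    by (rule r6)
  show "u \<in> D \<Longrightarrow> w \<in> D \<Longrightarrow> z \<in> D \<Longrightarrow> E (\<lambda>x. u x + w x) z = E u z + E w z" for u w z
    by (rule r7)
  show "u \<in> D \<Longrightarrow> w \<in> D \<Longrightarrow> E (\<lambda>x. c * u x) w = c * E u w" for u w c
    by (rule r8)
  show "u \<in> D \<Longrightarrow> E u u \<ge> 0" for u
    by (rule r9)
  show "u \<in> D \<Longrightarrow> E u u = 0 \<longleftrightarrow> (\<exists>c. agree_on S u (\<lambda>_. c))" for u c
    by (rule r10)
  show "\<lbrakk>\<And>k::nat. us k \<in> D; \<And>e. e > 0 \<Longrightarrow> \<exists>K. \<forall>j\<ge>K. \<forall>k\<ge>K. E (\<lambda>x. us j x - us k x) (\<lambda>x. us j x - us k x) < e\<rbrakk> \<Longrightarrow> \<exists>w\<in>D. (\<lambda>k. E (\<lambda>x. us k x - w x) (\<lambda>x. us k x - w x)) \<longlonglongrightarrow> 0" for w us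
    by (rule r11) blast
  show "finite U \<Longrightarrow> U \<subseteq> S \<Longrightarrow> \<exists>u\<in>D. agree_on U u f" for u U f
    by (rule r12) blast
  show "p \<in> S \<Longrightarrow> q \<in> S \<Longrightarrow> bdd_above {(u p - u q)\<^sup>2 / E u u | u. u \<in> D \<and> E u u > 0}" for u p q
    by (rule r13)
  show "u \<in> D \<Longrightarrow> (\<lambda>x. max 0 (min (u x) 1)) \<in> D" for u
    using r14 by blast
  show "u \<in> D \<Longrightarrow> E (\<lambda>x. max 0 (min (u x) 1)) (\<lambda>x. max 0 (min (u x) 1)) \<le> E u u" for u
    using r14 by blast
qed

lemma D_diff: "u \<in> D \<Longrightarrow> w \<in> D \<Longrightarrow> (\<lambda>x. u x - w x) \<in> D"
  using D_add[of u "\<lambda>x. (-1) * w x"] D_scale[of w "-1"] by simp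

lemma E_add_right: "u \<in> D \<Longrightarrow> w \<in> D \<Longrightarrow> z \<in> D \<Longrightarrow> E z (\<lambda>x. u x + w x) = E z u + E z w"
  using E_add_left[of u w z] E_sym[of z "\<lambda>x. u x + w x"] E_sym[of z u] E_sym[of z w] D_add by simp

lemma E_scale_right: "u \<in> D \<Longrightarrow> w \<in> D \<Longrightarrow> E w (\<lambda>x. c * u x) = c * E w u"
  using E_scale_left[of u w c] E_sym[of w "\<lambda>x. c * u x"] E_sym[of w u] D_scale by simp

lemma E_diff_left: "u \<in> D \<Longrightarrow> w \<in> D \<Longrightarrow> z \<in> D \<Longrightarrow> E (\<lambda>x. u x - w x) z = E u z - E w z"
  using E_add_left[of u "\<lambda>x. (-1) * w x" z] D_scale[of w "-1"] E_scale_left[of w z "-1"] by simp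

lemma E_diff_right: "u \<in> D \<Longrightarrow> w \<in> D \<Longrightarrow> z \<in> D \<Longrightarrow> E z (\<lambda>x. u x - w x) = E z u - E z w"
  using E_diff_left[of u w z] E_sym[of z "\<lambda>x. u x - w x"] E_sym[of z u] E_sym[of z w] D_diff by simp

lemmas D_intros = D_const D_add D_scale D_diff
lemmas E_bilinear = E_add_left E_add_right E_diff_left E_diff_right E_scale_left E_scale_right

lemma E_diff_sq: "u \<in> D \<Longrightarrow> w \<in> D \<Longrightarrow>
    E (\<lambda>x. u x - w x) (\<lambda>x. u x - w x) = E u u - 2 * E u w + E w w"
  by (simp add: E_bilinear D_intros E_sym[of w u])

lemma E_add_sq: "u \<in> D \<Longrightarrow> w \<in> D \<Longrightarrow>
    E (\<lambda>x. u x + w x) (\<lambda>x. u x + w x) = E u u + 2 * E u w + E w w"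
  by (simp add: E_bilinear D_intros E_sym[of w u])

lemma E_diff_commute: "u \<in> D \<Longrightarrow> w \<in> D \<Longrightarrow>
    E (\<lambda>x. u x - w x) (\<lambda>x. u x - w x) = E (\<lambda>x. w x - u x) (\<lambda>x. w x - u x)"
  by (simp add: E_diff_sq E_sym[of w u])

lemma E_Cauchy_Schwarz:
  assumes u: "u \<in> D" and w: "w \<in> D"
  shows "(E u w)\<^sup>2 \<le> E u u * E w w"
proof -
  have *: "0 \<le> E u u + 2 * r * E u w + r\<^sup>2 * E w w" for r
    using E_nonneg[of "\<lambda>x. u x + r * w x"] u w
    by (simp add: E_bilinear D_intros E_sym[of w u] power2_eq_square algebra_simps)
  show ?thesis
  proof (cases "E w w = 0")
    case True
    \<comment> \<open>an affine function of \<open>r\<close> that is nonnegative everywhere is constant\<close>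
    have "E u w = 0"
    proof (rule ccontr)
      assume "E u w \<noteq> 0"
      then show False using *[of "- (E u u + 1) / (2 * E u w)"] True by (simp add: field_simps)
    qed
    then show ?thesis using True by simp
  next
    case False
    then have "E w w > 0" using E_nonneg[OF w] by simp
    then show ?thesis using *[of "- E u w / E w w"] by (simp add: field_simps power2_eq_square)
  qed
qed

lemma E_zero_orthogonal: "u \<in> D \<Longrightarrow> w \<in> D \<Longrightarrow> E w w = 0 \<Longrightarrow> E u w = 0"
  using E_Cauchy_Schwarz[of u w] by simp

lemma E_const: "u \<in> D \<Longrightarrow> E u (\<lambda>_. c) = 0"
  by (rule E_zero_orthogonal) (auto simp: D_const E_zero_iff agree_on_def)

lemma E_shift: "u \<in> D \<Longrightarrow> E (\<lambda>x. u x + c) (\<lambda>x. u x + c) = E u u"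
  by (simp add: E_add_sq[OF _ D_const] E_const D_const)

lemma E_triangle:
  assumes u: "u \<in> D" and w: "w \<in> D"
  shows "sqrt (E (\<lambda>x. u x + w x) (\<lambda>x. u x + w x)) \<le> sqrt (E u u) + sqrt (E w w)"
proof (rule real_le_lsqrt)
  have "E u w \<le> sqrt (E u u) * sqrt (E w w)"
    by (metis E_Cauchy_Schwarz[OF u w] real_le_rsqrt real_sqrt_mult)
  then show "E (\<lambda>x. u x + w x) (\<lambda>x. u x + w x) \<le> (sqrt (E u u) + sqrt (E w w))\<^sup>2"
    using E_nonneg[OF u] E_nonneg[OF w] by (simp add: E_add_sq u w power2_sum)
qed (use E_nonneg[OF u] E_nonneg[OF w] in auto)

lemma E_tendsto:
  assumes us: "\<And>k. us k \<in> D" and w: "w \<in> D"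
    and lim: "(\<lambda>k::nat. E (\<lambda>x. us k x - w x) (\<lambda>x. us k x - w x)) \<longlonglongrightarrow> 0"
  shows "(\<lambda>k. E (us k) (us k)) \<longlonglongrightarrow> E w w"
proof -
  let ?d = "\<lambda>k. sqrt (E (\<lambda>x. us k x - w x) (\<lambda>x. us k x - w x))"
  have d0: "?d \<longlonglongrightarrow> 0" using tendsto_real_sqrt[OF lim] by simp
  have "\<bar>sqrt (E (us k) (us k)) - sqrt (E w w)\<bar> \<le> ?d k" for k
    using E_triangle[OF D_diff[OF us[of k] w] w] E_triangle[OF D_diff[OF w us[of k]] us[of k]]
      E_diff_commute[OF w us[of k]] by simp
  then have "(\<lambda>k. sqrt (E (us k) (us k)) - sqrt (E w w)) \<longlonglongrightarrow> 0"
    by (intro Lim_null_comparison[OF _ d0]) auto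
  then have "(\<lambda>k. sqrt (E (us k) (us k))) \<longlonglongrightarrow> sqrt (E w w)" by (simp add: LIM_zero_iff)
  from tendsto_power[OF this, of 2] show ?thesis using E_nonneg[OF us] E_nonneg[OF w] by simp
qed

lemma resistance_bound:
  assumes p: "p \<in> S" and q: "q \<in> S"
  obtains R where "R \<ge> 0" "\<And>u. u \<in> D \<Longrightarrow> (u p - u q)\<^sup>2 \<le> R * E u u"
proof -
  from E_bdd[OF p q] obtain M where M: "\<And>u. u \<in> D \<Longrightarrow> E u u > 0 \<Longrightarrow> (u p - u q)\<^sup>2 / E u u \<le> M"
    unfolding bdd_above_def by blast
  show thesis
  proof
    fix u assume u: "u \<in> D"
    show "(u p - u q)\<^sup>2 \<le> max M 0 * E u u"
    proof (cases "E u u = 0")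
      case True
      then show ?thesis using E_zero_iff[OF u] p q by (auto simp: agree_on_def)
    next
      case False
      then have pos: "E u u > 0" using E_nonneg[OF u] by simp
      then have "(u p - u q)\<^sup>2 \<le> M * E u u" using M[OF u] by (simp add: field_simps)
      also have "\<dots> \<le> max M 0 * E u u" using pos by (intro mult_right_mono) auto
      finally show ?thesis .
    qed
  qed simp
qed

text \<open>
  By the resistance estimate, differences of values are continuous in energy.
\<close>

lemma energy_limit_pointwise:
  assumes us: "\<And>k. us k \<in> D" and w: "w \<in> D"
    and lim: "(\<lambda>k::nat. E (\<lambda>x. us k x - w x) (\<lambda>x. us k x - w x)) \<longlonglongrightarrow> 0"
    and p: "p \<in> S" and q: "q \<in> S"
    and ev: "eventually (\<lambda>k. us k p = a \<and> us k q = b) sequentially"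
  shows "a - b = w p - w q"
proof -
  obtain R where R: "\<And>u. u \<in> D \<Longrightarrow> (u p - u q)\<^sup>2 \<le> R * E u u"
    using resistance_bound[OF p q] by metis
  have "eventually (\<lambda>k. ((a - b) - (w p - w q))\<^sup>2 \<le> R * E (\<lambda>x. us k x - w x) (\<lambda>x. us k x - w x)) sequentially"
    using ev
  proof eventually_elim
    case (elim k)
    then show ?case using R[OF D_diff[OF us[of k] w]] by (simp add: algebra_simps)
  qed
  moreover have "(\<lambda>k. R * E (\<lambda>x. us k x - w x) (\<lambda>x. us k x - w x)) \<longlonglongrightarrow> R * 0"
    by (intro tendsto_intros lim)
  ultimately have "((a - b) - (w p - w q))\<^sup>2 \<le> R * 0"
    by (intro tendsto_lowerbound[where F = sequentially]) auto
  then show ?thesis by simp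
qed

subsection \<open>Energy minimisers\<close>

definition minimiser :: "'a set \<Rightarrow> ('a \<Rightarrow> real) \<Rightarrow> ('a \<Rightarrow> real) \<Rightarrow> bool" where
  "minimiser U f u \<longleftrightarrow> u \<in> D \<and> agree_on U u f \<and> (\<forall>w\<in>D. agree_on U w f \<longrightarrow> E u u \<le> E w w)"

lemma minimiserD:
  "minimiser U f u \<Longrightarrow> u \<in> D" "minimiser U f u \<Longrightarrow> agree_on U u f"
  "minimiser U f u \<Longrightarrow> w \<in> D \<Longrightarrow> agree_on U w f \<Longrightarrow> E u u \<le> E w w"
  by (auto simp: minimiser_def)

text \<open>
  The classical projection argument: by the parallelogram law a minimising sequence is Cauchy;
  its limit, shifted to take the right value at one point of \<open>U\<close>, has all the right values.
\<close>

lemma minimiser_exists: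
  assumes fin: "finite U" and US: "U \<subseteq> S" and ne: "U \<noteq> {}"
  shows "\<exists>u. minimiser U f u"
proof -
  define C where "C = {u\<in>D. agree_on U u f}"
  define m where "m = Inf ((\<lambda>u. E u u) ` C)"
  have Cne: "C \<noteq> {}" using D_interpolate[OF fin US, of f] by (auto simp: C_def)
  have bdd: "bdd_below ((\<lambda>u. E u u) ` C)" by (rule bdd_belowI2[of _ 0]) (simp add: C_def E_nonneg)
  have m_le: "m \<le> E u u" if "u \<in> C" for u unfolding m_def by (rule cINF_lower[OF bdd that])
  have "\<exists>u\<in>C. E u u < m + 1 / Suc k" for k
    using cInf_lessD[of "(\<lambda>u. E u u) ` C" "m + 1 / Suc k"] Cne by (auto simp: m_def)
  then obtain us where us: "\<And>k. us k \<in> C" and usm: "\<And>k. E (us k) (us k) < m + 1 / Suc k" by metis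
  have usD: "us k \<in> D" for k using us by (simp add: C_def)
  have near: "E (\<lambda>x. us j x - us k x) (\<lambda>x. us j x - us k x) \<le> 2 / Suc j + 2 / Suc k" for j k
  proof -
    \<comment> \<open>the midpoint is admissible, so its energy is at least \<open>m\<close>\<close>
    let ?mid = "\<lambda>x. (1/2) * (us j x + us k x)"
    have "?mid \<in> C"
      using us[of j] us[of k] unfolding C_def
      by (intro CollectI conjI D_scale D_add) (auto simp: agree_on_def)
    then have "m \<le> E ?mid ?mid" by (rule m_le)
    moreover have "E ?mid ?mid = (E (us j) (us j) + 2 * E (us j) (us k) + E (us k) (us k)) / 4"
      using usD[of j] usD[of k]
      by (simp only: E_bilinear D_intros E_sym[of "us k" "us j"]) (simp add: field_simps)
    ultimately show ?thesis
      using usm[of j] usm[of k] by (simp add: E_diff_sq usD)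
  qed
  obtain w where w: "w \<in> D" and lim: "(\<lambda>k. E (\<lambda>x. us k x - w x) (\<lambda>x. us k x - w x)) \<longlonglongrightarrow> 0"
  proof -
    have "\<exists>K. \<forall>j\<ge>K. \<forall>k\<ge>K. E (\<lambda>x. us j x - us k x) (\<lambda>x. us j x - us k x) < e" if e: "e > 0" for e
    proof -
      obtain K where K: "1 / Suc K < e / 4" using nat_approx_posE[of "e/4"] e by auto
      have "E (\<lambda>x. us j x - us k x) (\<lambda>x. us j x - us k x) < e" if "j \<ge> K" "k \<ge> K" for j k
      proof -
        have "1 / Suc j \<le> 1 / Suc K" "1 / Suc k \<le> 1 / Suc K"
          using that by (auto simp: field_simps)
        then show ?thesis using near[of j k] K by simp
      qed
      then show ?thesis by blast
    qed
    from E_complete[OF usD this] show thesis using that by blast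
  qed
  have Ew: "E w w \<le> m"
  proof -
    have "(\<lambda>k. m + 1 / Suc k) \<longlonglongrightarrow> m + 0"
      by (intro tendsto_intros) (use LIMSEQ_inverse_real_of_nat in \<open>simp add: inverse_eq_divide\<close>)
    moreover have "(\<lambda>k. E (us k) (us k)) \<longlonglongrightarrow> E w w" by (rule E_tendsto[OF usD w lim])
    moreover have "\<forall>k\<ge>0. E (us k) (us k) \<le> m + 1 / Suc k" using usm less_imp_le by blast
    ultimately have "E w w \<le> m + 0" by (intro LIMSEQ_le) auto
    then show ?thesis by simp
  qed
  obtain p0 where p0: "p0 \<in> U" using ne by auto
  define w' where "w' = (\<lambda>x. w x + (f p0 - w p0))"
  have "agree_on U w' f"
    unfolding agree_on_def
  proof
    fix p assume p: "p \<in> U"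
    have "f p - f p0 = w p - w p0"
      by (rule energy_limit_pointwise[OF usD w lim]) (use p p0 US us in \<open>auto simp: C_def agree_on_def\<close>)
    then show "w' p = f p" by (simp add: w'_def)
  qed
  moreover have "w' \<in> D" unfolding w'_def by (intro D_intros w)
  moreover have "E w' w' \<le> m" unfolding w'_def using E_shift[OF w] Ew by simp
  ultimately have "minimiser U f w'" unfolding minimiser_def using m_le by (force simp: C_def)
  then show ?thesis by blast
qed

text \<open>
  The first variation of the energy at a minimiser vanishes.
\<close>

lemma minimiser_orthogonal:
  assumes u: "minimiser U f u" and w: "w \<in> D" and w0: "agree_on U w (\<lambda>_. 0)"
  shows "E u w = 0"
proof -
  note uD = minimiserD(1)[OF u]
  have *: "0 \<le> 2 * r * E u w + r\<^sup>2 * E w w" for r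
  proof -
    have "E u u \<le> E (\<lambda>x. u x + r * w x) (\<lambda>x. u x + r * w x)"
      using minimiserD[OF u] w w0 by (intro minimiserD(3)[OF u] D_intros) (auto simp: agree_on_def)
    also have "\<dots> = E u u + 2 * r * E u w + r\<^sup>2 * E w w"
      using uD w by (simp add: E_bilinear D_intros E_sym[of w u] power2_eq_square algebra_simps)
    finally show ?thesis by simp
  qed
  show ?thesis
  proof (cases "E w w = 0")
    case True
    then show ?thesis by (rule E_zero_orthogonal[OF uD w])
  next
    case False
    then have "E w w > 0" using E_nonneg[OF w] by simp
    then have "0 \<le> - (E u w)\<^sup>2"
      using *[of "- E u w / E w w"] by (simp add: field_simps power2_eq_square)
    then show ?thesis by simp
  qed
qed

text \<open>
  Against a minimiser only the values on \<open>U\<close> count: this makes traces bilinear.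
\<close>

lemma minimiser_pairing:
  assumes u: "minimiser U f u" and w: "w \<in> D" and w': "w' \<in> D" and "agree_on U w w'"
  shows "E u w = E u w'"
  using minimiser_orthogonal[OF u D_diff[OF w w']] assms minimiserD(1)[OF u]
  by (simp add: E_diff_right agree_on_def)

lemma minimiser_unique:
  assumes u: "minimiser U f u" and w: "minimiser U g w" and fg: "agree_on U f g"
    and p: "p \<in> U" and US: "U \<subseteq> S"
  shows "agree_on S u w"
proof -
  note uD = minimiserD(1)[OF u] and wD = minimiserD(1)[OF w]
  have z: "agree_on U (\<lambda>x. u x - w x) (\<lambda>_. 0)"
    using minimiserD(2)[OF u] minimiserD(2)[OF w] fg by (auto simp: agree_on_def)
  have "E u (\<lambda>x. u x - w x) = 0" "E w (\<lambda>x. u x - w x) = 0"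
    using minimiser_orthogonal[OF u D_diff[OF uD wD] z] minimiser_orthogonal[OF w D_diff[OF uD wD] z]
    by simp_all
  then have "E (\<lambda>x. u x - w x) (\<lambda>x. u x - w x) = 0"
    by (simp add: E_diff_left uD wD D_diff)
  then obtain c where c: "\<And>x. x \<in> S \<Longrightarrow> u x - w x = c"
    using E_zero_iff[OF D_diff[OF uD wD]] by (auto simp: agree_on_def)
  moreover have "c = 0" using c[of p] z p US by (auto simp: agree_on_def)
  ultimately show ?thesis by (auto simp: agree_on_def)
qed

subsection \<open>Traces\<close>

definition trace_on :: "'a set \<Rightarrow> ('a \<Rightarrow> real) \<Rightarrow> real" where
  "trace_on U f = (LEAST e. \<exists>u\<in>D. agree_on U u f \<and> e = E u u)"

lemma trace_on_eq: "minimiser U f u \<Longrightarrow> trace_on U f = E u u"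
  unfolding trace_on_def by (rule Least_equality) (auto simp: minimiser_def)

lemma trace_on_le:
  assumes "finite U" "U \<subseteq> S" "U \<noteq> {}" "u \<in> D"
  shows "trace_on U u \<le> E u u"
proof -
  obtain w where w: "minimiser U u w" using minimiser_exists assms by blast
  show ?thesis using trace_on_eq[OF w] minimiserD(3)[OF w assms(4)] by (simp add: agree_on_def)
qed

lemma trace_on_cong: "agree_on U f g \<Longrightarrow> trace_on U f = trace_on U g"
  unfolding trace_on_def agree_on_def by (rule arg_cong[where f = Least]) (auto intro!: ext)

end

context resform
begin

definition min_ext :: "'a set \<Rightarrow> ('a \<Rightarrow> real) \<Rightarrow> 'a \<Rightarrow> real" where
  "min_ext U f = (SOME u. minimiser U f u)"

text \<open>
  The polarisation of the trace energy.
\<close>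

definition trace_form :: "'a set \<Rightarrow> ('a \<Rightarrow> real) \<Rightarrow> ('a \<Rightarrow> real) \<Rightarrow> real" where
  "trace_form U f g = E (min_ext U f) (min_ext U g)"

abbreviation pt :: "'a \<Rightarrow> 'a \<Rightarrow> real" where
  "pt p \<equiv> \<lambda>x. if x = p then 1 else 0"

context
  fixes U :: "'a set"
  assumes fin: "finite U" and US: "U \<subseteq> S" and ne: "U \<noteq> {}"
begin

lemma min_ext: "minimiser U f (min_ext U f)"
  unfolding min_ext_def using minimiser_exists[OF fin US ne] by (rule someI_ex)

lemmas min_ext_D = minimiserD(1)[OF min_ext]
lemmas min_ext_agree = minimiserD(2)[OF min_ext]

lemma trace_on_trace_form: "trace_on U f = trace_form U f f"
  unfolding trace_form_def by (rule trace_on_eq[OF min_ext])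

lemma trace_form_eq: "u \<in> D \<Longrightarrow> agree_on U u g \<Longrightarrow> trace_form U f g = E (min_ext U f) u"
  unfolding trace_form_def using min_ext_agree[of g]
  by (intro minimiser_pairing[OF min_ext] min_ext_D) (auto simp: agree_on_def)

lemma trace_form_sym: "trace_form U f g = trace_form U g f"
  unfolding trace_form_def by (rule E_sym) (rule min_ext_D)+

lemma trace_form_add: "trace_form U h (\<lambda>x. f x + g x) = trace_form U h f + trace_form U h g"
proof -
  have "trace_form U h (\<lambda>x. f x + g x) = E (min_ext U h) (\<lambda>x. min_ext U f x + min_ext U g x)"
    using min_ext_agree[of f] min_ext_agree[of g]
    by (intro trace_form_eq D_add min_ext_D) (auto simp: agree_on_def)
  also have "\<dots> = trace_form U h f + trace_form U h g"
    unfolding trace_form_def by (intro E_add_right min_ext_D)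
  finally show ?thesis .
qed

lemma trace_form_scale: "trace_form U h (\<lambda>x. c * f x) = c * trace_form U h f"
proof -
  have "trace_form U h (\<lambda>x. c * f x) = E (min_ext U h) (\<lambda>x. c * min_ext U f x)"
    using min_ext_agree[of f] by (intro trace_form_eq D_scale min_ext_D) (auto simp: agree_on_def)
  also have "\<dots> = c * trace_form U h f"
    unfolding trace_form_def by (intro E_scale_right min_ext_D)
  finally show ?thesis .
qed

lemma trace_form_sum: "finite I \<Longrightarrow> trace_form U h (\<lambda>x. \<Sum>i\<in>I. c i * w i x) = (\<Sum>i\<in>I. c i * trace_form U h (w i))"
proof (induction I rule: finite_induct)
  case empty
  then show ?case using trace_form_scale[of h 0 "\<lambda>_. 0"] by simp
next
  case (insert i I)
  then show ?case using trace_form_add[of h "\<lambda>x. c i * w i x" "\<lambda>x. \<Sum>i\<in>I. c i * w i x"] trace_form_scale[of h "c i" "w i"] by simp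
qed

lemma trace_form_cong: "agree_on U g g' \<Longrightarrow> trace_form U f g = trace_form U f g'"
  using trace_form_eq[OF min_ext_D[of g'], of g f] min_ext_agree[of g'] unfolding trace_form_def
  by (simp add: agree_on_def)

lemma trace_form_const: "trace_form U f (\<lambda>_. c) = 0"
  using trace_form_eq[OF D_const, of c "\<lambda>_. c" f] E_const[OF min_ext_D] by (simp add: agree_on_def)

text \<open>
  The bilinear trace form sees functions only through their values at the finitely many points
  of \<open>U\<close>, which are combinations of point masses.
\<close>

lemma trace_form_expand:
  "trace_form U f g = (\<Sum>p\<in>U. \<Sum>q\<in>U. f p * g q * trace_form U (pt p) (pt q))"
proof -
  have ag: "agree_on U f (\<lambda>x. \<Sum>p\<in>U. f p * pt p x)" for f
    by (simp add: agree_on_def fin if_distrib[of "(*) _"] cong: if_cong)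
  have 1: "trace_form U h f = (\<Sum>p\<in>U. f p * trace_form U h (pt p))" for h f
    using trace_form_cong[OF ag[of f], of h] trace_form_sum[OF fin, of h f pt] by simp
  have "trace_form U f g = (\<Sum>q\<in>U. g q * trace_form U (pt q) f)"
    by (subst 1) (simp add: trace_form_sym[of f])
  also have "\<dots> = (\<Sum>q\<in>U. g q * (\<Sum>p\<in>U. f p * trace_form U (pt p) (pt q)))"
    by (subst 1[of _ f]) (simp add: trace_form_sym[of "pt _" "pt _"])
  also have "\<dots> = (\<Sum>p\<in>U. \<Sum>q\<in>U. f p * g q * trace_form U (pt p) (pt q))"
    by (subst sum.swap) (simp add: sum_distrib_left mult_ac)
  finally show ?thesis .
qed

lemma trace_on_nonneg: "trace_on U f \<ge> 0"
  unfolding trace_on_trace_form trace_form_def by (rule E_nonneg[OF min_ext_D])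

lemma trace_on_unit: "trace_on U (\<lambda>x. max 0 (min (f x) 1)) \<le> trace_on U f"
proof -
  let ?u = "\<lambda>x. max 0 (min (min_ext U f x) 1)"
  have "trace_on U (\<lambda>x. max 0 (min (f x) 1)) = trace_on U ?u"
    using min_ext_agree[of f] by (intro trace_on_cong) (auto simp: agree_on_def)
  also have "\<dots> \<le> E ?u ?u" by (intro trace_on_le fin US ne D_unit min_ext_D)
  also have "\<dots> \<le> trace_on U f" unfolding trace_on_trace_form trace_form_def by (rule E_unit[OF min_ext_D])
  finally show ?thesis .
qed

lemma trace_on_add: "trace_on U (\<lambda>x. f x + g x) = trace_on U f + 2 * trace_form U f g + trace_on U g"
  unfolding trace_on_trace_form by (simp add: trace_form_add trace_form_sym[of "\<lambda>x. f x + g x"] trace_form_sym[of g f])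

lemma trace_on_scale: "trace_on U (\<lambda>x. c * f x) = c\<^sup>2 * trace_on U f"
  unfolding trace_on_trace_form by (simp add: trace_form_scale trace_form_sym[of "\<lambda>x. c * f x"] power2_eq_square)

text \<open>
  Cutting \<open>1\<^sub>p - s 1\<^sub>q\<close> at level 0 removes the second term; the Markov property
  bounds the effect on the energy, and the linear term in \<open>s\<close> dominates.
\<close>

lemma trace_form_pt_nonpos:
  assumes pq: "p \<noteq> q"
  shows "trace_form U (pt p) (pt q) \<le> 0"
proof (rule field_le_epsilon)
  fix e :: real assume e: "e > 0"
  let ?b = "trace_form U (pt p) (pt q)" and ?c = "trace_on U (pt q)"
  define s where "s = e / (?c + 1)"
  have c: "?c \<ge> 0" by (rule trace_on_nonneg)
  have s: "s > 0" using e c by (simp add: s_def)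
  have "trace_on U (pt p) = trace_on U (\<lambda>x. max 0 (min (pt p x + (- s) * pt q x) 1))"
    using pq s by (intro trace_on_cong) (auto simp: agree_on_def)
  also have "\<dots> \<le> trace_on U (\<lambda>x. pt p x + (- s) * pt q x)" by (rule trace_on_unit)
  also have "\<dots> = trace_on U (pt p) - 2 * s * ?b + s\<^sup>2 * ?c"
    using trace_on_add[of "pt p" "\<lambda>x. (- s) * pt q x"] trace_on_scale[of "- s" "pt q"]
      trace_form_scale[of "pt p" "- s" "pt q"] by simp
  finally have "s * (2 * ?b) \<le> s * (s * ?c)" by (simp add: power2_eq_square algebra_simps)
  then have "2 * ?b \<le> s * ?c" using s by simp
  also have "\<dots> \<le> e" using c e by (simp add: s_def field_simps)
  finally show "?b \<le> 0 + e" using e by simp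
qed

text \<open>
  The rows of the matrix of the trace form sum to 0, since constants have no energy; this turns
  the quadratic form into a sum over edges.
\<close>

lemma trace_on_conductances:
  "trace_on U f = (\<Sum>p\<in>U. \<Sum>q\<in>U. - trace_form U (pt p) (pt q) * (f p - f q)\<^sup>2) / 2"
proof -
  let ?T = "\<lambda>p q. trace_form U (pt p) (pt q)"
  have row: "(\<Sum>p\<in>U. \<Sum>q\<in>U. g p * ?T p q) = 0" for g
    using trace_form_const[of g 1] by (subst (asm) trace_form_expand) simp
  have col: "(\<Sum>p\<in>U. \<Sum>q\<in>U. g q * ?T p q) = 0" for g
    using row[of g] by (subst sum.swap) (simp add: trace_form_sym)
  have "(\<Sum>p\<in>U. \<Sum>q\<in>U. - ?T p q * (f p - f q)\<^sup>2)
      = (\<Sum>p\<in>U. \<Sum>q\<in>U. 2 * (f p * f q * ?T p q) - (f p)\<^sup>2 * ?T p q - (f q)\<^sup>2 * ?T p q)"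
    by (intro sum.cong refl) (simp add: power2_eq_square algebra_simps)
  also have "\<dots> = 2 * trace_form U f f"
    using row[of "\<lambda>p. (f p)\<^sup>2"] col[of "\<lambda>p. (f p)\<^sup>2"] trace_form_expand[of f f]
    by (simp add: sum_subtractf sum_distrib_left)
  finally show ?thesis by (simp add: trace_on_trace_form)
qed

text \<open>
  As the conductances are nonnegative, oscillations on \<open>U\<close> control trace energies. This is how
  the Markov property enters all estimates below.
\<close>

lemma trace_on_contraction:
  assumes I: "finite I"
    and le: "\<And>p q. p \<in> U \<Longrightarrow> q \<in> U \<Longrightarrow> (u p - u q)\<^sup>2 \<le> K * (\<Sum>i\<in>I. (w i p - w i q)\<^sup>2)"
  shows "trace_on U u \<le> K * (\<Sum>i\<in>I. trace_on U (w i))"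
proof -
  let ?c = "\<lambda>p q. - trace_form U (pt p) (pt q)"
  have "trace_on U u \<le> (\<Sum>p\<in>U. \<Sum>q\<in>U. ?c p q * (K * (\<Sum>i\<in>I. (w i p - w i q)\<^sup>2))) / 2"
    unfolding trace_on_conductances
  proof (intro divide_right_mono sum_mono)
    fix p q assume "p \<in> U" "q \<in> U"
    then show "?c p q * (u p - u q)\<^sup>2 \<le> ?c p q * (K * (\<Sum>i\<in>I. (w i p - w i q)\<^sup>2))"
      using le[of p q] trace_form_pt_nonpos[of p q] by (cases "p = q") (auto intro!: mult_left_mono_neg)
  qed simp
  also have "(\<Sum>p\<in>U. \<Sum>q\<in>U. ?c p q * (K * (\<Sum>i\<in>I. (w i p - w i q)\<^sup>2)))
      = (\<Sum>p\<in>U. \<Sum>q\<in>U. \<Sum>i\<in>I. K * (?c p q * (w i p - w i q)\<^sup>2))"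
    by (simp add: sum_distrib_left sum_distrib_right sum_negf mult_ac)
  also have "\<dots> = (\<Sum>i\<in>I. \<Sum>p\<in>U. \<Sum>q\<in>U. K * (?c p q * (w i p - w i q)\<^sup>2))"
    by (subst sum.swap[of _ I], subst sum.swap[of _ I]) simp
  also have "\<dots> / 2 = K * (\<Sum>i\<in>I. trace_on U (w i))"
    unfolding trace_on_conductances by (simp add: sum_distrib_left sum_divide_distrib)
  finally show ?thesis .
qed

lemma trace_form_Cauchy_Schwarz: "(trace_form U f g)\<^sup>2 \<le> trace_on U f * trace_on U g"
  unfolding trace_on_trace_form trace_form_def by (rule E_Cauchy_Schwarz; rule min_ext_D)

lemma trace_on_mono:
  assumes "finite U'" "U' \<subseteq> S" "U \<subseteq> U'"
  shows "trace_on U f \<le> trace_on U' f"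
proof -
  have "U' \<noteq> {}" using ne assms by auto
  from minimiser_exists[OF assms(1,2) this] obtain w where w: "minimiser U' f w" by blast
  have "E (min_ext U f) (min_ext U f) \<le> E w w"
    using minimiserD(2)[OF w] assms(3)
    by (intro minimiserD(3)[OF min_ext] minimiserD(1)[OF w]) (auto simp: agree_on_def)
  then show ?thesis by (simp add: trace_on_eq[OF w] trace_on_eq[OF min_ext])
qed

end

subsection \<open>The form as the limit of its traces\<close>

context
  fixes U :: "nat \<Rightarrow> 'a set"
  assumes fin: "\<And>n. finite (U n)" and mono: "\<And>m n. m \<le> n \<Longrightarrow> U m \<subseteq> U n"
    and un: "(\<Union>n. U n) = S" and ne: "\<And>n. U n \<noteq> {}"
begin

lemma US: "U n \<subseteq> S"
  using un by auto

text \<open>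
  The minimisers for \<open>f\<close> on \<open>U n\<close> have orthogonal increments, so bounded traces make them a
  Cauchy sequence, whose limit can only be \<open>f\<close> up to a constant.
\<close>

lemma bounded_traces:
  assumes B: "\<And>n. trace_on (U n) f \<le> B"
  shows "f \<in> D \<and> (\<lambda>n. trace_on (U n) f) \<longlonglongrightarrow> E f f"
proof -
  let ?h = "\<lambda>n. min_ext (U n) f"
  note min = min_ext[OF fin US ne]
  note hD = min_ext_D[OF fin US ne]
  have trh: "trace_on (U n) f = E (?h n) (?h n)" for n
    by (rule trace_on_eq[OF min])
  have inc: "E (\<lambda>x. ?h m x - ?h n x) (\<lambda>x. ?h m x - ?h n x) = trace_on (U m) f - trace_on (U n) f"
    if "n \<le> m" for m n
  proof -
    have "agree_on (U n) (?h m) (?h n)"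
      using minimiserD(2)[OF min[of n]] minimiserD(2)[OF min[of m]] mono[OF that]
      by (auto simp: agree_on_def)
    then have "E (?h n) (?h m) = E (?h n) (?h n)"
      by (intro minimiser_pairing[OF min] hD)
    then show ?thesis by (simp add: E_diff_sq hD trh E_sym[of "?h m" "?h n"])
  qed
  have "incseq (\<lambda>n. trace_on (U n) f)"
    by (intro incseq_SucI trace_on_mono fin US ne mono) simp
  from incseq_convergent[OF this] B obtain L where L: "(\<lambda>n. trace_on (U n) f) \<longlonglongrightarrow> L" by metis
  have "\<exists>K. \<forall>j\<ge>K. \<forall>k\<ge>K. E (\<lambda>x. ?h j x - ?h k x) (\<lambda>x. ?h j x - ?h k x) < e" if e: "e > 0" for e
  proof -
    have "Cauchy (\<lambda>n. trace_on (U n) f)" using L by (rule LIMSEQ_imp_Cauchy)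
    then obtain K where K: "\<And>j k. j \<ge> K \<Longrightarrow> k \<ge> K \<Longrightarrow> \<bar>trace_on (U j) f - trace_on (U k) f\<bar> < e"
      using e unfolding Cauchy_def dist_real_def by metis
    have "E (\<lambda>x. ?h j x - ?h k x) (\<lambda>x. ?h j x - ?h k x) < e" if "j \<ge> K" "k \<ge> K" for j k
      using K[OF that] inc[of j k] inc[of k j] E_diff_commute[OF hD[of j f] hD[of k f]]
      by (cases "j \<le> k") auto
    then show ?thesis by blast
  qed
  from E_complete[OF hD this] obtain w
    where w: "w \<in> D" and lim: "(\<lambda>k. E (\<lambda>x. ?h k x - w x) (\<lambda>x. ?h k x - w x)) \<longlonglongrightarrow> 0" by blast
  obtain p0 where p0: "p0 \<in> U 0" using ne by auto
  define c where "c = f p0 - w p0"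
  have fw: "agree_on S (\<lambda>x. w x + c) f"
    unfolding agree_on_def
  proof
    fix p assume p: "p \<in> S"
    then obtain n where n: "p \<in> U n" using un by auto
    have "eventually (\<lambda>k. ?h k p = f p \<and> ?h k p0 = f p0) sequentially"
      using eventually_ge_at_top[of n]
    proof eventually_elim
      case (elim k)
      then show ?case
        using n p0 mono[of n k] mono[of 0 k] minimiserD(2)[OF min[of k f]] by (auto simp: agree_on_def)
    qed
    moreover have "p0 \<in> S" using p0 US by blast
    ultimately have "f p - f p0 = w p - w p0" by (intro energy_limit_pointwise[OF hD w lim p])
    then show "w p + c = f p" by (simp add: c_def)
  qed
  have wc: "(\<lambda>x. w x + c) \<in> D" by (intro D_intros w)
  have fD: "f \<in> D" by (rule D_agree[OF wc fw])
  have "E f f = E w w"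
    using E_agree[OF wc wc fD fD fw fw] E_shift[OF w] by simp
  moreover have "(\<lambda>n. trace_on (U n) f) \<longlonglongrightarrow> E w w"
    unfolding trh by (rule E_tendsto[OF hD w lim])
  ultimately show ?thesis using fD by simp
qed

lemma traces_tendsto:
  assumes f: "f \<in> D"
  shows "(\<lambda>n. trace_on (U n) f) \<longlonglongrightarrow> E f f"
  using bounded_traces[of f "E f f"] trace_on_le[OF fin US ne f] by blast

text \<open>
  Pointwise convergence with no gain of energy is convergence in energy: by the parallelogram law it
  suffices that midpoints do not lose energy, and each finite trace is continuous for pointwise
  convergence.
\<close>

lemma energy_convergence:
  assumes fD: "f \<in> D" and fs: "\<And>k. fs k \<in> D" and le: "\<And>k. E (fs k) (fs k) \<le> E f f"
    and pw: "\<And>p. p \<in> S \<Longrightarrow> (\<lambda>k::nat. fs k p) \<longlonglongrightarrow> f p"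
  shows "(\<lambda>k. E (\<lambda>x. fs k x - f x) (\<lambda>x. fs k x - f x)) \<longlonglongrightarrow> 0"
proof (rule LIMSEQ_I)
  fix e :: real assume e: "e > 0"
  \<comment> \<open>two errors of \<open>e/16\<close> enter the parallelogram law with the factor 4\<close>
  have "eventually (\<lambda>n. trace_on (U n) f > E f f - e / 16) sequentially"
    by (rule order_tendstoD[OF traces_tendsto[OF fD]]) (use e in simp)
  then obtain n where n: "trace_on (U n) f > E f f - e / 16" by (auto simp: eventually_sequentially)
  let ?m = "\<lambda>k x. (1/2) * (fs k x + f x)"
  have "(\<lambda>k. trace_on (U n) (?m k)) \<longlonglongrightarrow> trace_on (U n) (\<lambda>x. (1/2) * (f x + f x))"
    unfolding trace_on_conductances[OF fin US ne]
    by (intro tendsto_intros pw) (use US in auto)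
  then have "(\<lambda>k. trace_on (U n) (?m k)) \<longlonglongrightarrow> trace_on (U n) f" by simp
  then have "eventually (\<lambda>k. trace_on (U n) (?m k) > trace_on (U n) f - e / 16) sequentially"
    by (rule order_tendstoD) (use e in simp)
  then obtain K where K: "\<And>k. k \<ge> K \<Longrightarrow> trace_on (U n) (?m k) > trace_on (U n) f - e / 16"
    by (auto simp: eventually_sequentially)
  have "norm (E (\<lambda>x. fs k x - f x) (\<lambda>x. fs k x - f x) - 0) < e" if "k \<ge> K" for k
  proof -
    have "?m k \<in> D" by (intro D_scale D_add fs fD)
    then have "E (?m k) (?m k) > E f f - e / 8"
      using trace_on_le[OF fin[of n] US ne, of "?m k"] K[OF that] n by simp
    moreover have "E (?m k) (?m k) = (E (fs k) (fs k) + 2 * E (fs k) f + E f f) / 4"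
      using fs[of k] fD by (simp only: E_bilinear D_intros E_sym[of f "fs k"]) (simp add: field_simps)
    ultimately have "E (\<lambda>x. fs k x - f x) (\<lambda>x. fs k x - f x) < e"
      using le[of k] e by (simp add: E_diff_sq fs fD)
    then show ?thesis using E_nonneg[OF D_diff[OF fs[of k] fD]] by simp
  qed
  then show "\<exists>K. \<forall>k\<ge>K. norm (E (\<lambda>x. fs k x - f x) (\<lambda>x. fs k x - f x) - 0) < e" by blast
qed

text \<open>
  All traces decrease, so \<open>bounded_traces\<close> applies to a function not known to lie
  in the domain.
\<close>

lemma energy_contraction:
  assumes f: "f \<in> D" and le: "\<And>p q. p \<in> S \<Longrightarrow> q \<in> S \<Longrightarrow> \<bar>u p - u q\<bar> \<le> \<bar>f p - f q\<bar>"
  shows "u \<in> D \<and> E u u \<le> E f f"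
proof -
  have "trace_on (U n) u \<le> trace_on (U n) f" for n
    using trace_on_contraction[OF fin US ne, of "{()}" n u 1 "\<lambda>_. f"] le US
    by (simp add: abs_le_square_iff subset_iff)
  then have *: "trace_on (U n) u \<le> E f f" for n
    using trace_on_le[OF fin US ne f, of n] by (meson order_trans)
  from bounded_traces[OF this] have "u \<in> D" "(\<lambda>n. trace_on (U n) u) \<longlonglongrightarrow> E u u" by auto
  then show ?thesis using LIMSEQ_le_const2[of _ "E u u" "E f f"] * by blast
qed

end

end

section \<open>The tree of cells\<close>

locale cells =
  fixes X :: "('a::metric_space, 'i, 'z) fractal_scheme"
  assumes fr: "finitely_ramified X"
begin

lemma
  shows compact_points: "compact (points X)"
    and inj_cell: "inj_on (cell X) (indices X)"
    and cell_points: "\<alpha> \<in> indices X \<Longrightarrow> cell X \<alpha> \<subseteq> points X"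
    and cell_compact: "\<alpha> \<in> indices X \<Longrightarrow> compact (cell X \<alpha>)"
    and cell_connected: "\<alpha> \<in> indices X \<Longrightarrow> connected (cell X \<alpha>)"
    and vtx_finite: "\<alpha> \<in> indices X \<Longrightarrow> finite (vtx X \<alpha>)"
    and vtx_cell: "\<alpha> \<in> indices X \<Longrightarrow> vtx X \<alpha> \<subseteq> cell X \<alpha>"
    and vtx_card: "\<alpha> \<in> indices X \<Longrightarrow> card (vtx X \<alpha>) \<ge> 2"
    and vtx_refine: "\<lbrakk>\<alpha> \<in> indices X; finite J; J \<subseteq> indices X; cell X \<alpha> = (\<Union>\<beta>\<in>J. cell X \<beta>)\<rbrakk>
      \<Longrightarrow> vtx X \<alpha> \<subseteq> (\<Union>\<beta>\<in>J. vtx X \<beta>)"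
    and level_finite: "finite (level X n)"
    and level_disjoint: "m \<noteq> n \<Longrightarrow> level X m \<inter> level X n = {}"
    and level_0: "level X 0 = {root X}"
    and cell_root: "cell X (root X) = points X"
    and cell_children: "\<alpha> \<in> level X n
      \<Longrightarrow> \<exists>J. J \<subseteq> level X (Suc n) \<and> cell X \<alpha> = (\<Union>\<beta>\<in>J. cell X \<beta>)"
    and cell_inter: "\<lbrakk>\<alpha> \<in> level X n; \<beta> \<in> level X n; \<alpha> \<noteq> \<beta>\<rbrakk>
      \<Longrightarrow> cell X \<alpha> \<inter> cell X \<beta> = vtx X \<alpha> \<inter> vtx X \<beta>"
    and nested_cells_point: "(\<forall>k::nat. a k \<in> indices X) \<and> (\<forall>k. cell X (a (Suc k)) \<subset> cell X (a k))
      \<Longrightarrow> \<exists>x\<in>points X. (\<Inter>k. cell X (a k)) = {x}"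
proof -
  \<comment> \<open>the conjuncts of the definition, in order\<close>
  note r = fr[unfolded finitely_ramified_def]
  note r1 = r[THEN conjunct1] and r = r[THEN conjunct2]
  note r2 = r[THEN conjunct1] and r = r[THEN conjunct2]
  note r3 = r[THEN conjunct1] and r = r[THEN conjunct2]
  note r4 = r[THEN conjunct1] and r = r[THEN conjunct2]
  note r5 = r[THEN conjunct1] and r = r[THEN conjunct2]
  note r6 = r[THEN conjunct1] and r = r[THEN conjunct2]
  note r7 = r[THEN conjunct1] and r = r[THEN conjunct2]
  note r8 = r[THEN conjunct1] and r = r[THEN conjunct2]
  note r9 = r[THEN conjunct1] and r = r[THEN conjunct2]
  note r10 = r[THEN conjunct1] and r = r[THEN conjunct2]
  note r11 = r[THEN conjunct1] and r = r[THEN conjunct2]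
  note r12 = r[THEN conjunct1] and r = r[THEN conjunct2]
  show "compact (points X)" by (rule r1)
  show "inj_on (cell X) (indices X)" by (rule r3)
  show "\<alpha> \<in> indices X \<Longrightarrow> cell X \<alpha> \<subseteq> points X" using r4 by blast
  show "\<alpha> \<in> indices X \<Longrightarrow> compact (cell X \<alpha>)" using r4 by blast
  show "\<alpha> \<in> indices X \<Longrightarrow> connected (cell X \<alpha>)" using r4 by blast
  show "\<alpha> \<in> indices X \<Longrightarrow> finite (vtx X \<alpha>)" using r5 by blast
  show "\<alpha> \<in> indices X \<Longrightarrow> vtx X \<alpha> \<subseteq> cell X \<alpha>" using r5 by blast
  show "\<alpha> \<in> indices X \<Longrightarrow> card (vtx X \<alpha>) \<ge> 2" using r5 by blast
  show "\<lbrakk>\<alpha> \<in> indices X; finite J; J \<subseteq> indices X; cell X \<alpha> = (\<Union>\<beta>\<in>J. cell X \<beta>)\<rbrakk>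
      \<Longrightarrow> vtx X \<alpha> \<subseteq> (\<Union>\<beta>\<in>J. vtx X \<beta>)" by (rule r6[rule_format]) auto
  show "finite (level X n)" by (rule r7[rule_format])
  show "m \<noteq> n \<Longrightarrow> level X m \<inter> level X n = {}" by (rule r8[rule_format])
  show "level X 0 = {root X}" by (rule r9)
  show "cell X (root X) = points X" by (rule r10)
  show "\<alpha> \<in> level X n \<Longrightarrow> \<exists>J. J \<subseteq> level X (Suc n) \<and> cell X \<alpha> = (\<Union>\<beta>\<in>J. cell X \<beta>)"
    by (rule r11[rule_format])
  show "\<lbrakk>\<alpha> \<in> level X n; \<beta> \<in> level X n; \<alpha> \<noteq> \<beta>\<rbrakk>
      \<Longrightarrow> cell X \<alpha> \<inter> cell X \<beta> = vtx X \<alpha> \<inter> vtx X \<beta>" by (rule r12[rule_format])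
  show "(\<forall>k::nat. a k \<in> indices X) \<and> (\<forall>k. cell X (a (Suc k)) \<subset> cell X (a k))
      \<Longrightarrow> \<exists>x\<in>points X. (\<Inter>k. cell X (a k)) = {x}" by (rule r[rule_format]) auto
qed

lemma nested_cells:
  assumes "\<And>k. a k \<in> indices X" "\<And>k::nat. cell X (a (Suc k)) \<subset> cell X (a k)"
  shows "\<exists>x. (\<Inter>k. cell X (a k)) = {x}"
  using nested_cells_point[of a] assms by blast

lemma idx: "\<alpha> \<in> level X n \<Longrightarrow> \<alpha> \<in> indices X"
  by (auto simp: indices_def)

lemma root_idx: "root X \<in> level X 0"
  by (simp add: level_0)

lemma vtx_nonempty: "\<alpha> \<in> indices X \<Longrightarrow> vtx X \<alpha> \<noteq> {}"
  using vtx_card by force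

definition sub :: "nat \<Rightarrow> 'i \<Rightarrow> 'i set" where
  "sub n \<alpha> = {\<beta> \<in> level X n. cell X \<beta> \<subseteq> cell X \<alpha>}"

lemma subD: "\<beta> \<in> sub n \<alpha> \<Longrightarrow> \<beta> \<in> level X n" "\<beta> \<in> sub n \<alpha> \<Longrightarrow> cell X \<beta> \<subseteq> cell X \<alpha>"
  by (auto simp: sub_def)

lemma sub_finite [simp]: "finite (sub n \<alpha>)"
  by (rule finite_subset[OF _ level_finite[of n]]) (auto simp: sub_def)

lemma cell_sub_union:
  assumes a: "\<alpha> \<in> level X m" and "m \<le> n"
  shows "cell X \<alpha> = (\<Union>\<beta>\<in>sub n \<alpha>. cell X \<beta>)"
  using \<open>m \<le> n\<close>
proof (induction n rule: dec_induct)
  case base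
  then show ?case using a by (auto simp: sub_def)
next
  case (step n)
  show ?case
  proof
    show "cell X \<alpha> \<subseteq> (\<Union>\<beta>\<in>sub (Suc n) \<alpha>. cell X \<beta>)"
    proof
      fix x assume "x \<in> cell X \<alpha>"
      then obtain \<beta> where b: "\<beta> \<in> sub n \<alpha>" and x: "x \<in> cell X \<beta>" using step.IH by auto
      obtain J where J: "J \<subseteq> level X (Suc n)" "cell X \<beta> = (\<Union>\<gamma>\<in>J. cell X \<gamma>)"
        using cell_children[OF subD(1)[OF b]] by blast
      then obtain \<gamma> where "\<gamma> \<in> J" "x \<in> cell X \<gamma>" using x by auto
      moreover have "\<gamma> \<in> sub (Suc n) \<alpha>"
        using J \<open>\<gamma> \<in> J\<close> subD(2)[OF b] unfolding sub_def by blast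
      ultimately show "x \<in> (\<Union>\<beta>\<in>sub (Suc n) \<alpha>. cell X \<beta>)" by blast
    qed
  qed (auto simp: sub_def)
qed

text \<open>
  A connected metric space with more than one point is uncountable.
\<close>

lemma cell_not_subset_finite:
  assumes a: "\<alpha> \<in> indices X" and W: "finite W"
  shows "\<not> cell X \<alpha> \<subseteq> W"
proof
  assume "cell X \<alpha> \<subseteq> W"
  then have fin: "finite (cell X \<alpha>)" using W by (rule finite_subset)
  then have "cell X \<alpha> = {} \<or> (\<exists>x. cell X \<alpha> = {x})"
    using connected_finite_iff_sing[OF cell_connected[OF a]] by blast
  then have "card (cell X \<alpha>) \<le> 1" by auto
  moreover have "card (vtx X \<alpha>) \<le> card (cell X \<alpha>)" by (rule card_mono[OF fin vtx_cell[OF a]])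
  ultimately show False using vtx_card[OF a] by simp
qed

lemma sub_root: "sub n (root X) = level X n"
  using cell_points idx by (auto simp: sub_def cell_root)

lemma level_cover: "points X = (\<Union>\<alpha>\<in>level X n. cell X \<alpha>)"
  using cell_sub_union[OF root_idx, of n] by (simp add: cell_root sub_root)

text \<open>
  A cell that is not among the subcells of level-\<open>m\<close> cells would meet each of them in
  vertices only, hence be finite, which a nontrivial connected set is not.
\<close>

lemma parent_exists:
  assumes b: "\<beta> \<in> level X n" and mn: "m \<le> n"
  shows "\<exists>\<alpha>\<in>level X m. \<beta> \<in> sub n \<alpha>"
proof (rule ccontr)
  assume no: "\<not> (\<exists>\<alpha>\<in>level X m. \<beta> \<in> sub n \<alpha>)"
  have "cell X \<beta> \<subseteq> vtx X \<beta>"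
  proof
    fix x assume x: "x \<in> cell X \<beta>"
    then have "x \<in> points X" using cell_points[OF idx[OF b]] by blast
    then obtain \<alpha> where a: "\<alpha> \<in> level X m" "x \<in> cell X \<alpha>" using level_cover[of m] by blast
    then obtain \<gamma> where g: "\<gamma> \<in> sub n \<alpha>" "x \<in> cell X \<gamma>" using cell_sub_union[OF a(1) mn] by blast
    then have "\<gamma> \<noteq> \<beta>" using no a by blast
    then show "x \<in> vtx X \<beta>" using cell_inter[OF subD(1)[OF g(1)] b] x g by blast
  qed
  then show False using cell_not_subset_finite[OF idx[OF b] vtx_finite[OF idx[OF b]]] by blast
qed

lemma parent_unique:
  assumes b: "\<beta> \<in> indices X" and a: "\<alpha> \<in> level X m" "\<alpha>' \<in> level X m"
    and "cell X \<beta> \<subseteq> cell X \<alpha>" "cell X \<beta> \<subseteq> cell X \<alpha>'"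
  shows "\<alpha> = \<alpha>'"
proof (rule ccontr)
  assume "\<alpha> \<noteq> \<alpha>'"
  then have "cell X \<beta> \<subseteq> vtx X \<alpha>" using cell_inter[OF a] assms by blast
  then show False using cell_not_subset_finite[OF b vtx_finite[OF idx[OF a(1)]]] by blast
qed

text \<open>
  The tree structure: a subcell passes through a unique ancestor at each intermediate level.
\<close>

lemma sub_decompose:
  assumes a: "\<alpha> \<in> level X m" and "m \<le> k" "k \<le> n"
  shows "sub n \<alpha> = (\<Union>\<gamma>\<in>sub k \<alpha>. sub n \<gamma>)"
proof
  show "sub n \<alpha> \<subseteq> (\<Union>\<gamma>\<in>sub k \<alpha>. sub n \<gamma>)"
  proof
    fix \<beta> assume b: "\<beta> \<in> sub n \<alpha>"
    then obtain \<gamma> where g: "\<gamma> \<in> level X k" "\<beta> \<in> sub n \<gamma>" using parent_exists[OF subD(1) \<open>k \<le> n\<close>] by blast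
    obtain \<alpha>' where a': "\<alpha>' \<in> level X m" "\<gamma> \<in> sub k \<alpha>'" using parent_exists[OF g(1) \<open>m \<le> k\<close>] by blast
    have "\<alpha> = \<alpha>'"
      using parent_unique[OF idx[OF subD(1)[OF b]] a a'(1)] subD(2)[OF b] subD(2)[OF g(2)] subD(2)[OF a'(2)]
      by blast
    then show "\<beta> \<in> (\<Union>\<gamma>\<in>sub k \<alpha>. sub n \<gamma>)" using a' g by blast
  qed
qed (auto simp: sub_def)

lemma sum_sub_decompose:
  assumes a: "\<alpha> \<in> level X m" and "m \<le> k" "k \<le> n"
  shows "(\<Sum>\<beta>\<in>sub n \<alpha>. w \<beta>) = (\<Sum>\<gamma>\<in>sub k \<alpha>. \<Sum>\<beta>\<in>sub n \<gamma>. w \<beta>)"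
  unfolding sub_decompose[OF assms]
proof (rule sum.UNION_disjoint)
  show "\<forall>i\<in>sub k \<alpha>. \<forall>j\<in>sub k \<alpha>. i \<noteq> j \<longrightarrow> sub n i \<inter> sub n j = {}"
    using parent_unique idx unfolding sub_def by blast
qed auto

subsection \<open>Vertices\<close>

definition subvertices :: "nat \<Rightarrow> 'i \<Rightarrow> 'a set" where
  "subvertices n \<alpha> = (\<Union>\<beta>\<in>sub n \<alpha>. vtx X \<beta>)"

lemma subvertices_root: "subvertices n (root X) = level_vertices X n"
  by (simp add: subvertices_def level_vertices_def sub_root)

lemma subvertices_finite: "finite (subvertices n \<alpha>)"
  unfolding subvertices_def using vtx_finite idx subD(1)[of _ n \<alpha>] by (intro finite_UN_I) auto

lemma vtx_sub_mono:
  assumes a: "\<alpha> \<in> level X m" and mn: "m \<le> n"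
  shows "vtx X \<alpha> \<subseteq> subvertices n \<alpha>"
  unfolding subvertices_def
proof (rule vtx_refine[OF idx[OF a] _ _ cell_sub_union[OF a mn]])
  show "sub n \<alpha> \<subseteq> indices X" using idx subD(1) by blast
qed simp

lemma subvertices_mono:
  assumes a: "\<alpha> \<in> level X m" and mk: "m \<le> k" and kn: "k \<le> n"
  shows "subvertices k \<alpha> \<subseteq> subvertices n \<alpha>"
proof
  fix p assume "p \<in> subvertices k \<alpha>"
  then obtain \<gamma> where g: "\<gamma> \<in> sub k \<alpha>" "p \<in> vtx X \<gamma>" by (auto simp: subvertices_def)
  then have "p \<in> subvertices n \<gamma>" using vtx_sub_mono[OF subD(1) kn] by blast
  then show "p \<in> subvertices n \<alpha>"
    using g sub_decompose[OF a mk kn] unfolding subvertices_def by blast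
qed

lemma level_vertices_mono: "k \<le> n \<Longrightarrow> level_vertices X k \<subseteq> level_vertices X n"
  using subvertices_mono[OF root_idx, of k n] by (simp add: subvertices_root)

lemma vertex_of_cell:
  assumes b: "\<beta> \<in> level X n" and p: "p \<in> level_vertices X n" "p \<in> cell X \<beta>"
  shows "p \<in> vtx X \<beta>"
proof -
  obtain \<gamma> where g: "\<gamma> \<in> level X n" "p \<in> vtx X \<gamma>" using p by (auto simp: level_vertices_def)
  then have "p \<in> cell X \<gamma>" using vtx_cell[OF idx] by blast
  then show ?thesis using cell_inter[OF b g(1)] g p by blast
qed

lemma subvertices_eq:
  assumes a: "\<alpha> \<in> level X m" and mn: "m \<le> n"
  shows "subvertices n \<alpha> = level_vertices X n \<inter> cell X \<alpha>"
proof
  show "subvertices n \<alpha> \<subseteq> level_vertices X n \<inter> cell X \<alpha>"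
    using vtx_cell[OF idx] unfolding subvertices_def level_vertices_def sub_def by blast
  show "level_vertices X n \<inter> cell X \<alpha> \<subseteq> subvertices n \<alpha>"
  proof
    fix p assume p: "p \<in> level_vertices X n \<inter> cell X \<alpha>"
    then obtain \<beta> where "\<beta> \<in> sub n \<alpha>" "p \<in> cell X \<beta>" using cell_sub_union[OF a mn] by auto
    moreover from this p have "p \<in> vtx X \<beta>" using vertex_of_cell[OF subD(1)] by blast
    ultimately show "p \<in> subvertices n \<alpha>" by (auto simp: subvertices_def)
  qed
qed

text \<open>
  This exhaustion by finite sets is what the limit of traces needs.
\<close>

lemma all_vertices_cell:
  assumes a: "\<alpha> \<in> level X m"
  shows "(\<Union>n. subvertices (m + n) \<alpha>) = all_vertices X \<inter> cell X \<alpha>"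
proof
  show "(\<Union>n. subvertices (m + n) \<alpha>) \<subseteq> all_vertices X \<inter> cell X \<alpha>"
    using subvertices_eq[OF a] by (auto simp: all_vertices_def)
  show "all_vertices X \<inter> cell X \<alpha> \<subseteq> (\<Union>n. subvertices (m + n) \<alpha>)"
  proof
    fix p assume p: "p \<in> all_vertices X \<inter> cell X \<alpha>"
    then obtain n where "p \<in> level_vertices X n" by (auto simp: all_vertices_def)
    then have "p \<in> level_vertices X (m + n)" using level_vertices_mono[of n "m + n"] by auto
    then have "p \<in> subvertices (m + n) \<alpha>" using p subvertices_eq[OF a, of "m + n"] by simp
    then show "p \<in> (\<Union>n. subvertices (m + n) \<alpha>)" by blast
  qed
qed

lemma all_vertices_points: "all_vertices X \<subseteq> points X"
  using vtx_cell cell_points idx unfolding all_vertices_def level_vertices_def by blast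

lemma all_vertices_countable: "countable (all_vertices X)"
proof -
  have "finite (level_vertices X n)" for n
    using subvertices_finite[of n "root X"] by (simp add: subvertices_root)
  then show ?thesis unfolding all_vertices_def by (auto intro: countable_finite)
qed

lemma vtx_all: "\<alpha> \<in> indices X \<Longrightarrow> vtx X \<alpha> \<subseteq> all_vertices X"
  unfolding all_vertices_def level_vertices_def indices_def by blast

subsection \<open>Cells shrink\<close>

text \<open>
  Koenig's lemma: if large cells occurred at all levels, there would be a branch of large cells, and
  by compactness its intersection could not be a single point.
\<close>

lemma cells_shrink:
  assumes e: "e > 0"
  shows "\<exists>n0. \<forall>n\<ge>n0. \<forall>\<alpha>\<in>level X n. \<forall>x\<in>cell X \<alpha>. \<forall>y\<in>cell X \<alpha>. dist x y < e"
proof (rule ccontr)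
  define big where "big = (\<lambda>\<alpha>. \<exists>x\<in>cell X \<alpha>. \<exists>y\<in>cell X \<alpha>. dist x y \<ge> e)"
  \<comment> \<open>cells with large descendants at all later levels; by finiteness some child inherits this\<close>
  define P where "P = (\<lambda>n \<alpha>. \<alpha> \<in> level X n \<and> (\<forall>k\<ge>n. \<exists>\<beta>\<in>sub k \<alpha>. big \<beta>))"
  assume "\<not> ?thesis"
  then have inf: "\<exists>n\<ge>n0. \<exists>\<alpha>\<in>level X n. big \<alpha>" for n0 by (force simp: big_def not_less)
  have big_mono: "big \<beta> \<Longrightarrow> \<beta> \<in> sub k \<alpha> \<Longrightarrow> big \<alpha>" for \<alpha> \<beta> k
    unfolding big_def sub_def by blast
  have "P 0 (root X)"
    unfolding P_def
  proof (intro conjI allI impI)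
    fix k :: nat
    obtain n \<alpha> where na: "n \<ge> k" "\<alpha> \<in> level X n" "big \<alpha>" using inf by blast
    obtain \<gamma> where g: "\<gamma> \<in> level X k" "\<alpha> \<in> sub n \<gamma>" using parent_exists[OF na(2,1)] by blast
    have "big \<gamma>" by (rule big_mono[OF na(3) g(2)])
    then show "\<exists>\<beta>\<in>sub k (root X). big \<beta>" using g by (auto simp: sub_root)
  qed (rule root_idx)
  moreover have "\<exists>\<beta>. P (Suc n) \<beta> \<and> cell X \<beta> \<subset> cell X \<alpha>" if P: "P n \<alpha>" for n \<alpha>
  proof -
    have a: "\<alpha> \<in> level X n" using P by (simp add: P_def)
    have "\<exists>\<beta>\<in>sub (Suc n) \<alpha>. P (Suc n) \<beta>"
    proof (rule ccontr)
      assume no: "\<not> ?thesis"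
      have "\<exists>k\<ge>Suc n. \<forall>\<gamma>\<in>sub k \<beta>. \<not> big \<gamma>" if "\<beta> \<in> sub (Suc n) \<alpha>" for \<beta>
        using no that subD(1) unfolding P_def by blast
      then obtain k where k: "\<And>\<beta>. \<beta> \<in> sub (Suc n) \<alpha> \<Longrightarrow> k \<beta> \<ge> Suc n"
        "\<And>\<beta> \<gamma>. \<beta> \<in> sub (Suc n) \<alpha> \<Longrightarrow> \<gamma> \<in> sub (k \<beta>) \<beta> \<Longrightarrow> \<not> big \<gamma>" by metis
      define K where "K = Max (insert (Suc n) (k ` sub (Suc n) \<alpha>))"
      have K: "K \<ge> Suc n" "\<And>\<beta>. \<beta> \<in> sub (Suc n) \<alpha> \<Longrightarrow> k \<beta> \<le> K"
        by (auto simp: K_def intro!: Max_ge)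
      obtain \<gamma> where g: "\<gamma> \<in> sub K \<alpha>" "big \<gamma>" using P K(1) by (auto simp: P_def dest: Suc_leD)
      then obtain \<beta> where b: "\<beta> \<in> sub (Suc n) \<alpha>" "\<gamma> \<in> sub K \<beta>"
        using sub_decompose[OF a _ K(1)] by auto
      then obtain \<delta> where d: "\<delta> \<in> sub (k \<beta>) \<beta>" "\<gamma> \<in> sub K \<delta>"
        using sub_decompose[OF subD(1)[OF b(1)] k(1)[OF b(1)] K(2)[OF b(1)]] by auto
      show False using k(2)[OF b(1) d(1)] big_mono[OF g(2) d(2)] by blast
    qed
    then obtain \<beta> where b: "\<beta> \<in> sub (Suc n) \<alpha>" "P (Suc n) \<beta>" by blast
    have "\<beta> \<noteq> \<alpha>" using level_disjoint[of n "Suc n"] a subD(1)[OF b(1)] by auto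
    then have "cell X \<beta> \<noteq> cell X \<alpha>"
      using inj_cell idx[OF a] idx[OF subD(1)[OF b(1)]] by (auto dest: inj_onD)
    then show ?thesis using b subD(2) by blast
  qed
  ultimately obtain a where a: "\<And>n. P n (a n)" "\<And>n. cell X (a (Suc n)) \<subset> cell X (a n)"
    using dependent_nat_choice[of P "\<lambda>n \<alpha> \<beta>. cell X \<beta> \<subset> cell X \<alpha>"] by metis
  have al: "a n \<in> level X n" for n using a(1) by (simp add: P_def)
  obtain x where x: "(\<Inter>k. cell X (a k)) = {x}"
    using nested_cells[of a, OF idx[OF al] a(2)] by blast
  have dec: "m \<le> n \<Longrightarrow> cell X (a n) \<subseteq> cell X (a m)" for m n
    by (induction n rule: dec_induct) (use a(2) in auto)
  have "\<exists>n. cell X (a n) \<subseteq> ball x (e/2)"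
  proof (rule ccontr)
    assume no: "\<not> ?thesis"
    then have "\<forall>n. \<exists>y. y \<in> cell X (a n) \<and> dist x y \<ge> e/2" by (force simp: not_less)
    then obtain y where y: "\<And>n. y n \<in> cell X (a n)" "\<And>n. dist x (y n) \<ge> e/2" by metis
    have "\<forall>n. y n \<in> cell X (a 0)" using y(1) dec[of 0] by blast
    then obtain l r where r: "strict_mono r" and l: "(y \<circ> r) \<longlonglongrightarrow> l"
      using cell_compact[OF idx[OF al[of 0]]] unfolding compact_def by metis
    have "l \<in> cell X (a k)" for k
    proof (rule Lim_in_closed_set[OF _ _ _ l])
      show "closed (cell X (a k))" by (rule compact_imp_closed[OF cell_compact[OF idx[OF al]]])
      show "eventually (\<lambda>n. (y \<circ> r) n \<in> cell X (a k)) sequentially"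
        using eventually_ge_at_top[of k]
      proof eventually_elim
        case (elim n)
        then have "k \<le> r n" using seq_suble[OF r, of n] by simp
        then show ?case using y(1)[of "r n"] dec[of k "r n"] by auto
      qed
    qed simp
    then have "l = x" using x by blast
    moreover have "(\<lambda>n. dist x ((y \<circ> r) n)) \<longlonglongrightarrow> dist x l" by (intro tendsto_intros l)
    then have "e/2 \<le> dist x l" using y(2) by (intro LIMSEQ_le_const[of _ "dist x l"]) auto
    ultimately show False using e by simp
  qed
  then obtain n where n: "cell X (a n) \<subseteq> ball x (e/2)" by blast
  obtain \<beta> where "\<beta> \<in> sub n (a n)" "big \<beta>" using a(1) by (auto simp: P_def)
  then have "big (a n)" by (auto intro: big_mono)
  then obtain y z where "y \<in> cell X (a n)" "z \<in> cell X (a n)" "dist y z \<ge> e" by (auto simp: big_def)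
  moreover from this n have "dist x y < e / 2" "dist x z < e / 2" by auto
  ultimately show False using dist_triangle_half_r[of x y e z] by simp
qed

end

context resform
begin

lemma minimiserI:
  assumes u: "u \<in> D" and uf: "agree_on U u f"
    and orth: "\<And>w. w \<in> D \<Longrightarrow> agree_on U w (\<lambda>_. 0) \<Longrightarrow> E u w = 0"
  shows "minimiser U f u"
  unfolding minimiser_def
proof (intro conjI ballI impI)
  fix w assume w: "w \<in> D" "agree_on U w f"
  have "E u (\<lambda>x. w x - u x) = 0"
    using w uf by (intro orth D_intros u) (auto simp: agree_on_def)
  then have "E u w = E u u" using w u by (simp add: E_diff_right)
  then show "E u u \<le> E w w"
    using E_nonneg[OF D_diff[OF w(1) u]] E_diff_sq[OF w(1) u] E_sym[OF u w(1)] by simp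
qed (use u uf in auto)

lemma D_sum: "finite I \<Longrightarrow> (\<And>i. i \<in> I \<Longrightarrow> w i \<in> D) \<Longrightarrow> (\<lambda>x. \<Sum>i\<in>I. c i * w i x) \<in> D"
  by (induction I rule: finite_induct) (auto intro!: D_intros)

lemma E_sum_left: "finite I \<Longrightarrow> (\<And>i. i \<in> I \<Longrightarrow> w i \<in> D) \<Longrightarrow> z \<in> D \<Longrightarrow>
    E (\<lambda>x. \<Sum>i\<in>I. c i * w i x) z = (\<Sum>i\<in>I. c i * E (w i) z)"
proof (induction I rule: finite_induct)
  case empty
  then show ?case using E_const[of z 0] E_sym[OF _ D_const, of z 0] by simp
next
  case (insert i I)
  have "E (\<lambda>x. c i * w i x + (\<Sum>i\<in>I. c i * w i x)) z
      = E (\<lambda>x. c i * w i x) z + E (\<lambda>x. \<Sum>i\<in>I. c i * w i x) z"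
    using insert by (intro E_add_left D_scale D_sum) auto
  also have "\<dots> = c i * E (w i) z + (\<Sum>i\<in>I. c i * E (w i) z)"
    using insert E_scale_left[of "w i" z "c i"] by simp
  finally show ?case using insert(1,2) by simp
qed

end

section \<open>Forms on cells\<close>

locale form_cells = cells X for X :: "('a::metric_space, 'i, 'z) form_fractal_scheme" +
  assumes sf: "splitting_form X"
begin

lemma cell_form: "\<alpha> \<in> indices X \<Longrightarrow> resform (all_vertices X \<inter> cell X \<alpha>) (form_dom X \<alpha>) (form X \<alpha>)"
  using sf unfolding splitting_form_def by (auto intro: resform.intro)

lemma root_form: "resform (all_vertices X) (Dom X) (energy X)"
proof -
  have "all_vertices X \<inter> cell X (root X) = all_vertices X"
    using all_vertices_points by (auto simp: cell_root)
  then show ?thesis using cell_form[OF idx[OF root_idx]] by simp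
qed

lemma splitting:
  assumes "\<alpha> \<in> level X m" "m \<le> n"
  shows "f \<in> form_dom X \<alpha> \<longleftrightarrow> (\<forall>\<beta>\<in>sub n \<alpha>. f \<in> form_dom X \<beta>)"
    and "f \<in> form_dom X \<alpha> \<Longrightarrow> form X \<alpha> f f = (\<Sum>\<beta>\<in>sub n \<alpha>. form X \<beta> f f)"
proof -
  have *: "(\<forall>f. f \<in> form_dom X \<alpha> \<longleftrightarrow>
           (\<forall>\<beta>\<in>level X n. cell X \<beta> \<subseteq> cell X \<alpha> \<longrightarrow> f \<in> form_dom X \<beta>)) \<and>
        (\<forall>f\<in>form_dom X \<alpha>.
           form X \<alpha> f f = (\<Sum>\<beta>\<in>{\<beta>\<in>level X n. cell X \<beta> \<subseteq> cell X \<alpha>}. form X \<beta> f f))"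
    using sf assms unfolding splitting_form_def by blast
  show "f \<in> form_dom X \<alpha> \<longleftrightarrow> (\<forall>\<beta>\<in>sub n \<alpha>. f \<in> form_dom X \<beta>)"
    using * unfolding sub_def by blast
  show "f \<in> form_dom X \<alpha> \<Longrightarrow> form X \<alpha> f f = (\<Sum>\<beta>\<in>sub n \<alpha>. form X \<beta> f f)"
    using * unfolding sub_def by blast
qed

abbreviation cell_trace :: "'i \<Rightarrow> ('a \<Rightarrow> real) \<Rightarrow> real" where
  "cell_trace \<alpha> \<equiv> trace_energy X \<alpha> (vtx X \<alpha>)"

definition cell_bilinear :: "'i \<Rightarrow> ('a \<Rightarrow> real) \<Rightarrow> ('a \<Rightarrow> real) \<Rightarrow> real" where
  "cell_bilinear \<alpha> = resform.trace_form (form_dom X \<alpha>) (form X \<alpha>) (vtx X \<alpha>)"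

lemma trace_energy_tr:
  "\<alpha> \<in> indices X \<Longrightarrow> trace_energy X \<alpha> U f = resform.trace_on (form_dom X \<alpha>) (form X \<alpha>) U f"
  by (simp add: resform.trace_on_def[OF cell_form] trace_energy_def)

lemma vtx_in_form:
  "\<alpha> \<in> indices X \<Longrightarrow> vtx X \<alpha> \<subseteq> all_vertices X \<inter> cell X \<alpha>"
  using vtx_all vtx_cell by auto

text \<open>
  Minimisers on the subcells fit together, since distinct cells of one level meet in common vertices,
  where the values are prescribed.
\<close>

lemma trace_subvertices:
  assumes a: "\<alpha> \<in> level X m" and mn: "m \<le> n"
  shows "trace_energy X \<alpha> (subvertices n \<alpha>) f = (\<Sum>\<beta>\<in>sub n \<alpha>. cell_trace \<beta> f)"
proof -
  interpret A: resform "all_vertices X \<inter> cell X \<alpha>" "form_dom X \<alpha>" "form X \<alpha>"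
    by (rule cell_form[OF idx[OF a]])
  have "\<exists>w. resform.minimiser (form_dom X \<beta>) (form X \<beta>) (vtx X \<beta>) f w" if "\<beta> \<in> sub n \<alpha>" for \<beta>
    using resform.minimiser_exists[OF cell_form vtx_finite vtx_in_form vtx_nonempty] idx[OF subD(1)[OF that]]
    by blast
  then obtain w where w: "\<And>\<beta>. \<beta> \<in> sub n \<alpha> \<Longrightarrow>
      resform.minimiser (form_dom X \<beta>) (form X \<beta>) (vtx X \<beta>) f (w \<beta>)" by metis
  note wD = resform.minimiserD(1)[OF cell_form w] and wf = resform.minimiserD(2)[OF cell_form w]
  \<comment> \<open>at a vertex of several cells the choice is immaterial: the value there is prescribed\<close>
  define u where "u = (\<lambda>x. w (SOME \<beta>. \<beta> \<in> sub n \<alpha> \<and> x \<in> cell X \<beta>) x)"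
  have wu: "w \<beta> x = u x" if b: "\<beta> \<in> sub n \<alpha>" and x: "x \<in> cell X \<beta>" for \<beta> x
  proof -
    define \<gamma> where "\<gamma> = (SOME \<beta>. \<beta> \<in> sub n \<alpha> \<and> x \<in> cell X \<beta>)"
    have g: "\<gamma> \<in> sub n \<alpha>" "x \<in> cell X \<gamma>"
      using someI[of "\<lambda>\<beta>. \<beta> \<in> sub n \<alpha> \<and> x \<in> cell X \<beta>" \<beta>] b x by (auto simp: \<gamma>_def)
    have "w \<beta> x = w \<gamma> x"
    proof (cases "\<beta> = \<gamma>")
      case False
      then have "x \<in> vtx X \<beta>" "x \<in> vtx X \<gamma>"
        using cell_inter[OF subD(1)[OF b] subD(1)[OF g(1)]] x g(2) by blast+
      then show ?thesis
        using wf[OF idx[OF subD(1)[OF b]] b] wf[OF idx[OF subD(1)[OF g(1)]] g(1)]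
        by (auto simp: agree_on_def)
    qed simp
    then show ?thesis by (simp add: u_def \<gamma>_def)
  qed
  have ag: "agree_on (all_vertices X \<inter> cell X \<beta>) (w \<beta>) u" if "\<beta> \<in> sub n \<alpha>" for \<beta>
    using wu[OF that] by (simp add: agree_on_def)
  have uD\<beta>: "u \<in> form_dom X \<beta>" if b: "\<beta> \<in> sub n \<alpha>" for \<beta>
    using resform.D_agree[OF cell_form wD[OF _ b] ag[OF b]] idx[OF subD(1)[OF b]] by blast
  have uE\<beta>: "form X \<beta> u u = cell_trace \<beta> f" if b: "\<beta> \<in> sub n \<alpha>" for \<beta>
  proof -
    have i: "\<beta> \<in> indices X" by (rule idx[OF subD(1)[OF b]])
    have "form X \<beta> u u = form X \<beta> (w \<beta>) (w \<beta>)"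
      using resform.E_agree[OF cell_form[OF i] wD[OF i b] wD[OF i b] uD\<beta>[OF b] uD\<beta>[OF b] ag[OF b] ag[OF b]]
      by simp
    then show ?thesis using resform.trace_on_eq[OF cell_form[OF i] w[OF b]] by (simp add: trace_energy_tr[OF i])
  qed
  have uD: "u \<in> form_dom X \<alpha>" using splitting(1)[OF a mn] uD\<beta> by blast
  have uE: "form X \<alpha> u u = (\<Sum>\<beta>\<in>sub n \<alpha>. cell_trace \<beta> f)"
    using splitting(2)[OF a mn uD] uE\<beta> by simp
  have "A.minimiser (subvertices n \<alpha>) f u"
    unfolding A.minimiser_def
  proof (intro conjI ballI impI uD)
    show "agree_on (subvertices n \<alpha>) u f"
      unfolding agree_on_def subvertices_def
    proof (intro ballI)
      fix x assume "x \<in> (\<Union>\<beta>\<in>sub n \<alpha>. vtx X \<beta>)"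
      then obtain \<beta> where b: "\<beta> \<in> sub n \<alpha>" "x \<in> vtx X \<beta>" by blast
      have i: "\<beta> \<in> indices X" by (rule idx[OF subD(1)[OF b(1)]])
      have "w \<beta> x = f x" using wf[OF i b(1)] b(2) by (simp add: agree_on_def)
      moreover have "w \<beta> x = u x" using wu[OF b(1)] b(2) vtx_cell[OF i] by blast
      ultimately show "u x = f x" by simp
    qed
    fix z assume z: "z \<in> form_dom X \<alpha>" "agree_on (subvertices n \<alpha>) z f"
    have "cell_trace \<beta> f \<le> form X \<beta> z z" if b: "\<beta> \<in> sub n \<alpha>" for \<beta>
    proof -
      have i: "\<beta> \<in> indices X" by (rule idx[OF subD(1)[OF b]])
      have "agree_on (vtx X \<beta>) z f" using z(2) b by (auto simp: agree_on_def subvertices_def)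
      then have "form X \<beta> (w \<beta>) (w \<beta>) \<le> form X \<beta> z z"
        using splitting(1)[OF a mn] z(1) b by (intro resform.minimiserD(3)[OF cell_form[OF i] w[OF b]]) auto
      then show ?thesis using resform.trace_on_eq[OF cell_form[OF i] w[OF b]] by (simp add: trace_energy_tr[OF i])
    qed
    then show "form X \<alpha> u u \<le> form X \<alpha> z z"
      unfolding uE splitting(2)[OF a mn z(1)] by (rule sum_mono)
  qed
  then show ?thesis using A.trace_on_eq uE by (simp add: trace_energy_tr[OF idx[OF a]])
qed

lemma subvertices_exhaust:
  assumes a: "\<alpha> \<in> level X m"
  shows "\<And>n. finite (subvertices (m + n) \<alpha>)"
    and "\<And>k n. k \<le> n \<Longrightarrow> subvertices (m + k) \<alpha> \<subseteq> subvertices (m + n) \<alpha>"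
    and "(\<Union>n. subvertices (m + n) \<alpha>) = all_vertices X \<inter> cell X \<alpha>"
    and "\<And>n. subvertices (m + n) \<alpha> \<noteq> {}"
proof -
  show "subvertices (m + n) \<alpha> \<noteq> {}" for n
    using vtx_sub_mono[OF a, of "m + n"] vtx_nonempty[OF idx[OF a]] by auto
qed (use subvertices_finite subvertices_mono[OF a] all_vertices_cell[OF a] in auto)

text \<open>
  By \<open>trace_subvertices\<close> and \<open>bounded_traces\<close>, the trace energies of
  small subcells decide membership in the domain of a cell form and compute it.
\<close>

theorem cell_energy_bounded:
  assumes a: "\<alpha> \<in> level X m" and B: "\<And>n. m \<le> n \<Longrightarrow> (\<Sum>\<beta>\<in>sub n \<alpha>. cell_trace \<beta> f) \<le> B"
  shows "f \<in> form_dom X \<alpha> \<and> (\<lambda>n. \<Sum>\<beta>\<in>sub (m + n) \<alpha>. cell_trace \<beta> f) \<longlonglongrightarrow> form X \<alpha> f f"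
proof -
  have "resform.trace_on (form_dom X \<alpha>) (form X \<alpha>) (subvertices (m + n) \<alpha>) f = (\<Sum>\<beta>\<in>sub (m + n) \<alpha>. cell_trace \<beta> f)" for n
    using trace_subvertices[OF a, of "m + n" f] by (simp add: trace_energy_tr[OF idx[OF a]])
  then show ?thesis
    using resform.bounded_traces[OF cell_form[OF idx[OF a]], OF subvertices_exhaust[OF a], of f B] B
    by simp
qed

lemma level_vertices_exhaust:
  shows "\<And>n. finite (level_vertices X n)"
    and "\<And>m n. m \<le> n \<Longrightarrow> level_vertices X m \<subseteq> level_vertices X n"
    and "(\<Union>n. level_vertices X n) = all_vertices X"
    and "\<And>n. level_vertices X n \<noteq> {}"
  using subvertices_exhaust(1,4)[OF root_idx] level_vertices_mono
  by (auto simp: subvertices_root all_vertices_def)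

subsection \<open>Cell traces\<close>

lemmas ct_rules = cell_form vtx_finite vtx_in_form vtx_nonempty

lemma cell_trace_bilinear: "\<alpha> \<in> indices X \<Longrightarrow> cell_trace \<alpha> f = cell_bilinear \<alpha> f f"
  by (simp add: trace_energy_tr cell_bilinear_def resform.trace_on_trace_form[OF ct_rules])

lemma cell_trace_nonneg: "\<alpha> \<in> indices X \<Longrightarrow> cell_trace \<alpha> f \<ge> 0"
  by (simp add: trace_energy_tr resform.trace_on_nonneg[OF ct_rules])

lemma cell_bilinear_sym: "\<alpha> \<in> indices X \<Longrightarrow> cell_bilinear \<alpha> f g = cell_bilinear \<alpha> g f"
  unfolding cell_bilinear_def by (rule resform.trace_form_sym[OF ct_rules])

lemma cell_bilinear_sum:
  "\<alpha> \<in> indices X \<Longrightarrow> finite I \<Longrightarrow> cell_bilinear \<alpha> f (\<lambda>x. \<Sum>i\<in>I. c i * w i x) = (\<Sum>i\<in>I. c i * cell_bilinear \<alpha> f (w i))"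
  unfolding cell_bilinear_def by (rule resform.trace_form_sum[OF ct_rules])

lemma cell_trace_add:
  "\<alpha> \<in> indices X \<Longrightarrow> cell_trace \<alpha> (\<lambda>x. f x + g x) = cell_trace \<alpha> f + 2 * cell_bilinear \<alpha> f g + cell_trace \<alpha> g"
  by (simp add: trace_energy_tr cell_bilinear_def resform.trace_on_add[OF ct_rules])

lemma cell_bilinear_le:
  "\<alpha> \<in> indices X \<Longrightarrow> (cell_bilinear \<alpha> f g)\<^sup>2 \<le> cell_trace \<alpha> f * cell_trace \<alpha> g"
  by (simp add: trace_energy_tr cell_bilinear_def resform.trace_form_Cauchy_Schwarz[OF ct_rules])

lemma cell_trace_contraction:
  assumes "\<alpha> \<in> indices X" "finite I"
    "\<And>p q. p \<in> vtx X \<alpha> \<Longrightarrow> q \<in> vtx X \<alpha> \<Longrightarrow> (u p - u q)\<^sup>2 \<le> K * (\<Sum>i\<in>I. (w i p - w i q)\<^sup>2)"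
  shows "cell_trace \<alpha> u \<le> K * (\<Sum>i\<in>I. cell_trace \<alpha> (w i))"
  using resform.trace_on_contraction[OF ct_rules, of \<alpha> I u K w] assms by (simp add: trace_energy_tr)

text \<open>
  Polarisation: test with the sum of two point masses.
\<close>

lemma quadratic_form_zero:
  fixes A :: "'b \<Rightarrow> 'b \<Rightarrow> real"
  assumes fin: "finite V" and sym: "\<And>p q. A p q = A q p"
    and zero: "\<And>f. (\<Sum>p\<in>V. f p * (\<Sum>q\<in>V. A p q * f q)) = 0"
    and p: "p \<in> V" and q: "q \<in> V"
  shows "A p q = 0"
proof -
  let ?i = "\<lambda>p x. if x = p then 1 else 0 :: real"
  have val: "(\<Sum>x\<in>V. ?i r x * b x) = b r" "(\<Sum>x\<in>V. b x * ?i r x) = b r" if "r \<in> V" for r and b :: "'b \<Rightarrow> real"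
  proof -
    have "(\<Sum>x\<in>V. ?i r x * b x) = (\<Sum>x\<in>V. if x = r then b x else 0)" by (rule sum.cong) auto
    then show *: "(\<Sum>x\<in>V. ?i r x * b x) = b r" using that fin by simp
    show "(\<Sum>x\<in>V. b x * ?i r x) = b r" using * by (simp only: mult.commute)
  qed
  have d: "A r r = 0" if "r \<in> V" for r
    using zero[of "?i r"] by (simp only: val[OF that])
  have "(\<Sum>x\<in>V. (?i p x + ?i q x) * (\<Sum>y\<in>V. A x y * (?i p y + ?i q y))) = A p p + A p q + (A q p + A q q)"
    by (simp only: distrib_left distrib_right sum.distrib val[OF p] val[OF q])
  then show ?thesis using zero[of "\<lambda>x. ?i p x + ?i q x"] d[OF p] d[OF q] sym[of p q] by simp
qed

text \<open>
  The matrix of a quadratic form is unique, so the description in \<open>cell_matrix\<close>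
  picks the one of the trace form.
\<close>

lemma cell_matrix_eq:
  assumes a: "\<alpha> \<in> indices X"
  shows "cell_matrix X \<alpha> = (\<lambda>p q. if p \<in> vtx X \<alpha> \<and> q \<in> vtx X \<alpha>
    then cell_bilinear \<alpha> (\<lambda>x. if x = p then 1 else 0) (\<lambda>x. if x = q then 1 else 0) else 0)"
    (is "_ = ?D")
proof -
  have ex: "cell_bilinear \<alpha> f g = (\<Sum>p\<in>vtx X \<alpha>. f p * (\<Sum>q\<in>vtx X \<alpha>. ?D p q * g q))" for f g
    unfolding cell_bilinear_def resform.trace_form_expand[OF ct_rules, OF a a a a, of f g]
    by (simp add: sum_distrib_left mult_ac)
  have D: "(\<forall>p q. ?D p q = ?D q p) \<and>
             (\<forall>p q. p \<notin> vtx X \<alpha> \<or> q \<notin> vtx X \<alpha> \<longrightarrow> ?D p q = 0) \<and>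
             (\<forall>f. cell_trace \<alpha> f = (\<Sum>p\<in>vtx X \<alpha>. f p * (\<Sum>q\<in>vtx X \<alpha>. ?D p q * f q)))"
  proof (intro conjI allI)
    show "?D p q = ?D q p" for p q
      using cell_bilinear_sym[OF a, of "\<lambda>x. if x = p then 1 else 0" "\<lambda>x. if x = q then 1 else 0"]
      by (simp only: conj_commute)
    show "p \<notin> vtx X \<alpha> \<or> q \<notin> vtx X \<alpha> \<longrightarrow> ?D p q = 0" for p q by simp
    show "cell_trace \<alpha> f = (\<Sum>p\<in>vtx X \<alpha>. f p * (\<Sum>q\<in>vtx X \<alpha>. ?D p q * f q))" for f
      using cell_trace_bilinear[OF a, of f] ex[of f f] by (simp only:)
  qed
  show ?thesis
    unfolding cell_matrix_def
  proof (rule the_equality, rule D, intro ext)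
    fix D' p q
    assume D': "(\<forall>p q. D' p q = D' q p) \<and>
             (\<forall>p q. p \<notin> vtx X \<alpha> \<or> q \<notin> vtx X \<alpha> \<longrightarrow> D' p q = 0) \<and>
             (\<forall>f. cell_trace \<alpha> f = (\<Sum>p\<in>vtx X \<alpha>. f p * (\<Sum>q\<in>vtx X \<alpha>. D' p q * f q)))"
    show "D' p q = ?D p q"
    proof (cases "p \<in> vtx X \<alpha> \<and> q \<in> vtx X \<alpha>")
      case True
      have "(\<lambda>p q. D' p q - ?D p q) p q = 0"
      proof (rule quadratic_form_zero[OF vtx_finite[OF a]])
        show "D' p q - ?D p q = D' q p - ?D q p" for p q
          using D'[THEN conjunct1, rule_format, of p q] D[THEN conjunct1, rule_format, of p q] by (simp only:)
        show "(\<Sum>p\<in>vtx X \<alpha>. f p * (\<Sum>q\<in>vtx X \<alpha>. (D' p q - ?D p q) * f q)) = 0" for f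
        proof -
          have "(\<Sum>p\<in>vtx X \<alpha>. f p * (\<Sum>q\<in>vtx X \<alpha>. (D' p q - ?D p q) * f q))
            = (\<Sum>p\<in>vtx X \<alpha>. f p * (\<Sum>q\<in>vtx X \<alpha>. D' p q * f q)) - (\<Sum>p\<in>vtx X \<alpha>. f p * (\<Sum>q\<in>vtx X \<alpha>. ?D p q * f q))"
            by (simp only: left_diff_distrib right_diff_distrib sum_subtractf)
          moreover have "cell_trace \<alpha> f = (\<Sum>p\<in>vtx X \<alpha>. f p * (\<Sum>q\<in>vtx X \<alpha>. ?D p q * f q))"
            using D by blast
          moreover have "cell_trace \<alpha> f = (\<Sum>p\<in>vtx X \<alpha>. f p * (\<Sum>q\<in>vtx X \<alpha>. D' p q * f q))"
            using D' by blast
          ultimately show ?thesis by linarith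
        qed
      qed (use True in auto)
      then show ?thesis by simp
    next
      case False
      then have "?D p q = 0" by (auto split: if_splits)
      moreover have "D' p q = 0" using D' False by blast
      ultimately show ?thesis by linarith
    qed
  qed
qed

end

section \<open>Martingale convergence along cells\<close>

locale cell_measure = cells X for X :: "('a::metric_space, 'i, 'z) fractal_scheme" +
  fixes N :: "'a measure"
  assumes sets_N: "sets N = sets (restrict_space borel (points X))"
    and atomless: "x \<in> points X \<Longrightarrow> emeasure N {x} = 0"
    and finite_N: "finite_measure N"
begin

sublocale finite_measure N
  by (rule finite_N)

lemma space_N: "space N = points X"
  using sets_eq_imp_space_eq[OF sets_N] by (simp add: space_restrict_space)

lemma borel_sets_N: "A \<in> sets borel \<Longrightarrow> A \<subseteq> points X \<Longrightarrow> A \<in> sets N"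
  using compact_imp_closed[OF compact_points] by (simp add: sets_N sets_restrict_space_iff)

lemma cell_sets [measurable]: "\<alpha> \<in> indices X \<Longrightarrow> cell X \<alpha> \<in> sets N"
  by (intro borel_sets_N cell_points borel_closed compact_imp_closed cell_compact)

lemma all_vertices_null: "all_vertices X \<in> null_sets N"
proof -
  have "(\<Union>x\<in>all_vertices X. {x}) \<in> null_sets N"
    using all_vertices_points
    by (intro null_sets_UN' all_vertices_countable null_setsI atomless borel_sets_N) auto
  then show ?thesis by simp
qed

lemma all_vertices_sets [measurable]: "all_vertices X \<in> sets N"
  using all_vertices_null by auto

lemma AE_not_vertex: "AE x in N. x \<notin> all_vertices X"
  by (rule AE_not_in[OF all_vertices_null])

lemma cell_of_point:
  assumes b: "\<beta> \<in> level X n" and g: "\<gamma> \<in> level X n" and x: "x \<in> cell X \<beta>" "x \<in> cell X \<gamma>"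
    and "x \<notin> all_vertices X"
  shows "\<beta> = \<gamma>"
  using cell_inter[OF b g] vtx_all[OF idx[OF b]] assms by blast

text \<open>
  Subcells overlap only in vertices, a null set: off it they form a partition.
\<close>

lemma indicator_cell:
  assumes a: "\<alpha> \<in> level X m" and mn: "m \<le> n" and x: "x \<notin> all_vertices X"
  shows "indicator (cell X \<alpha>) x = (\<Sum>\<beta>\<in>sub n \<alpha>. indicator (cell X \<beta>) x :: real)"
proof (cases "x \<in> cell X \<alpha>")
  case True
  then obtain \<beta> where b: "\<beta> \<in> sub n \<alpha>" "x \<in> cell X \<beta>" using cell_sub_union[OF a mn] by auto
  have "(\<Sum>\<gamma>\<in>sub n \<alpha>. indicator (cell X \<gamma>) x :: real) = (\<Sum>\<gamma>\<in>sub n \<alpha>. if \<gamma> = \<beta> then 1 else 0)"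
  proof (intro sum.cong refl)
    fix \<gamma> assume g: "\<gamma> \<in> sub n \<alpha>"
    show "indicator (cell X \<gamma>) x = (if \<gamma> = \<beta> then 1 else 0 :: real)"
    proof (cases "\<gamma> = \<beta>")
      case False
      then have "x \<notin> cell X \<gamma>" using cell_of_point[OF subD(1)[OF b(1)] subD(1)[OF g] b(2) _ x] by blast
      then show ?thesis using False by simp
    qed (use b in simp)
  qed
  then show ?thesis using True b by simp
next
  case False
  then show ?thesis using subD(2) by (auto intro!: sum.neutral[symmetric] simp: indicator_def)
qed

abbreviation cell_integral :: "'i \<Rightarrow> ('a \<Rightarrow> real) \<Rightarrow> real" where
  "cell_integral \<alpha> f \<equiv> LINT x|N. indicator (cell X \<alpha>) x * f x"

lemma integrable_cell:
  fixes f :: "'a \<Rightarrow> real"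
  shows "\<alpha> \<in> indices X \<Longrightarrow> integrable N f \<Longrightarrow> integrable N (\<lambda>x. indicator (cell X \<alpha>) x * f x)"
  using integrable_real_mult_indicator[OF cell_sets, of \<alpha> f] by (simp add: mult.commute)

lemma cell_integral_decompose:
  fixes f :: "'a \<Rightarrow> real"
  assumes a: "\<alpha> \<in> level X m" and mn: "m \<le> n" and f: "integrable N f"
  shows "cell_integral \<alpha> f = (\<Sum>\<beta>\<in>sub n \<alpha>. cell_integral \<beta> f)"
proof -
  have int: "integrable N (\<lambda>x. indicator (cell X \<beta>) x * f x)" if "\<beta> \<in> sub n \<alpha>" for \<beta>
    by (rule integrable_cell[OF idx[OF subD(1)[OF that]] f])
  have "cell_integral \<alpha> f = (LINT x|N. (\<Sum>\<beta>\<in>sub n \<alpha>. indicator (cell X \<beta>) x * f x))"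
  proof (rule integral_cong_AE)
    show "(\<lambda>x. indicator (cell X \<alpha>) x * f x) \<in> borel_measurable N"
      using integrable_cell[OF idx[OF a] f] by (rule borel_measurable_integrable)
    show "(\<lambda>x. \<Sum>\<beta>\<in>sub n \<alpha>. indicator (cell X \<beta>) x * f x) \<in> borel_measurable N"
      using int by (intro borel_measurable_sum borel_measurable_integrable)
    show "AE x in N. indicator (cell X \<alpha>) x * f x = (\<Sum>\<beta>\<in>sub n \<alpha>. indicator (cell X \<beta>) x * f x)"
      using AE_not_vertex by eventually_elim (simp add: indicator_cell[OF a mn] sum_distrib_right)
  qed
  also have "\<dots> = (\<Sum>\<beta>\<in>sub n \<alpha>. cell_integral \<beta> f)"
    by (rule Bochner_Integration.integral_sum[OF int])
  finally show ?thesis .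
qed

abbreviation mass :: "'i \<Rightarrow> real" where
  "mass \<alpha> \<equiv> measure N (cell X \<alpha>)"

lemma cell_integral_const: "\<alpha> \<in> indices X \<Longrightarrow> cell_integral \<alpha> (\<lambda>_. c) = c * mass \<alpha>"
  using sets.sets_into_space[OF cell_sets, of \<alpha>] by (simp add: mult.commute Int_absorb2)

lemma mass_decompose:
  assumes "\<alpha> \<in> level X m" "m \<le> n"
  shows "mass \<alpha> = (\<Sum>\<beta>\<in>sub n \<alpha>. mass \<beta>)"
proof -
  have "1 * mass \<alpha> = (\<Sum>\<beta>\<in>sub n \<alpha>. 1 * mass \<beta>)"
    using cell_integral_decompose[OF assms, of "\<lambda>_. 1"] cell_integral_const[OF idx[OF assms(1)], of 1]
      cell_integral_const[OF idx[OF subD(1)], of _ n \<alpha> 1]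
    by (simp del: mult_1_right mult_1_left)
  then show ?thesis by simp
qed

end

text \<open>
  \<open>a\<close> is an additive function of cells dominated by the measure; \<open>Y n\<close> is its mean density on
  the level-\<open>n\<close> cell around a point, a bounded martingale. Densities on null cells are 0,
  in accordance with division by zero.
\<close>

locale cell_martingale = cell_measure +
  fixes a :: "'b \<Rightarrow> real" and C :: real and Y :: "nat \<Rightarrow> 'a \<Rightarrow> real"
  assumes additive: "\<alpha> \<in> level X m \<Longrightarrow> m \<le> n \<Longrightarrow> a \<alpha> = (\<Sum>\<beta>\<in>sub n \<alpha>. a \<beta>)"
    and dominated: "\<alpha> \<in> indices X \<Longrightarrow> \<bar>a \<alpha>\<bar> \<le> C * mass \<alpha>"
    and Y_measurable [measurable]: "\<And>n. Y n \<in> borel_measurable N"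
    and Y_eq: "\<lbrakk>\<alpha> \<in> level X n; x \<in> cell X \<alpha>; x \<notin> all_vertices X\<rbrakk> \<Longrightarrow> Y n x = a \<alpha> / mass \<alpha>"
begin

definition mean :: "'b \<Rightarrow> real" where
  "mean \<alpha> = a \<alpha> / mass \<alpha>"

lemma mean_mass: "\<alpha> \<in> indices X \<Longrightarrow> mean \<alpha> * mass \<alpha> = a \<alpha>"
  using dominated[of \<alpha>] by (auto simp: mean_def)

lemma mean_bound: "\<alpha> \<in> indices X \<Longrightarrow> \<bar>mean \<alpha>\<bar> \<le> \<bar>C\<bar>"
proof -
  assume "\<alpha> \<in> indices X"
  then have "\<bar>a \<alpha>\<bar> \<le> C * mass \<alpha>" by (rule dominated)
  also have "\<dots> \<le> \<bar>C\<bar> * mass \<alpha>" by (intro mult_right_mono) auto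
  finally show ?thesis
    using measure_nonneg[of N "cell X \<alpha>"]
    by (cases "mass \<alpha> = 0") (auto simp: mean_def abs_divide divide_le_eq)
qed

text \<open>
  Expansion of the square; additivity of \<open>a\<close> takes care of the mixed term.
\<close>

lemma square_deviation:
  assumes al: "\<alpha> \<in> level X m" and mn: "m \<le> n"
  shows "(\<Sum>\<beta>\<in>sub n \<alpha>. (mean \<beta> - c)\<^sup>2 * mass \<beta>) = (\<Sum>\<beta>\<in>sub n \<alpha>. (mean \<beta>)\<^sup>2 * mass \<beta>) - 2 * c * a \<alpha> + c\<^sup>2 * mass \<alpha>"
proof -
  have "(mean \<beta> - c)\<^sup>2 * mass \<beta> = (mean \<beta>)\<^sup>2 * mass \<beta> - 2 * c * a \<beta> + c\<^sup>2 * mass \<beta>" if "\<beta> \<in> sub n \<alpha>" for \<beta>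
    using mean_mass[OF idx[OF subD(1)[OF that]], symmetric] by (simp add: power2_eq_square algebra_simps)
  then show ?thesis
    unfolding additive[OF al mn] mass_decompose[OF al mn] sum_distrib_left
    by (simp add: sum.distrib sum_subtractf)
qed

text \<open>
  Jensen's inequality: the mean of a cell is the average of the means of its subcells.
\<close>

lemma square_deviation_mono:
  assumes al: "\<alpha> \<in> level X m" and mn: "m \<le> n"
  shows "(mean \<alpha> - c)\<^sup>2 * mass \<alpha> \<le> (\<Sum>\<beta>\<in>sub n \<alpha>. (mean \<beta> - c)\<^sup>2 * mass \<beta>)"
proof -
  have "0 \<le> (\<Sum>\<beta>\<in>sub n \<alpha>. (mean \<beta> - mean \<alpha>)\<^sup>2 * mass \<beta>)" by (intro sum_nonneg) auto
  also have "\<dots> = (\<Sum>\<beta>\<in>sub n \<alpha>. (mean \<beta>)\<^sup>2 * mass \<beta>) - 2 * mean \<alpha> * a \<alpha> + (mean \<alpha>)\<^sup>2 * mass \<alpha>"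
    by (rule square_deviation[OF al mn])
  finally have "0 \<le> (\<Sum>\<beta>\<in>sub n \<alpha>. (mean \<beta>)\<^sup>2 * mass \<beta>) - 2 * mean \<alpha> * a \<alpha> + (mean \<alpha>)\<^sup>2 * mass \<alpha>" .
  moreover have "mean \<alpha> * a \<alpha> = (mean \<alpha>)\<^sup>2 * mass \<alpha>"
    unfolding mean_mass[OF idx[OF al], symmetric] by (simp only: power2_eq_square mult.assoc)
  moreover have "(mean \<alpha> - c)\<^sup>2 * mass \<alpha> = (mean \<alpha>)\<^sup>2 * mass \<alpha> - 2 * c * a \<alpha> + c\<^sup>2 * mass \<alpha>"
    unfolding mean_mass[OF idx[OF al], symmetric] by (simp add: power2_eq_square algebra_simps)
  ultimately show ?thesis
    unfolding square_deviation[OF al mn] by simp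
qed

text \<open>
  Kolmogorov's maximal inequality, by induction on the number of levels: either the mean on the cell
  itself is already off by \<open>e\<close>, and convexity gives the bound, or the children inherit
  the problem.
\<close>

lemma maximal_inequality:
  assumes e: "e \<ge> 0" and al: "\<alpha> \<in> level X n"
  shows "e\<^sup>2 * measure N {x\<in>space N. x \<in> cell X \<alpha> - all_vertices X \<and> (\<exists>k\<le>j. e \<le> \<bar>Y (n + k) x - c\<bar>)}
      \<le> (\<Sum>\<beta>\<in>sub (n + j) \<alpha>. (mean \<beta> - c)\<^sup>2 * mass \<beta>)"
  using al
proof (induction j arbitrary: n \<alpha>)
  case (0 n \<alpha>)
  have a: "\<alpha> \<in> indices X" by (rule idx[OF 0])
  let ?A = "{x\<in>space N. x \<in> cell X \<alpha> - all_vertices X \<and> (\<exists>k\<le>0. e \<le> \<bar>Y (n + k) x - c\<bar>)}"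
  show ?case
  proof (cases "e \<le> \<bar>mean \<alpha> - c\<bar>")
    case True
    have "e\<^sup>2 * measure N ?A \<le> (mean \<alpha> - c)\<^sup>2 * mass \<alpha>"
      using True e power_mono[OF True e, of 2] by (intro mult_mono finite_measure_mono cell_sets a) auto
    then show ?thesis using square_deviation_mono[OF 0, of n c] by simp
  next
    case False
    then have A: "?A = {}" using Y_eq[OF 0] by (auto simp: mean_def)
    show ?thesis unfolding A by (auto intro!: sum_nonneg)
  qed
next
  case (Suc j n \<alpha>)
  have a: "\<alpha> \<in> indices X" by (rule idx[OF Suc.prems])
  let ?A = "\<lambda>n \<alpha> j. {x\<in>space N. x \<in> cell X \<alpha> - all_vertices X \<and> (\<exists>k\<le>j. e \<le> \<bar>Y (n + k) x - c\<bar>)}"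
  show ?case
  proof (cases "e \<le> \<bar>mean \<alpha> - c\<bar>")
    case True
    have "e\<^sup>2 * measure N (?A n \<alpha> (Suc j)) \<le> (mean \<alpha> - c)\<^sup>2 * mass \<alpha>"
      using True e power_mono[OF True e, of 2] by (intro mult_mono finite_measure_mono cell_sets a) auto
    then show ?thesis using square_deviation_mono[OF Suc.prems, of "n + Suc j" c] by simp
  next
    case False
    have meas: "?A (Suc n) \<gamma> j \<in> sets N" if "\<gamma> \<in> sub (Suc n) \<alpha>" for \<gamma>
    proof -
      have [measurable]: "cell X \<gamma> \<in> sets N" by (rule cell_sets[OF idx[OF subD(1)[OF that]]])
      show ?thesis by measurable
    qed
    have "?A n \<alpha> (Suc j) \<subseteq> (\<Union>\<gamma>\<in>sub (Suc n) \<alpha>. ?A (Suc n) \<gamma> j)"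
    proof
      fix x assume x: "x \<in> ?A n \<alpha> (Suc j)"
      then obtain k where k: "k \<le> Suc j" "e \<le> \<bar>Y (n + k) x - c\<bar>" by auto
      have "k \<noteq> 0"
      proof
        assume "k = 0"
        then show False using k False Y_eq[OF Suc.prems, of x] x by (auto simp: mean_def)
      qed
      then obtain k' where k': "k = Suc k'" using not0_implies_Suc by blast
      obtain \<gamma> where "\<gamma> \<in> sub (Suc n) \<alpha>" "x \<in> cell X \<gamma>"
        using cell_sub_union[OF Suc.prems, of "Suc n"] x by auto
      then show "x \<in> (\<Union>\<gamma>\<in>sub (Suc n) \<alpha>. ?A (Suc n) \<gamma> j)" using x k k' by auto
    qed
    then have "measure N (?A n \<alpha> (Suc j)) \<le> measure N (\<Union>\<gamma>\<in>sub (Suc n) \<alpha>. ?A (Suc n) \<gamma> j)"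
      using meas by (intro finite_measure_mono sets.finite_UN) auto
    also have "\<dots> \<le> (\<Sum>\<gamma>\<in>sub (Suc n) \<alpha>. measure N (?A (Suc n) \<gamma> j))"
      using meas by (intro finite_measure_subadditive_finite) auto
    finally have "e\<^sup>2 * measure N (?A n \<alpha> (Suc j)) \<le> (\<Sum>\<gamma>\<in>sub (Suc n) \<alpha>. e\<^sup>2 * measure N (?A (Suc n) \<gamma> j))"
      by (simp add: sum_distrib_left[symmetric] mult_left_mono)
    also have "\<dots> \<le> (\<Sum>\<gamma>\<in>sub (Suc n) \<alpha>. \<Sum>\<beta>\<in>sub (Suc n + j) \<gamma>. (mean \<beta> - c)\<^sup>2 * mass \<beta>)"
      by (intro sum_mono Suc.IH subD(1))
    also have "\<dots> = (\<Sum>\<beta>\<in>sub (n + Suc j) \<alpha>. (mean \<beta> - c)\<^sup>2 * mass \<beta>)"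
      by (subst sum_sub_decompose[OF Suc.prems, of "Suc n" "n + Suc j"]) auto
    finally show ?thesis .
  qed
qed

definition second_moment :: "nat \<Rightarrow> real" where
  "second_moment n = (\<Sum>\<beta>\<in>level X n. (mean \<beta>)\<^sup>2 * mass \<beta>)"

text \<open>
  Orthogonality of martingale increments.
\<close>

lemma second_moment_increment:
  assumes "n \<le> k"
  shows "(\<Sum>\<alpha>\<in>level X n. \<Sum>\<beta>\<in>sub k \<alpha>. (mean \<beta> - mean \<alpha>)\<^sup>2 * mass \<beta>) = second_moment k - second_moment n"
proof -
  have "(\<Sum>\<beta>\<in>sub k \<alpha>. (mean \<beta> - mean \<alpha>)\<^sup>2 * mass \<beta>) = (\<Sum>\<beta>\<in>sub k \<alpha>. (mean \<beta>)\<^sup>2 * mass \<beta>) - (mean \<alpha>)\<^sup>2 * mass \<alpha>"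
    if "\<alpha> \<in> level X n" for \<alpha>
    unfolding square_deviation[OF that assms] using mean_mass[OF idx[OF that], symmetric]
    by (simp add: power2_eq_square algebra_simps)
  then show ?thesis
    using sum_sub_decompose[OF root_idx, of n k "\<lambda>\<beta>. (mean \<beta>)\<^sup>2 * mass \<beta>"] assms
    by (simp add: second_moment_def sub_root sum_subtractf)
qed

lemma second_moment_convergent: "convergent second_moment"
proof (rule Bseq_monoseq_convergent)
  have "second_moment n \<le> second_moment (Suc n)" for n
  proof -
    have "0 \<le> (\<Sum>\<alpha>\<in>level X n. \<Sum>\<beta>\<in>sub (Suc n) \<alpha>. (mean \<beta> - mean \<alpha>)\<^sup>2 * mass \<beta>)"
      by (intro sum_nonneg mult_nonneg_nonneg) auto
    then show ?thesis using second_moment_increment[of n "Suc n"] by simp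
  qed
  then show "monoseq second_moment" by (intro mono_SucI1) auto
  have "\<bar>second_moment n\<bar> \<le> C\<^sup>2 * mass (root X)" for n
  proof -
    have "second_moment n \<le> (\<Sum>\<beta>\<in>level X n. C\<^sup>2 * mass \<beta>)"
      unfolding second_moment_def
      by (intro sum_mono mult_right_mono) (auto simp: abs_le_square_iff[symmetric] intro!: mean_bound idx)
    also have "\<dots> = C\<^sup>2 * mass (root X)"
      using mass_decompose[OF root_idx, of n] by (simp add: sub_root sum_distrib_left)
    finally show ?thesis
      using sum_nonneg[of "level X n" "\<lambda>\<beta>. (mean \<beta>)\<^sup>2 * mass \<beta>"] by (simp add: second_moment_def)
  qed
  then show "Bseq second_moment" by (intro BseqI') auto
qed

text \<open>
  The maximal inequality on each cell of level \<open>n\<close>, with \<open>c\<close> the mean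
  on that cell.
\<close>

lemma oscillation_measure:
  assumes e: "e > 0"
  shows "measure N {x\<in>space N. x \<notin> all_vertices X \<and> (\<exists>k\<le>j. e \<le> \<bar>Y (n + k) x - Y n x\<bar>)}
      \<le> (second_moment (n + j) - second_moment n) / e\<^sup>2"
    (is "measure N ?S \<le> _")
proof -
  let ?A = "\<lambda>\<alpha>. {x\<in>space N. x \<in> cell X \<alpha> - all_vertices X \<and> (\<exists>k\<le>j. e \<le> \<bar>Y (n + k) x - mean \<alpha>\<bar>)}"
  have meas: "?A \<alpha> \<in> sets N" if "\<alpha> \<in> level X n" for \<alpha>
  proof -
    have [measurable]: "cell X \<alpha> \<in> sets N" by (rule cell_sets[OF idx[OF that]])
    show ?thesis by measurable
  qed
  have "?S \<subseteq> (\<Union>\<alpha>\<in>level X n. ?A \<alpha>)"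
  proof
    fix x assume x: "x \<in> ?S"
    then obtain \<alpha> where a: "\<alpha> \<in> level X n" "x \<in> cell X \<alpha>" using level_cover[of n] by (auto simp: space_N)
    then have "Y n x = mean \<alpha>" using Y_eq x by (auto simp: mean_def)
    then show "x \<in> (\<Union>\<alpha>\<in>level X n. ?A \<alpha>)" using x a by auto
  qed
  then have "measure N ?S \<le> measure N (\<Union>\<alpha>\<in>level X n. ?A \<alpha>)"
    using meas level_finite by (intro finite_measure_mono sets.finite_UN) auto
  also have "\<dots> \<le> (\<Sum>\<alpha>\<in>level X n. measure N (?A \<alpha>))"
    using meas level_finite by (intro finite_measure_subadditive_finite) auto
  finally have "e\<^sup>2 * measure N ?S \<le> (\<Sum>\<alpha>\<in>level X n. e\<^sup>2 * measure N (?A \<alpha>))"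
    by (simp add: sum_distrib_left[symmetric] mult_left_mono)
  also have "\<dots> \<le> (\<Sum>\<alpha>\<in>level X n. \<Sum>\<beta>\<in>sub (n + j) \<alpha>. (mean \<beta> - mean \<alpha>)\<^sup>2 * mass \<beta>)"
    using e by (intro sum_mono maximal_inequality) auto
  also have "\<dots> = second_moment (n + j) - second_moment n"
    by (rule second_moment_increment) simp
  finally show ?thesis using e by (simp add: field_simps)
qed

text \<open>
  The second moments converge, so the bound of \<open>oscillation_measure\<close> tends to 0 as
  \<open>n\<close> grows, uniformly in \<open>j\<close>.
\<close>

lemma oscillation_null:
  assumes e: "e > 0"
  shows "AE x in N. \<exists>n. \<forall>k. \<bar>Y (n + k) x - Y n x\<bar> < e"
proof -
  obtain L where L: "second_moment \<longlonglongrightarrow> L" using second_moment_convergent by (auto simp: convergent_def)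
  define S where "S = (\<lambda>n j. {x\<in>space N. x \<notin> all_vertices X \<and> (\<exists>k\<le>j. e \<le> \<bar>Y (n + k) x - Y n x\<bar>)})"
  have S_sets: "S n j \<in> sets N" for n j unfolding S_def by measurable
  have S_le: "measure N (\<Union>j. S n j) \<le> (L - second_moment n) / e\<^sup>2" for n
  proof (rule LIMSEQ_le)
    show "(\<lambda>j. measure N (S n j)) \<longlonglongrightarrow> measure N (\<Union>j. S n j)"
    proof (rule finite_Lim_measure_incseq)
      show "incseq (S n)"
        unfolding S_def by (intro incseq_SucI subsetI) (auto intro: le_SucI)
    qed (use S_sets in auto)
    show "(\<lambda>j. (second_moment (n + j) - second_moment n) / e\<^sup>2) \<longlonglongrightarrow> (L - second_moment n) / e\<^sup>2"
      using LIMSEQ_ignore_initial_segment[OF L, of n] e by (intro tendsto_intros) (auto simp: add.commute)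
    show "\<exists>k. \<forall>j\<ge>k. measure N (S n j) \<le> (second_moment (n + j) - second_moment n) / e\<^sup>2"
      using oscillation_measure[OF e] by (auto simp: S_def)
  qed
  \<comment> \<open>the points where the oscillation after every level reaches \<open>e\<close>\<close>
  let ?B = "\<Inter>n. \<Union>j. S n j"
  have B: "?B \<in> sets N" using S_sets by blast
  have "measure N ?B \<le> 0"
  proof (rule LIMSEQ_le_const)
    show "(\<lambda>n. (L - second_moment n) / e\<^sup>2) \<longlonglongrightarrow> 0"
      using tendsto_divide[OF tendsto_diff[OF tendsto_const[of L] L] tendsto_const[of "e\<^sup>2"]] e by simp
    have "measure N ?B \<le> measure N (\<Union>j. S n j)" for n
      using S_sets by (intro finite_measure_mono) auto
    then show "\<exists>k. \<forall>n\<ge>k. measure N ?B \<le> (L - second_moment n) / e\<^sup>2"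
      using S_le by (meson order_trans)
  qed
  then have "?B \<in> null_sets N" using B by (simp add: null_sets_def emeasure_eq_measure measure_le_0_iff)
  from AE_not_in[OF this] AE_not_vertex AE_space show ?thesis
    by eventually_elim (auto simp: S_def not_le; metis le_refl not_le)
qed

theorem martingale_convergence: "AE x in N. convergent (\<lambda>n. Y n x)"
proof -
  have "AE x in N. \<forall>i. \<exists>n. \<forall>k. \<bar>Y (n + k) x - Y n x\<bar> < 1 / real (Suc i)"
    unfolding AE_all_countable by (intro allI oscillation_null) simp
  then show ?thesis
  proof eventually_elim
    case (elim x)
    have "Cauchy (\<lambda>n. Y n x)"
    proof (rule metric_CauchyI)
      fix e :: real assume "e > 0"
      then obtain i where i: "1 / real (Suc i) < e / 2" using nat_approx_posE[of "e / 2"] by auto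
      obtain n where n: "\<And>k. \<bar>Y (n + k) x - Y n x\<bar> < 1 / real (Suc i)" using elim by blast
      have "dist (Y p x) (Y q x) < e" if "n \<le> p" "n \<le> q" for p q
        using n[of "p - n"] n[of "q - n"] that i by (simp add: dist_real_def)
      then show "\<exists>M. \<forall>m\<ge>M. \<forall>n\<ge>M. dist (Y m x) (Y n x) < e" by blast
    qed
    then show ?case by (rule Cauchy_convergent)
  qed
qed

lemma Y_bound: "AE x in N. \<bar>Y n x\<bar> \<le> \<bar>C\<bar>"
  using AE_not_vertex AE_space
proof eventually_elim
  case (elim x)
  then obtain \<alpha> where "\<alpha> \<in> level X n" "x \<in> cell X \<alpha>" using level_cover[of n] by (auto simp: space_N)
  then show ?case using Y_eq mean_bound[OF idx] elim by (metis mean_def)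
qed

text \<open>
  For \<open>n \<ge> m\<close> the integral of \<open>Y n\<close> over the cell is exactly
  \<open>a \<alpha>\<close>; bounded convergence passes to the limit.
\<close>

theorem martingale_limit_integral:
  assumes L [measurable]: "L \<in> borel_measurable N" and lim: "AE x in N. (\<lambda>n. Y n x) \<longlonglongrightarrow> L x"
    and al: "\<alpha> \<in> level X m"
  shows "cell_integral \<alpha> L = a \<alpha>"
proof -
  have [measurable]: "cell X \<alpha> \<in> sets N" by (rule cell_sets[OF idx[OF al]])
  have "(\<lambda>n. cell_integral \<alpha> (Y n)) \<longlonglongrightarrow> cell_integral \<alpha> L"
  proof (rule integral_dominated_convergence[where w = "\<lambda>_. \<bar>C\<bar>"])
    show "AE x in N. (\<lambda>n. indicator (cell X \<alpha>) x * Y n x) \<longlonglongrightarrow> indicator (cell X \<alpha>) x * L x"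
      using lim by eventually_elim (rule tendsto_mult_left)
    show "AE x in N. norm (indicator (cell X \<alpha>) x * Y n x) \<le> \<bar>C\<bar>" for n
      using Y_bound[of n] by eventually_elim (auto simp: indicator_def)
  qed auto
  moreover have "cell_integral \<alpha> (Y n) = a \<alpha>" if n: "n \<ge> m" for n
  proof -
    have int: "integrable N (Y n)"
      using Y_bound[of n] by (intro integrable_const_bound[where B = "\<bar>C\<bar>"]) auto
    have "cell_integral \<beta> (Y n) = a \<beta>" if b: "\<beta> \<in> sub n \<alpha>" for \<beta>
    proof -
      have i: "\<beta> \<in> indices X" by (rule idx[OF subD(1)[OF b]])
      have [measurable]: "cell X \<beta> \<in> sets N" by (rule cell_sets[OF i])
      have "cell_integral \<beta> (Y n) = cell_integral \<beta> (\<lambda>_. mean \<beta>)"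
      proof (rule integral_cong_AE)
        show "AE x in N. indicator (cell X \<beta>) x * Y n x = indicator (cell X \<beta>) x * mean \<beta>"
          using AE_not_vertex
          by eventually_elim (use Y_eq[OF subD(1)[OF b]] in \<open>auto simp: indicator_def mean_def\<close>)
      qed measurable
      then show ?thesis by (simp only: cell_integral_const[OF i] mean_mass[OF i])
    qed
    then show ?thesis using cell_integral_decompose[OF al n int] additive[OF al n] by simp
  qed
  then have "eventually (\<lambda>n. cell_integral \<alpha> (Y n) = a \<alpha>) sequentially"
    by (auto simp: eventually_sequentially)
  then have "(\<lambda>n. cell_integral \<alpha> (Y n)) \<longlonglongrightarrow> a \<alpha>" by (rule tendsto_eventually)
  ultimately show ?thesis using LIMSEQ_unique by blast
qed

end

section \<open>Harmonic coordinates\<close>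

locale harmonic_fractal = form_cells X for X :: "('a::metric_space, 'i, 'z) form_fractal_scheme" +
  fixes v :: "'m::finite \<Rightarrow> 'a"
    and \<nu> :: "('a \<Rightarrow> real) \<Rightarrow> 'a measure"
    and g :: "nat \<Rightarrow> 'a \<Rightarrow> real"
    and N :: "'a measure"
    and \<psi> :: "'a \<Rightarrow> real ^ 'm"
  assumes harmonic_cont: "harmonic_continuous X"
    and enum: "bij_betw v UNIV (level_vertices X 0)"
    and energy_measures: "\<And>h. harmonic X h \<Longrightarrow> is_energy_measure X h (\<nu> h)"
    and basis: "orthonormal_harmonic_basis X (CARD('m) - 1) g"
    and N_def: "N = kusuoka_measure X (CARD('m) - 1) (\<lambda>i. \<nu> (g i))"
    and psi_def: "\<psi> = harmonic_coords X v"
begin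

interpretation root: resform "all_vertices X" "Dom X" "energy X"
  by (rule root_form)

lemma V0: "finite (level_vertices X 0)" "level_vertices X 0 \<subseteq> all_vertices X" "level_vertices X 0 \<noteq> {}"
  using level_vertices_exhaust(1,4) by (auto simp: all_vertices_def)

lemma v_V0: "v i \<in> level_vertices X 0"
  using enum by (auto simp: bij_betw_def)

lemma v_all: "v i \<in> all_vertices X"
  using v_V0 V0 by blast

lemma V0_v: "p \<in> level_vertices X 0 \<Longrightarrow> \<exists>i. p = v i"
  using enum by (auto simp: bij_betw_def)

lemma harmonic_minimiser: "harmonic X h \<longleftrightarrow> root.minimiser (level_vertices X 0) h h"
  by (simp add: harmonic_def root.minimiser_def agree_on_def)

lemma minimiser_harmonic: "root.minimiser (level_vertices X 0) f h \<Longrightarrow> harmonic X h"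
  by (auto simp: harmonic_def root.minimiser_def agree_on_def)

lemma harmonic_Dom: "harmonic X h \<Longrightarrow> h \<in> Dom X"
  by (simp add: harmonic_def)

lemma harmonic_orthogonal:
  "harmonic X h \<Longrightarrow> w \<in> Dom X \<Longrightarrow> agree_on (level_vertices X 0) w (\<lambda>_. 0) \<Longrightarrow> energy X h w = 0"
  unfolding harmonic_minimiser by (rule root.minimiser_orthogonal)

lemma harmonicI:
  assumes "h \<in> Dom X"
    and "\<And>w. w \<in> Dom X \<Longrightarrow> agree_on (level_vertices X 0) w (\<lambda>_. 0) \<Longrightarrow> energy X h w = 0"
  shows "harmonic X h"
  by (rule minimiser_harmonic[of h], rule root.minimiserI) (use assms in \<open>auto simp: agree_on_def\<close>)

lemma harmonic_cong:
  assumes h: "harmonic X h" and ag: "agree_on (all_vertices X) h k"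
  shows "harmonic X k"
proof (rule harmonicI)
  show k: "k \<in> Dom X" by (rule root.D_agree[OF harmonic_Dom[OF h] ag])
  fix w assume w: "w \<in> Dom X" "agree_on (level_vertices X 0) w (\<lambda>_. 0)"
  have "energy X h w = energy X k w"
    by (rule root.E_agree[OF harmonic_Dom[OF h] w(1) k w(1) ag]) (simp add: agree_on_def)
  then show "energy X k w = 0" using harmonic_orthogonal[OF h w] by simp
qed

lemma harmonic_sum:
  assumes "finite I" "\<And>i. i \<in> I \<Longrightarrow> harmonic X (h i)"
  shows "harmonic X (\<lambda>x. \<Sum>i\<in>I. c i * h i x)"
proof (rule harmonicI)
  show "(\<lambda>x. \<Sum>i\<in>I. c i * h i x) \<in> Dom X"
    using assms by (intro root.D_sum harmonic_Dom) auto
  fix w assume w: "w \<in> Dom X" "agree_on (level_vertices X 0) w (\<lambda>_. 0)"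
  show "energy X (\<lambda>x. \<Sum>i\<in>I. c i * h i x) w = 0"
    using assms w by (subst root.E_sum_left) (auto intro!: harmonic_Dom sum.neutral harmonic_orthogonal)
qed

lemma harmonic_add:
  assumes "harmonic X h" "harmonic X k"
  shows "harmonic X (\<lambda>x. h x + k x)"
proof (rule harmonicI)
  show "(\<lambda>x. h x + k x) \<in> Dom X" using assms by (intro root.D_add harmonic_Dom)
  fix w assume w: "w \<in> Dom X" "agree_on (level_vertices X 0) w (\<lambda>_. 0)"
  show "energy X (\<lambda>x. h x + k x) w = 0"
    using root.E_add_left[OF harmonic_Dom[OF assms(1)] harmonic_Dom[OF assms(2)] w(1)]
      harmonic_orthogonal[OF assms(1) w] harmonic_orthogonal[OF assms(2) w] by simp
qed

lemma harmonic_unique: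
  assumes h: "harmonic X h" and k: "harmonic X k" and eq: "\<And>i. h (v i) = k (v i)"
  shows "agree_on (all_vertices X) h k"
proof (rule root.minimiser_unique)
  show "root.minimiser (level_vertices X 0) h h" using h by (simp add: harmonic_minimiser)
  show "root.minimiser (level_vertices X 0) k k" using k by (simp add: harmonic_minimiser)
  show "agree_on (level_vertices X 0) h k" using eq V0_v unfolding agree_on_def by blast
qed (use v_V0 V0 in auto)

text \<open>
  The description in \<open>harmonic_ext\<close> is satisfiable: take the continuous version of
  the energy minimiser.
\<close>

lemma harmonic_ext:
  "harmonic X (harmonic_ext X v t) \<and> continuous_on (points X) (harmonic_ext X v t)
    \<and> (\<forall>i. harmonic_ext X v t (v i) = t $ i)"
proof -
  define f where "f = (\<lambda>x. t $ inv v x)"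
  have f: "f (v i) = t $ i" for i
    using enum by (simp add: f_def bij_betw_def)
  obtain u where u: "root.minimiser (level_vertices X 0) f u"
    using root.minimiser_exists[OF V0] by blast
  obtain k where k: "continuous_on (points X) k" "agree_on (all_vertices X) k u"
    using harmonic_cont minimiser_harmonic[OF u] by (auto simp: harmonic_continuous_def)
  have "harmonic X k"
    using harmonic_cong[OF minimiser_harmonic[OF u]] k(2) by (simp add: agree_on_def)
  moreover have "k (v i) = t $ i" for i
    using k(2) root.minimiserD(2)[OF u] v_all[of i] v_V0[of i] f[of i] by (simp add: agree_on_def)
  ultimately have "\<exists>h. harmonic X h \<and> continuous_on (points X) h \<and> (\<forall>i. h (v i) = t $ i)"
    using k(1) by blast
  then show ?thesis unfolding harmonic_ext_def by (rule someI_ex)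
qed

lemma psi_component: "\<psi> x $ j = harmonic_ext X v (axis j 1) x"
  by (simp add: psi_def harmonic_coords_def)

lemma harmonic_coordinate: "harmonic X (\<lambda>x. \<psi> x $ j)"
  using harmonic_ext[of "axis j 1"] by (simp add: psi_component)

lemma psi_continuous: "continuous_on (points X) \<psi>"
proof -
  have "continuous_on (points X) (\<lambda>x. \<chi> j. \<psi> x $ j)"
    using harmonic_ext by (intro continuous_on_vec_lambda) (simp add: psi_component)
  then show ?thesis by simp
qed

lemma psi_v: "\<psi> (v i) $ j = (if i = j then 1 else 0)"
  using harmonic_ext[of "axis j 1"] by (simp add: psi_component axis_def)

lemma inner_psi: "t \<bullet> \<psi> x = (\<Sum>j\<in>UNIV. t $ j * \<psi> x $ j)"
  by (simp add: inner_vec_def)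

lemma harmonic_linear: "harmonic X (\<lambda>x. t \<bullet> \<psi> x)"
  unfolding inner_psi by (intro harmonic_sum harmonic_coordinate) simp

text \<open>
  Both sides are harmonic and agree on \<open>V\<^sub>0\<close>, where the coordinates are the unit vectors.
\<close>

lemma harmonic_is_linear:
  assumes "harmonic X h"
  shows "agree_on (all_vertices X) h (\<lambda>x. (\<chi> i. h (v i)) \<bullet> \<psi> x)"
  by (rule harmonic_unique[OF assms harmonic_linear])
     (simp add: inner_psi psi_v if_distrib[of "(*) _"] cong: if_cong)

lemma harmonic_ext_linear:
  assumes "x \<in> all_vertices X"
  shows "harmonic_ext X v t x = t \<bullet> \<psi> x"
proof -
  have "(\<chi> i. harmonic_ext X v t (v i)) = t" using harmonic_ext[of t] by (simp add: vec_eq_iff)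
  then show ?thesis
    using harmonic_is_linear[of "harmonic_ext X v t"] harmonic_ext[of t] assms by (simp add: agree_on_def)
qed

section \<open>The Kusuoka measure and the matrix field\<close>

lemma energy_measure:
  assumes h: "harmonic X h"
  shows "cell_measure X (\<nu> h)" and "\<alpha> \<in> indices X \<Longrightarrow> emeasure (\<nu> h) (cell X \<alpha>) = ennreal (cell_trace \<alpha> h)"
proof -
  have m: "sets (\<nu> h) = sets (restrict_space borel (points X))"
    "\<And>x. x \<in> points X \<Longrightarrow> emeasure (\<nu> h) {x} = 0"
    "\<And>\<alpha>. \<alpha> \<in> indices X \<Longrightarrow> emeasure (\<nu> h) (cell X \<alpha>) = ennreal (cell_trace \<alpha> h)"
    using energy_measures[OF h] by (auto simp: is_energy_measure_def)
  have "space (\<nu> h) = cell X (root X)"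
    using sets_eq_imp_space_eq[OF m(1)] by (simp add: space_restrict_space cell_root)
  then have "finite_measure (\<nu> h)"
    using m(3)[OF idx[OF root_idx]] by (intro finite_measureI) simp
  then show "cell_measure X (\<nu> h)"
    using m by (intro cell_measure.intro cell_measure_axioms.intro cells_axioms)
  show "\<alpha> \<in> indices X \<Longrightarrow> emeasure (\<nu> h) (cell X \<alpha>) = ennreal (cell_trace \<alpha> h)" by (rule m)
qed

text \<open>
  The energy measure of \<open>h\<close> does not charge the vertices that subcells share.
\<close>

lemma cell_trace_additive:
  assumes h: "harmonic X h" and a: "\<alpha> \<in> level X m" and mn: "m \<le> n"
  shows "cell_trace \<alpha> h = (\<Sum>\<beta>\<in>sub n \<alpha>. cell_trace \<beta> h)"
proof -
  have "measure (\<nu> h) (cell X \<beta>) = cell_trace \<beta> h" if "\<beta> \<in> indices X" for \<beta>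
    using energy_measure(2)[OF h that] cell_trace_nonneg[OF that] by (simp add: measure_def)
  then show ?thesis
    using cell_measure.mass_decompose[OF energy_measure(1)[OF h] a mn] idx[OF a] idx[OF subD(1)]
    by simp
qed

lemma g_harmonic: "i < CARD('m) - 1 \<Longrightarrow> harmonic X (g i)"
  using basis by (simp add: orthonormal_harmonic_basis_def)

lemma sets_N': "sets N = sets (restrict_space borel (points X))"
  unfolding N_def kusuoka_measure_def
  by (subst sets_measure_of)
     (use sets.sigma_sets_eq[of "restrict_space borel (points X)"] sets.space_closed[of "restrict_space borel (points X)"]
       in \<open>auto simp: space_restrict_space\<close>)

lemma emeasure_N:
  assumes B: "B \<in> sets N"
  shows "emeasure N B = (\<Sum>i<CARD('m) - 1. emeasure (\<nu> (g i)) B)"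
proof -
  let ?R = "restrict_space borel (points X)"
  have s: "sets (\<nu> (g i)) = sets N" if "i < CARD('m) - 1" for i
    using cell_measure.sets_N[OF energy_measure(1)[OF g_harmonic[OF that]]] sets_N' by simp
  show ?thesis
  proof (rule emeasure_measure_of[OF N_def[unfolded kusuoka_measure_def]])
    show "sets ?R \<subseteq> Pow (points X)"
      using sets.space_closed[of ?R] by (simp add: space_restrict_space)
    show "positive (sets N) (\<lambda>B. \<Sum>i<CARD('m) - 1. emeasure (\<nu> (g i)) B)"
      by (simp add: positive_def)
    show "countably_additive (sets N) (\<lambda>B. \<Sum>i<CARD('m) - 1. emeasure (\<nu> (g i)) B)"
    proof (rule countably_additiveI)
      fix A :: "nat \<Rightarrow> 'a set"
      assume A: "range A \<subseteq> sets N" "disjoint_family A"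
      have "(\<Sum>n. \<Sum>i<CARD('m) - 1. emeasure (\<nu> (g i)) (A n)) = (\<Sum>i<CARD('m) - 1. \<Sum>n. emeasure (\<nu> (g i)) (A n))"
        by (rule suminf_sum) simp
      also have "\<dots> = (\<Sum>i<CARD('m) - 1. emeasure (\<nu> (g i)) (\<Union>n. A n))"
        using A s by (intro sum.cong refl suminf_emeasure) auto
      finally show "(\<Sum>n. \<Sum>i<CARD('m) - 1. emeasure (\<nu> (g i)) (A n)) = (\<Sum>i<CARD('m) - 1. emeasure (\<nu> (g i)) (\<Union>n. A n))" .
    qed
  qed (rule B)
qed

lemma N_cell_sets: "\<alpha> \<in> indices X \<Longrightarrow> cell X \<alpha> \<in> sets N"
  using compact_imp_closed[OF compact_points] compact_imp_closed[OF cell_compact] cell_points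
  by (simp add: sets_N' sets_restrict_space_iff)

lemma emeasure_N_cell:
  assumes a: "\<alpha> \<in> indices X"
  shows "emeasure N (cell X \<alpha>) = ennreal (\<Sum>i<CARD('m) - 1. cell_trace \<alpha> (g i))"
  using energy_measure(2)[OF g_harmonic a] cell_trace_nonneg[OF a]
  by (simp add: emeasure_N[OF N_cell_sets[OF a]] sum_ennreal)

sublocale cell_measure X N
proof (intro cell_measure.intro cell_measure_axioms.intro cells_axioms)
  show "sets N = sets (restrict_space borel (points X))" by (rule sets_N')
  show "emeasure N {x} = 0" if x: "x \<in> points X" for x
  proof -
    have "{x} \<in> sets N"
      using x compact_imp_closed[OF compact_points] by (simp add: sets_N' sets_restrict_space_iff)
    then show ?thesis
      using x cell_measure.atomless[OF energy_measure(1)[OF g_harmonic]] by (simp add: emeasure_N)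
  qed
  show "finite_measure N"
  proof (rule finite_measureI)
    have "space N = cell X (root X)"
      using sets_eq_imp_space_eq[OF sets_N'] by (simp add: space_restrict_space cell_root)
    then show "emeasure N (space N) \<noteq> \<infinity>" by (simp add: emeasure_N_cell[OF idx[OF root_idx]])
  qed
qed

lemma mass_eq: "\<alpha> \<in> indices X \<Longrightarrow> mass \<alpha> = (\<Sum>i<CARD('m) - 1. cell_trace \<alpha> (g i))"
  using emeasure_N_cell[of \<alpha>] cell_trace_nonneg[of \<alpha>] by (simp add: measure_def sum_nonneg)

text \<open>
  The Gram matrix of the coordinates for the trace on a cell; divided by the mass of the cell it
  is \<open>Z_cell\<close>.
\<close>

definition coord_energy :: "'i \<Rightarrow> 'm \<Rightarrow> 'm \<Rightarrow> real" where
  "coord_energy \<alpha> i j = cell_bilinear \<alpha> (\<lambda>x. \<psi> x $ i) (\<lambda>x. \<psi> x $ j)"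

lemma coord_energy_sym: "\<alpha> \<in> indices X \<Longrightarrow> coord_energy \<alpha> i j = coord_energy \<alpha> j i"
  unfolding coord_energy_def by (rule cell_bilinear_sym)

text \<open>
  Polarisation of \<open>cell_trace_additive\<close>, as sums of coordinates are harmonic.
\<close>

lemma coord_energy_additive:
  assumes a: "\<alpha> \<in> level X m" and mn: "m \<le> n"
  shows "coord_energy \<alpha> i j = (\<Sum>\<beta>\<in>sub n \<alpha>. coord_energy \<beta> i j)"
proof -
  let ?h = "\<lambda>i x. \<psi> x $ i"
  have pol: "coord_energy \<beta> i j = (cell_trace \<beta> (\<lambda>x. ?h i x + ?h j x) - cell_trace \<beta> (?h i) - cell_trace \<beta> (?h j)) / 2"
    if "\<beta> \<in> indices X" for \<beta>
    using cell_trace_add[OF that, of "?h i" "?h j"] by (simp add: coord_energy_def)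
  have "(\<Sum>\<beta>\<in>sub n \<alpha>. coord_energy \<beta> i j)
      = (\<Sum>\<beta>\<in>sub n \<alpha>. (cell_trace \<beta> (\<lambda>x. ?h i x + ?h j x) - cell_trace \<beta> (?h i) - cell_trace \<beta> (?h j)) / 2)"
    by (rule sum.cong[OF refl]) (rule pol[OF idx[OF subD(1)]])
  also have "\<dots> = coord_energy \<alpha> i j"
    unfolding pol[OF idx[OF a]] cell_trace_additive[OF harmonic_coordinate a mn]
      cell_trace_additive[OF harmonic_add[OF harmonic_coordinate harmonic_coordinate] a mn]
    by (simp add: sum_divide_distrib sum_subtractf diff_divide_distrib)
  finally show ?thesis by simp
qed

text \<open>
  The coordinates are, up to constants, combinations of the orthonormal basis that defines the
  Kusuoka measure.
\<close>

lemma coord_energy_dominated: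
  obtains C where "C \<ge> 0" "\<And>\<alpha> i. \<alpha> \<in> indices X \<Longrightarrow> cell_trace \<alpha> (\<lambda>x. \<psi> x $ i) \<le> C * mass \<alpha>"
    "\<And>\<alpha> i j. \<alpha> \<in> indices X \<Longrightarrow> \<bar>coord_energy \<alpha> i j\<bar> \<le> C * mass \<alpha>"
proof -
  let ?I = "{..<CARD('m) - 1}"
  have "\<exists>K\<ge>0. \<forall>\<alpha>\<in>indices X. cell_trace \<alpha> (\<lambda>x. \<psi> x $ j) \<le> K * mass \<alpha>" for j
  proof -
    obtain c0 c where c: "agree_on (all_vertices X) (\<lambda>x. \<psi> x $ j) (\<lambda>x. c0 + (\<Sum>i\<in>?I. c i * g i x))"
      using basis harmonic_coordinate[of j] unfolding orthonormal_harmonic_basis_def by blast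
    have "cell_trace \<alpha> (\<lambda>x. \<psi> x $ j) \<le> (\<Sum>i\<in>?I. (c i)\<^sup>2) * mass \<alpha>" if a: "\<alpha> \<in> indices X" for \<alpha>
      unfolding mass_eq[OF a]
    proof (rule cell_trace_contraction[OF a])
      fix p q assume "p \<in> vtx X \<alpha>" "q \<in> vtx X \<alpha>"
      then have pq: "p \<in> all_vertices X" "q \<in> all_vertices X" using vtx_all[OF a] by auto
      have "(\<psi> p $ j - \<psi> q $ j)\<^sup>2 = (\<Sum>i\<in>?I. c i * (g i p - g i q))\<^sup>2"
        using c pq by (simp add: agree_on_def right_diff_distrib sum_subtractf)
      also have "\<dots> \<le> (\<Sum>i\<in>?I. (c i)\<^sup>2) * (\<Sum>i\<in>?I. (g i p - g i q)\<^sup>2)"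
        by (rule Cauchy_Schwarz_ineq_sum)
      finally show "(\<psi> p $ j - \<psi> q $ j)\<^sup>2 \<le> (\<Sum>i\<in>?I. (c i)\<^sup>2) * (\<Sum>i\<in>?I. (g i p - g i q)\<^sup>2)" .
    qed simp
    moreover have "(\<Sum>i\<in>?I. (c i)\<^sup>2) \<ge> 0" by (intro sum_nonneg) auto
    ultimately show ?thesis by blast
  qed
  then obtain K where K: "\<And>j. K j \<ge> 0"
    "\<And>j \<alpha>. \<alpha> \<in> indices X \<Longrightarrow> cell_trace \<alpha> (\<lambda>x. \<psi> x $ j) \<le> K j * mass \<alpha>"
    using choice[of "\<lambda>j K. K \<ge> 0 \<and> (\<forall>\<alpha>\<in>indices X. cell_trace \<alpha> (\<lambda>x. \<psi> x $ j) \<le> K * mass \<alpha>)"] by blast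
  define C where "C = (\<Sum>j\<in>UNIV. K j)"
  have C0: "C \<ge> 0" unfolding C_def by (intro sum_nonneg K(1))
  have tr: "cell_trace \<alpha> (\<lambda>x. \<psi> x $ j) \<le> C * mass \<alpha>" if a: "\<alpha> \<in> indices X" for \<alpha> j
  proof -
    have "K j \<le> C" unfolding C_def by (intro member_le_sum K(1)) auto
    then have "K j * mass \<alpha> \<le> C * mass \<alpha>" by (intro mult_right_mono) auto
    then show ?thesis using K(2)[OF a, of j] by linarith
  qed
  moreover have "\<bar>coord_energy \<alpha> i j\<bar> \<le> C * mass \<alpha>" if a: "\<alpha> \<in> indices X" for \<alpha> i j
  proof -
    have "(coord_energy \<alpha> i j)\<^sup>2 \<le> cell_trace \<alpha> (\<lambda>x. \<psi> x $ i) * cell_trace \<alpha> (\<lambda>x. \<psi> x $ j)"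
      unfolding coord_energy_def by (rule cell_bilinear_le[OF a])
    also have "\<dots> \<le> (C * mass \<alpha>) * (C * mass \<alpha>)"
      by (intro mult_mono tr a cell_trace_nonneg mult_nonneg_nonneg C0) auto
    finally have "(coord_energy \<alpha> i j)\<^sup>2 \<le> (C * mass \<alpha>)\<^sup>2" by (simp add: power2_eq_square)
    then have "\<bar>coord_energy \<alpha> i j\<bar> \<le> \<bar>C * mass \<alpha>\<bar>" by (simp only: abs_le_square_iff)
    then show ?thesis using C0 by simp
  qed
  ultimately show thesis by (rule that[OF C0])
qed

lemma Z_cell_entry:
  assumes a: "\<alpha> \<in> indices X"
  shows "Z_cell X v N \<alpha> $ i $ j = coord_energy \<alpha> i j / mass \<alpha>"
proof -
  let ?i = "\<lambda>p x. if x = p then 1 else 0 :: real"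
  have "(\<Sum>p\<in>vtx X \<alpha>. \<Sum>q\<in>vtx X \<alpha>. cell_map X v \<alpha> p i * cell_matrix X \<alpha> p q * cell_map X v \<alpha> q j)
      = (\<Sum>p\<in>vtx X \<alpha>. \<Sum>q\<in>vtx X \<alpha>. \<psi> p $ i * \<psi> q $ j * cell_bilinear \<alpha> (?i p) (?i q))"
    by (intro sum.cong refl) (simp add: cell_map_def cell_matrix_eq[OF a] psi_component)
  also have "\<dots> = coord_energy \<alpha> i j"
    unfolding coord_energy_def cell_bilinear_def by (rule resform.trace_form_expand[OF ct_rules, OF a a a a, symmetric])
  finally show ?thesis by (simp add: Z_cell_def)
qed

text \<open>
  Cells of one level overlap in vertices only, so at most one of them qualifies, and a sum over
  the level can replace the definite description. Where no cell qualifies because the mass is 0,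
  division by zero gives the same value 0.
\<close>

lemma Z_level_eq:
  "Z_level X v N n x = (\<Sum>\<alpha>\<in>level X n. indicator (cell X \<alpha> - vtx X \<alpha>) x *\<^sub>R Z_cell X v N \<alpha>)"
proof -
  define P where "P = (\<lambda>\<alpha>. \<alpha> \<in> level X n \<and> mass \<alpha> \<noteq> 0 \<and> x \<in> cell X \<alpha> - vtx X \<alpha>)"
  have Z: "Z_level X v N n x = (if \<exists>\<alpha>. P \<alpha> then Z_cell X v N (THE \<alpha>. P \<alpha>) else 0)"
    unfolding Z_level_def P_def Let_def by (rule refl)
  have zero: "Z_cell X v N \<alpha> = 0" if "\<alpha> \<in> level X n" "mass \<alpha> = 0" for \<alpha>
    using Z_cell_entry[OF idx[OF that(1)]] that(2) by (simp add: vec_eq_iff)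
  show ?thesis
  proof (cases "\<exists>\<alpha>. P \<alpha>")
    case True
    then obtain \<alpha> where a: "P \<alpha>" by blast
    have uniq: "\<beta> = \<alpha>" if b: "\<beta> \<in> level X n" "x \<in> cell X \<beta>" for \<beta>
    proof (rule ccontr)
      assume "\<beta> \<noteq> \<alpha>"
      then have "x \<in> vtx X \<alpha>" using cell_inter[OF b(1), of \<alpha>] b a unfolding P_def by blast
      then show False using a by (simp add: P_def)
    qed
    have the: "(THE \<alpha>. P \<alpha>) = \<alpha>" by (rule the_equality[of P]) (use a uniq in \<open>auto simp: P_def\<close>)
    have "(\<Sum>\<beta>\<in>level X n. indicator (cell X \<beta> - vtx X \<beta>) x *\<^sub>R Z_cell X v N \<beta>)
        = (\<Sum>\<beta>\<in>level X n. if \<beta> = \<alpha> then Z_cell X v N \<alpha> else 0)"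
    proof (rule sum.cong[OF refl])
      fix \<beta> assume b: "\<beta> \<in> level X n"
      show "indicator (cell X \<beta> - vtx X \<beta>) x *\<^sub>R Z_cell X v N \<beta> = (if \<beta> = \<alpha> then Z_cell X v N \<alpha> else 0)"
      proof (cases "\<beta> = \<alpha>")
        case True
        have "x \<in> cell X \<alpha> - vtx X \<alpha>" using a by (simp add: P_def)
        then show ?thesis using True by simp
      next
        case False
        then have "x \<notin> cell X \<beta>" using uniq[OF b] by blast
        then show ?thesis using False by simp
      qed
    qed
    also have "\<dots> = Z_cell X v N \<alpha>" using a level_finite by (simp add: P_def)
    finally show ?thesis using Z True by (simp only: the if_True)
  next
    case False
    then have "Z_level X v N n x = 0" using Z by simp
    moreover have "(\<Sum>\<alpha>\<in>level X n. indicator (cell X \<alpha> - vtx X \<alpha>) x *\<^sub>R Z_cell X v N \<alpha>) = 0"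
    proof (rule sum.neutral, rule ballI)
      fix \<alpha> assume "\<alpha> \<in> level X n"
      then show "indicator (cell X \<alpha> - vtx X \<alpha>) x *\<^sub>R Z_cell X v N \<alpha> = 0"
        using False zero[of \<alpha>] by (cases "x \<in> cell X \<alpha> - vtx X \<alpha>") (auto simp: P_def)
    qed
    ultimately show ?thesis by simp
  qed
qed

lemma Z_level_cell:
  assumes a: "\<alpha> \<in> level X n" and x: "x \<in> cell X \<alpha>" "x \<notin> all_vertices X"
  shows "Z_level X v N n x = Z_cell X v N \<alpha>"
proof -
  have "indicator (cell X \<beta> - vtx X \<beta>) x *\<^sub>R Z_cell X v N \<beta> = (if \<beta> = \<alpha> then Z_cell X v N \<alpha> else 0)"
    if b: "\<beta> \<in> level X n" for \<beta>
  proof (cases "\<beta> = \<alpha>")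
    case True
    have "x \<in> cell X \<alpha> - vtx X \<alpha>" using x vtx_all[OF idx[OF a]] by blast
    then show ?thesis using True by simp
  next
    case False
    then have "x \<notin> cell X \<beta>" using cell_of_point[OF a b x(1) _ x(2)] by blast
    then show ?thesis using False by simp
  qed
  then show ?thesis using a level_finite by (simp add: Z_level_eq)
qed

lemma Z_level_measurable [measurable]: "Z_level X v N n \<in> borel_measurable N"
proof -
  have [measurable]: "cell X \<alpha> - vtx X \<alpha> \<in> sets N" if "\<alpha> \<in> level X n" for \<alpha>
    using idx[OF that] vtx_finite vtx_cell cell_points
    by (intro sets.Diff cell_sets borel_sets_N borel_closed finite_imp_closed) blast+
  have "(\<lambda>x. \<Sum>\<alpha>\<in>level X n. indicator (cell X \<alpha> - vtx X \<alpha>) x *\<^sub>R Z_cell X v N \<alpha>) \<in> borel_measurable N"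
    by measurable
  then show ?thesis by (simp add: Z_level_eq[abs_def])
qed

lemma Z_field_measurable [measurable]: "Z_field X v N \<in> borel_measurable N"
  unfolding Z_field_def[abs_def] by (rule borel_measurable_lim_metric) measurable

lemma Z_martingale:
  "\<exists>C\<ge>0. (\<forall>\<alpha>\<in>indices X. \<forall>i. cell_trace \<alpha> (\<lambda>x. \<psi> x $ i) \<le> C * mass \<alpha>) \<and>
    (\<forall>i j. cell_martingale X N (\<lambda>\<alpha>. coord_energy \<alpha> i j) C (\<lambda>n x. Z_level X v N n x $ i $ j))"
proof -
  obtain C where C: "C \<ge> 0" "\<And>\<alpha> i. \<alpha> \<in> indices X \<Longrightarrow> cell_trace \<alpha> (\<lambda>x. \<psi> x $ i) \<le> C * mass \<alpha>"
    "\<And>\<alpha> i j. \<alpha> \<in> indices X \<Longrightarrow> \<bar>coord_energy \<alpha> i j\<bar> \<le> C * mass \<alpha>" by (rule coord_energy_dominated) blast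
  show ?thesis
  proof (intro exI[of _ C] conjI ballI allI C(1,2))
    fix i j :: 'm
    show "cell_martingale X N (\<lambda>\<alpha>. coord_energy \<alpha> i j) C (\<lambda>n x. Z_level X v N n x $ i $ j)"
    proof unfold_locales
      have "(\<lambda>A :: real ^ 'm ^ 'm. A $ i $ j) \<in> borel_measurable borel"
        by (intro borel_measurable_continuous_onI continuous_intros)
      then show "(\<lambda>x. Z_level X v N n x $ i $ j) \<in> borel_measurable N" for n
        by (rule measurable_compose[OF Z_level_measurable])
      show "coord_energy \<alpha> i j = (\<Sum>\<beta>\<in>sub n \<alpha>. coord_energy \<beta> i j)" if "\<alpha> \<in> level X m" "m \<le> n" for \<alpha> m n
        by (rule coord_energy_additive[OF that])
      show "\<bar>coord_energy \<alpha> i j\<bar> \<le> C * mass \<alpha>" if "\<alpha> \<in> indices X" for \<alpha> by (rule C(3)[OF that])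
      show "Z_level X v N n x $ i $ j = coord_energy \<alpha> i j / mass \<alpha>"
        if "\<alpha> \<in> level X n" "x \<in> cell X \<alpha>" "x \<notin> all_vertices X" for \<alpha> n x
        by (simp only: Z_level_cell[OF that] Z_cell_entry[OF idx[OF that(1)]])
    qed
  qed
qed

lemma matrix_form: "u \<bullet> (A *v w) = (\<Sum>i\<in>UNIV. \<Sum>j\<in>UNIV. u $ i * A $ i $ j * w $ j)"
  for A :: "real ^ 'm ^ 'm"
  by (simp add: inner_vec_def matrix_vector_mult_def sum_distrib_left mult_ac)

lemma Z_level_tendsto: "AE x in N. (\<lambda>n. Z_level X v N n x) \<longlonglongrightarrow> Z_field X v N x"
proof -
  obtain C where M: "\<forall>i j. cell_martingale X N (\<lambda>\<alpha>. coord_energy \<alpha> i j) C (\<lambda>n x. Z_level X v N n x $ i $ j)"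
    using Z_martingale by blast
  have "AE x in N. \<forall>i j. convergent (\<lambda>n. Z_level X v N n x $ i $ j)"
    unfolding AE_all_countable by (intro allI cell_martingale.martingale_convergence[OF M[rule_format]])
  then show ?thesis
  proof eventually_elim
    case (elim x)
    then have "(\<lambda>n. Z_level X v N n x $ i $ j) \<longlonglongrightarrow> lim (\<lambda>n. Z_level X v N n x $ i $ j)" for i j
      by (simp add: convergent_LIMSEQ_iff)
    then have "(\<lambda>n. Z_level X v N n x) \<longlonglongrightarrow> (\<chi> i j. lim (\<lambda>n. Z_level X v N n x $ i $ j))"
      by (intro vec_tendstoI) simp
    then have "convergent (\<lambda>n. Z_level X v N n x)" by (rule convergentI)
    then show ?case unfolding Z_field_def by (simp add: convergent_LIMSEQ_iff)
  qed
qed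

end

section \<open>Continuously differentiable functions\<close>

lemma nabla_has_derivative:
  fixes \<phi> :: "real ^ 'm::finite \<Rightarrow> real"
  assumes "C1 \<phi>"
  shows "(\<phi> has_derivative (\<lambda>h. nabla \<phi> y \<bullet> h)) (at y)"
proof -
  let ?F = "frechet_derivative \<phi> (at y)"
  have F: "(\<phi> has_derivative ?F) (at y)"
    using assms by (simp add: C1_def frechet_derivative_works[symmetric])
  interpret F: linear ?F by (rule has_derivative_linear[OF F])
  have "?F h = nabla \<phi> y \<bullet> h" for h
  proof -
    have "?F h = ?F (\<Sum>i\<in>UNIV. h $ i *\<^sub>R axis i 1)"
      using basis_expansion[of h] by (simp add: scalar_mult_eq_scaleR)
    also have "\<dots> = nabla \<phi> y \<bullet> h"
      by (simp add: F.sum F.scaleR nabla_def inner_vec_def mult.commute)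
    finally show ?thesis .
  qed
  then have "?F = (\<lambda>h. nabla \<phi> y \<bullet> h)" by (rule ext)
  then show ?thesis using F by (simp only:)
qed

lemma C1I:
  fixes \<phi> :: "real ^ 'm::finite \<Rightarrow> real"
  assumes D: "\<And>y. (\<phi> has_derivative (\<lambda>h. G y \<bullet> h)) (at y)" and G: "continuous_on UNIV G"
  shows "C1 \<phi>" and "nabla \<phi> = G"
proof -
  have F: "frechet_derivative \<phi> (at y) = (\<lambda>h. G y \<bullet> h)" for y
    using frechet_derivative_at[OF D[of y]] by simp
  show *: "nabla \<phi> = G"
    by (rule ext) (simp add: nabla_def F inner_axis vec_eq_iff)
  show "C1 \<phi>"
    unfolding C1_def * using D G by (auto simp: differentiable_def)
qed

lemma C1_isCont: "C1 \<phi> \<Longrightarrow> continuous_on UNIV \<phi>"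
  by (meson continuous_at_imp_continuous_on has_derivative_continuous nabla_has_derivative)

text \<open>
  The mean value inequality for \<open>\<phi>\<close> minus its linear part.
\<close>

lemma C1_linearisation:
  fixes \<phi> :: "real ^ 'm::finite \<Rightarrow> real"
  assumes c1: "C1 \<phi>" and S: "convex S" and le: "\<And>w. w \<in> S \<Longrightarrow> norm (nabla \<phi> w - t) \<le> e"
    and y: "y \<in> S" and z: "z \<in> S"
  shows "\<bar>\<phi> y - \<phi> z - t \<bullet> (y - z)\<bar> \<le> e * norm (y - z)"
proof -
  have "norm ((\<phi> y - t \<bullet> y) - (\<phi> z - t \<bullet> z)) \<le> e * norm (y - z)"
  proof (rule differentiable_bound[OF S, where f' = "\<lambda>w h. (nabla \<phi> w - t) \<bullet> h"])
    fix w assume w: "w \<in> S"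
    have "((\<lambda>w. \<phi> w - t \<bullet> w) has_derivative (\<lambda>h. nabla \<phi> w \<bullet> h - t \<bullet> h)) (at w)"
      by (intro derivative_intros nabla_has_derivative c1)
    then show "((\<lambda>w. \<phi> w - t \<bullet> w) has_derivative (\<lambda>h. (nabla \<phi> w - t) \<bullet> h)) (at w within S)"
      by (simp add: inner_diff_left has_derivative_at_withinI)
    show "onorm (\<lambda>h. (nabla \<phi> w - t) \<bullet> h) \<le> e"
    proof (rule onorm_le)
      fix h
      have "norm ((nabla \<phi> w - t) \<bullet> h) \<le> norm (nabla \<phi> w - t) * norm h"
        by (simp add: Cauchy_Schwarz_ineq2)
      also have "\<dots> \<le> e * norm h" using le[OF w] by (rule mult_right_mono) simp
      finally show "norm ((nabla \<phi> w - t) \<bullet> h) \<le> e * norm h" .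
    qed
  qed (use y z in auto)
  then show ?thesis by (simp add: inner_diff_right algebra_simps)
qed

section \<open>The energy of continuously differentiable functions\<close>

lemma vec_nth_measurable:
  fixes f :: "'a \<Rightarrow> real ^ 'm::finite"
  assumes "f \<in> borel_measurable M"
  shows "(\<lambda>x. f x $ i) \<in> borel_measurable M"
proof -
  have "(\<lambda>y::real ^ 'm. y $ i) \<in> borel_measurable borel"
    by (intro borel_measurable_continuous_onI continuous_intros)
  then show ?thesis by (rule measurable_compose[OF assms])
qed

context harmonic_fractal
begin

abbreviation Z :: "'a \<Rightarrow> real ^ 'm ^ 'm" where
  "Z \<equiv> Z_field X v N"

text \<open>
  Holds almost everywhere for a suitable \<open>K\<close>. The properties of \<open>Z\<close>
  are bundled because they are needed together, at one point at a time.
\<close>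

definition psd_bounded :: "real \<Rightarrow> 'a \<Rightarrow> bool" where
  "psd_bounded K x \<longleftrightarrow> (\<forall>u w. \<bar>u \<bullet> (Z x *v w)\<bar> \<le> K * norm u * norm w) \<and>
     (\<forall>u w. u \<bullet> (Z x *v w) = w \<bullet> (Z x *v u)) \<and> (\<forall>u. 0 \<le> u \<bullet> (Z x *v u))"

lemma psd_boundedD:
  assumes "psd_bounded K x"
  shows "\<bar>u \<bullet> (Z x *v w)\<bar> \<le> K * norm u * norm w" "u \<bullet> (Z x *v w) = w \<bullet> (Z x *v u)" "0 \<le> u \<bullet> (Z x *v u)"
  using assms unfolding psd_bounded_def by blast+

lemma cell_bilinear_linear:
  assumes a: "\<alpha> \<in> indices X"
  shows "cell_bilinear \<alpha> (\<lambda>x. u \<bullet> \<psi> x) (\<lambda>x. w \<bullet> \<psi> x) = (\<Sum>i\<in>UNIV. \<Sum>j\<in>UNIV. u $ i * coord_energy \<alpha> i j * w $ j)"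
proof -
  have "cell_bilinear \<alpha> (\<lambda>x. u \<bullet> \<psi> x) (\<lambda>x. w \<bullet> \<psi> x)
      = (\<Sum>j\<in>UNIV. w $ j * cell_bilinear \<alpha> (\<lambda>x. u \<bullet> \<psi> x) (\<lambda>x. \<psi> x $ j))"
    unfolding inner_psi[of w] by (rule cell_bilinear_sum[OF a]) simp
  also have "\<dots> = (\<Sum>j\<in>UNIV. w $ j * cell_bilinear \<alpha> (\<lambda>x. \<psi> x $ j) (\<lambda>x. u \<bullet> \<psi> x))"
    by (simp only: cell_bilinear_sym[OF a, of "\<lambda>x. u \<bullet> \<psi> x"])
  also have "\<dots> = (\<Sum>j\<in>UNIV. w $ j * (\<Sum>i\<in>UNIV. u $ i * coord_energy \<alpha> j i))"
    unfolding inner_psi[of u] coord_energy_def by (subst cell_bilinear_sum[OF a]) auto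
  also have "\<dots> = (\<Sum>i\<in>UNIV. \<Sum>j\<in>UNIV. u $ i * coord_energy \<alpha> i j * w $ j)"
    unfolding sum_distrib_left by (subst sum.swap) (simp add: coord_energy_sym[OF a] mult_ac)
  finally show ?thesis .
qed

lemma Z_cell_form:
  assumes a: "\<alpha> \<in> indices X"
  shows "u \<bullet> (Z_cell X v N \<alpha> *v w) = cell_bilinear \<alpha> (\<lambda>x. u \<bullet> \<psi> x) (\<lambda>x. w \<bullet> \<psi> x) / mass \<alpha>"
  unfolding matrix_form cell_bilinear_linear[OF a] Z_cell_entry[OF a]
  by (simp add: sum_divide_distrib)

lemma form_tendsto: "A \<longlonglongrightarrow> B \<Longrightarrow> (\<lambda>n. u \<bullet> (A n *v w)) \<longlonglongrightarrow> u \<bullet> (B *v w)"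
  for A :: "nat \<Rightarrow> real ^ 'm ^ 'm"
  unfolding matrix_form by (intro tendsto_intros)

text \<open>
  Boundedness, symmetry and positivity hold for the matrices of all cells and pass to the limit.
\<close>

lemma Z_psd_bounded: "\<exists>K\<ge>0. AE x in N. psd_bounded K x"
proof -
  obtain C where C: "C \<ge> 0" "\<And>\<alpha> i j. \<alpha> \<in> indices X \<Longrightarrow> \<bar>coord_energy \<alpha> i j\<bar> \<le> C * mass \<alpha>"
    by (rule coord_energy_dominated) blast
  let ?M = "real CARD('m)"
  have "AE x in N. psd_bounded (C * ?M\<^sup>2) x"
    using Z_level_tendsto AE_not_vertex AE_space
  proof eventually_elim
    case (elim x)
    let ?Z = "\<lambda>n. Z_level X v N n x"
    have ex: "\<exists>\<alpha>\<in>indices X. ?Z n = Z_cell X v N \<alpha>" for n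
      using level_cover[of n] elim Z_level_cell[of _ n x] idx by (auto simp: space_N)
    note lim = form_tendsto[OF elim(1)]
    have form_bound: "\<bar>u \<bullet> (?Z n *v w)\<bar> \<le> C * ?M\<^sup>2 * norm u * norm w" for n u w
    proof -
      obtain \<alpha> where a: "\<alpha> \<in> indices X" "?Z n = Z_cell X v N \<alpha>" using ex by blast
      have entry: "\<bar>?Z n $ i $ j\<bar> \<le> C" for i j
      proof (cases "mass \<alpha> = 0")
        case False
        then have "mass \<alpha> > 0" using measure_nonneg[of N "cell X \<alpha>"] by linarith
        then show ?thesis using C(2)[OF a(1), of i j] by (simp add: a(2) Z_cell_entry[OF a(1)] field_simps)
      qed (use C(1) in \<open>simp add: a(2) Z_cell_entry[OF a(1)]\<close>)
      have "\<bar>u \<bullet> (?Z n *v w)\<bar> \<le> (\<Sum>i\<in>UNIV. \<Sum>j\<in>UNIV. \<bar>u $ i * ?Z n $ i $ j * w $ j\<bar>)"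
        unfolding matrix_form by (rule order_trans[OF sum_abs]) (intro sum_mono sum_abs)
      also have "\<dots> \<le> (\<Sum>i\<in>(UNIV::'m set). \<Sum>j\<in>(UNIV::'m set). norm u * C * norm w)"
      proof (intro sum_mono)
        fix i j :: 'm
        show "\<bar>u $ i * ?Z n $ i $ j * w $ j\<bar> \<le> norm u * C * norm w"
          unfolding abs_mult using entry[of i j] component_le_norm_cart[of u i] component_le_norm_cart[of w j] C(1)
          by (intro mult_mono mult_nonneg_nonneg) auto
      qed
      also have "\<dots> = C * ?M\<^sup>2 * norm u * norm w" by (simp add: power2_eq_square)
      finally show ?thesis .
    qed
    show ?case
      unfolding psd_bounded_def
    proof (intro conjI allI)
      show "\<bar>u \<bullet> (Z x *v w)\<bar> \<le> C * ?M\<^sup>2 * norm u * norm w" for u w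
        using tendsto_rabs[OF lim[of u w]] form_bound by (intro LIMSEQ_le_const2) auto
      have "u \<bullet> (?Z n *v w) = w \<bullet> (?Z n *v u)" for n u w
        using ex[of n] cell_bilinear_sym by (auto simp: Z_cell_form)
      then show "u \<bullet> (Z x *v w) = w \<bullet> (Z x *v u)" for u w
        using LIMSEQ_unique[OF lim[of u w]] lim[of w u] by simp
      have "0 \<le> u \<bullet> (?Z n *v u)" for n u
        using ex[of n] cell_trace_nonneg cell_trace_bilinear by (auto simp: Z_cell_form)
      then show "0 \<le> u \<bullet> (Z x *v u)" for u
        using lim[of u u] by (intro LIMSEQ_le_const) auto
    qed
  qed
  then show ?thesis using C(1) by (intro exI[of _ "C * ?M\<^sup>2"]) auto
qed

lemma Z_form_measurable:
  assumes "u \<in> borel_measurable N" "w \<in> borel_measurable N"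
  shows "(\<lambda>x. u x \<bullet> (Z x *v w x)) \<in> borel_measurable N"
proof -
  have [measurable]: "(\<lambda>x. Z x $ i $ j) \<in> borel_measurable N" for i j
  proof -
    have "(\<lambda>y::real ^ 'm ^ 'm. y $ i $ j) \<in> borel_measurable borel"
      by (intro borel_measurable_continuous_onI continuous_intros)
    then show ?thesis by (rule measurable_compose[OF Z_field_measurable])
  qed
  have [measurable]: "(\<lambda>x. u x $ i) \<in> borel_measurable N" "(\<lambda>x. w x $ i) \<in> borel_measurable N" for i
    by (intro vec_nth_measurable assms)+
  show ?thesis unfolding matrix_form by measurable
qed

lemma Z_form_integrable:
  assumes "u \<in> borel_measurable N" "w \<in> borel_measurable N"
    and u: "AE x in N. norm (u x) \<le> L" and w: "AE x in N. norm (w x) \<le> L'"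
  shows "integrable N (\<lambda>x. u x \<bullet> (Z x *v w x))"
proof -
  obtain K where K: "K \<ge> 0" "AE x in N. psd_bounded K x" using Z_psd_bounded by blast
  show ?thesis
  proof (rule integrable_const_bound)
    show "AE x in N. norm (u x \<bullet> (Z x *v w x)) \<le> K * L * L'"
      using K(2) u w
    proof eventually_elim
      case (elim x)
      have "\<bar>u x \<bullet> (Z x *v w x)\<bar> \<le> K * norm (u x) * norm (w x)" using elim(1) by (simp add: psd_bounded_def)
      also have "\<dots> \<le> K * L * L'"
        using elim K(1) norm_ge_zero[of "u x"] norm_ge_zero[of "w x"]
        by (intro mult_mono mult_left_mono mult_nonneg_nonneg) linarith+
      finally show ?case by simp
    qed
  qed (rule Z_form_measurable[OF assms(1,2)])
qed

text \<open>
  Integrals of the limit field over a cell are those of the approximating matrices, i.e. trace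
  energies.
\<close>

lemma Z_integral:
  assumes a: "\<alpha> \<in> level X m"
  shows "cell_integral \<alpha> (\<lambda>x. t \<bullet> (Z x *v t)) = cell_trace \<alpha> (\<lambda>x. t \<bullet> \<psi> x)"
proof -
  obtain C where M: "\<forall>i j. cell_martingale X N (\<lambda>\<alpha>. coord_energy \<alpha> i j) C (\<lambda>n x. Z_level X v N n x $ i $ j)"
    using Z_martingale by blast
  have entry: "cell_integral \<alpha> (\<lambda>x. Z x $ i $ j) = coord_energy \<alpha> i j" for i j
  proof (rule cell_martingale.martingale_limit_integral[OF M[rule_format] _ _ a])
    have "(\<lambda>y::real ^ 'm ^ 'm. y $ i $ j) \<in> borel_measurable borel"
      by (intro borel_measurable_continuous_onI continuous_intros)
    then show "(\<lambda>x. Z x $ i $ j) \<in> borel_measurable N" by (rule measurable_compose[OF Z_field_measurable])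
    show "AE x in N. (\<lambda>n. Z_level X v N n x $ i $ j) \<longlonglongrightarrow> Z x $ i $ j"
      using Z_level_tendsto by eventually_elim (intro tendsto_vec_nth)
  qed
  have int: "integrable N (\<lambda>x. indicator (cell X \<alpha>) x * Z x $ i $ j)" for i j
  proof -
    have "integrable N (\<lambda>x. axis i 1 \<bullet> (Z x *v axis j 1))"
      by (rule Z_form_integrable[where L = 1 and L' = 1]) auto
    moreover have "axis i 1 \<bullet> (Z x *v axis j 1) = Z x $ i $ j" for x
      by (simp add: inner_axis' matrix_vector_mul_component inner_axis)
    ultimately show ?thesis using integrable_cell[OF idx[OF a]] by simp
  qed
  have "cell_integral \<alpha> (\<lambda>x. t \<bullet> (Z x *v t))
      = (LINT x|N. (\<Sum>i\<in>UNIV. \<Sum>j\<in>UNIV. t $ i * t $ j * (indicator (cell X \<alpha>) x * Z x $ i $ j)))"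
    unfolding matrix_form by (simp add: sum_distrib_left mult_ac)
  also have "\<dots> = (\<Sum>i\<in>UNIV. \<Sum>j\<in>UNIV. t $ i * t $ j * coord_energy \<alpha> i j)"
    by (simp add: Bochner_Integration.integral_sum Bochner_Integration.integrable_sum int entry)
  also have "\<dots> = cell_trace \<alpha> (\<lambda>x. t \<bullet> \<psi> x)"
    unfolding cell_trace_bilinear[OF idx[OF a]] cell_bilinear_linear[OF idx[OF a]] by (simp add: mult_ac)
  finally show ?thesis .
qed

lemma continuous_measurable:
  fixes w :: "'a \<Rightarrow> 'c::{topological_space, second_countable_topology}"
  assumes "continuous_on (points X) w"
  shows "w \<in> borel_measurable N"
  using borel_measurable_continuous_on_restrict[OF assms] measurable_cong_sets[OF sets_N refl] by blast

lemma nabla_continuous: "C1 \<phi> \<Longrightarrow> continuous_on (points X) (\<lambda>x. nabla \<phi> (\<psi> x))"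
  unfolding C1_def using continuous_on_compose2[OF _ psi_continuous] by blast

lemma nabla_bounded:
  assumes "C1 \<phi>"
  obtains L where "L \<ge> 0" "\<And>x. x \<in> points X \<Longrightarrow> norm (nabla \<phi> (\<psi> x)) \<le> L"
proof -
  have "bounded ((\<lambda>x. nabla \<phi> (\<psi> x)) ` points X)"
    by (intro compact_imp_bounded compact_continuous_image nabla_continuous assms compact_points)
  then obtain L where "L > 0" "\<forall>y\<in>(\<lambda>x. nabla \<phi> (\<psi> x)) ` points X. norm y \<le> L"
    unfolding bounded_pos by blast
  then show thesis by (intro that[of L]) auto
qed

lemma nabla_form_integrable:
  assumes "C1 \<phi>"
  shows "integrable N (\<lambda>x. nabla \<phi> (\<psi> x) \<bullet> (Z x *v nabla \<phi> (\<psi> x)))"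
proof -
  obtain L where L: "\<And>x. x \<in> points X \<Longrightarrow> norm (nabla \<phi> (\<psi> x)) \<le> L" using nabla_bounded[OF assms] by metis
  show ?thesis
    by (rule Z_form_integrable[where L = L and L' = L])
       (auto intro!: continuous_measurable nabla_continuous assms AE_I2 L simp: space_N)
qed

text \<open>
  Uniform continuity, together with the shrinking of cells.
\<close>

lemma fine_cells:
  assumes c1: "C1 \<phi>" and e: "e > 0"
  shows "\<exists>n0. \<forall>n\<ge>n0. \<forall>\<beta>\<in>level X n. \<forall>x0\<in>cell X \<beta>.
    (\<forall>x\<in>cell X \<beta>. norm (nabla \<phi> (\<psi> x) - nabla \<phi> (\<psi> x0)) \<le> e) \<and>
    (\<forall>p\<in>cell X \<beta>. \<forall>q\<in>cell X \<beta>. \<bar>\<phi> (\<psi> p) - \<phi> (\<psi> q) - nabla \<phi> (\<psi> x0) \<bullet> (\<psi> p - \<psi> q)\<bar> \<le> e * norm (\<psi> p - \<psi> q))"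
proof -
  have "bounded (\<psi> ` points X)"
    by (intro compact_imp_bounded compact_continuous_image psi_continuous compact_points)
  then obtain R where "\<forall>y\<in>\<psi> ` points X. norm y \<le> R" unfolding bounded_iff by (rule exE)
  then have R: "\<psi> ` points X \<subseteq> cball 0 R" by auto
  have "uniformly_continuous_on (cball 0 R) (nabla \<phi>)"
    using c1 by (intro compact_uniformly_continuous) (auto simp: C1_def intro: continuous_on_subset)
  then obtain d where d: "d > 0" "\<And>y z. y \<in> cball 0 R \<Longrightarrow> z \<in> cball 0 R \<Longrightarrow> dist y z < d \<Longrightarrow>
      dist (nabla \<phi> y) (nabla \<phi> z) < e"
    using e unfolding uniformly_continuous_on_def by metis
  have "uniformly_continuous_on (points X) \<psi>"
    by (intro compact_uniformly_continuous psi_continuous compact_points)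
  then obtain d' where d': "d' > 0" "\<And>x y. x \<in> points X \<Longrightarrow> y \<in> points X \<Longrightarrow> dist x y < d' \<Longrightarrow> dist (\<psi> x) (\<psi> y) < d"
    using d(1) unfolding uniformly_continuous_on_def by metis
  obtain n0 where n0: "\<And>n \<beta> x y. n \<ge> n0 \<Longrightarrow> \<beta> \<in> level X n \<Longrightarrow> x \<in> cell X \<beta> \<Longrightarrow> y \<in> cell X \<beta> \<Longrightarrow> dist x y < d'"
    using cells_shrink[OF d'(1)] by blast
  show ?thesis
  proof (intro exI[of _ n0] allI impI ballI)
    fix n \<beta> x0 assume n: "n0 \<le> n" and b: "\<beta> \<in> level X n" and x0: "x0 \<in> cell X \<beta>"
    \<comment> \<open>segments between points of \<open>\<psi> ` cell X \<beta>\<close> may leave the image of \<open>\<psi>\<close>, so the gradient is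
      controlled on a convex set\<close>
    let ?S = "cball 0 R \<inter> ball (\<psi> x0) d"
    have pts: "x \<in> points X" if "x \<in> cell X \<beta>" for x using that cell_points[OF idx[OF b]] by blast
    have S: "\<psi> x \<in> ?S" if x: "x \<in> cell X \<beta>" for x
      using d'(2)[OF pts[OF x0] pts[OF x] n0[OF n b x0 x]] R pts[OF x] by auto
    have le: "norm (nabla \<phi> w - nabla \<phi> (\<psi> x0)) \<le> e" if "w \<in> ?S" for w
      using d(2)[of w "\<psi> x0"] that S[OF x0] by (simp add: dist_norm[symmetric] dist_commute)
    show "(\<forall>x\<in>cell X \<beta>. norm (nabla \<phi> (\<psi> x) - nabla \<phi> (\<psi> x0)) \<le> e) \<and>
      (\<forall>p\<in>cell X \<beta>. \<forall>q\<in>cell X \<beta>. \<bar>\<phi> (\<psi> p) - \<phi> (\<psi> q) - nabla \<phi> (\<psi> x0) \<bullet> (\<psi> p - \<psi> q)\<bar> \<le> e * norm (\<psi> p - \<psi> q))"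
    proof (intro conjI ballI)
      show "norm (nabla \<phi> (\<psi> x) - nabla \<phi> (\<psi> x0)) \<le> e" if "x \<in> cell X \<beta>" for x
        by (rule le[OF S[OF that]])
      show "\<bar>\<phi> (\<psi> p) - \<phi> (\<psi> q) - nabla \<phi> (\<psi> x0) \<bullet> (\<psi> p - \<psi> q)\<bar> \<le> e * norm (\<psi> p - \<psi> q)"
        if "p \<in> cell X \<beta>" "q \<in> cell X \<beta>" for p q
        by (rule C1_linearisation[OF c1 _ le S[OF that(1)] S[OF that(2)]]) (simp add: convex_Int)
    qed
  qed
qed

lemma norm_vec_sq: "(norm y)\<^sup>2 = (\<Sum>j\<in>UNIV. (y $ j)\<^sup>2)" for y :: "real ^ 'm"
  by (simp only: power2_norm_eq_inner inner_vec_def) (simp add: power2_eq_square)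

text \<open>
  On a small cell a \<open>C1\<close> function is a linear one, whose trace energy is an integral of
  \<open>Z\<close>, up to a remainder that is a contraction with small constant of the coordinates.
\<close>

lemma cell_energy_estimate:
  fixes K C L e :: real
  assumes c1: "C1 \<phi>" and K: "K \<ge> 0" "AE x in N. psd_bounded K x"
    and C: "C \<ge> 0" "\<And>\<alpha> i. \<alpha> \<in> indices X \<Longrightarrow> cell_trace \<alpha> (\<lambda>x. \<psi> x $ i) \<le> C * mass \<alpha>"
    and L: "L \<ge> 0" "\<And>x. x \<in> points X \<Longrightarrow> norm (nabla \<phi> (\<psi> x)) \<le> L"
    and e: "0 < e" "e \<le> 1" and b: "\<beta> \<in> level X n" and x0: "x0 \<in> cell X \<beta>"
    and fine: "\<And>x. x \<in> cell X \<beta> \<Longrightarrow> norm (nabla \<phi> (\<psi> x) - nabla \<phi> (\<psi> x0)) \<le> e"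
      "\<And>p q. p \<in> cell X \<beta> \<Longrightarrow> q \<in> cell X \<beta> \<Longrightarrow>
        \<bar>\<phi> (\<psi> p) - \<phi> (\<psi> q) - nabla \<phi> (\<psi> x0) \<bullet> (\<psi> p - \<psi> q)\<bar> \<le> e * norm (\<psi> p - \<psi> q)"
  shows "\<bar>cell_trace \<beta> (\<phi> \<circ> \<psi>) - cell_integral \<beta> (\<lambda>x. nabla \<phi> (\<psi> x) \<bullet> (Z x *v nabla \<phi> (\<psi> x)))\<bar>
    \<le> e * (2 * (K * L\<^sup>2 + CARD('m) * C) + CARD('m) * C + 2 * K * L) * mass \<beta>"
proof -
  note i = idx[OF b]
  define t where "t = nabla \<phi> (\<psi> x0)"
  define w where "w = (\<lambda>x. nabla \<phi> (\<psi> x))"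
  define \<rho> where "\<rho> = (\<lambda>x. \<phi> (\<psi> x) - t \<bullet> \<psi> x)"
  let ?M = "real CARD('m)" and ?m = "mass \<beta>"
  \<comment> \<open>up to the factor \<open>mass \<beta>\<close>, bounds for the trace energies of the linear part and of the coordinates\<close>
  define P where "P = K * L\<^sup>2"
  define R where "R = ?M * C"
  have PR: "P \<ge> 0" "R \<ge> 0" using K(1) C(1) by (auto simp: P_def R_def)
  have pts: "cell X \<beta> \<subseteq> points X" by (rule cell_points[OF i])
  have t: "norm t \<le> L" unfolding t_def using L(2) x0 pts by blast
  have [measurable]: "cell X \<beta> \<in> sets N" by (rule cell_sets[OF i])
  have tZ: "integrable N (\<lambda>x. t \<bullet> (Z x *v t))"
    by (rule Z_form_integrable[where L = L and L' = L]) (use t in auto)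
  have wZ: "integrable N (\<lambda>x. w x \<bullet> (Z x *v w x))"
    unfolding w_def by (rule nabla_form_integrable[OF c1])
  have T\<rho>: "cell_trace \<beta> \<rho> \<le> e\<^sup>2 * (R * ?m)"
  proof -
    have "cell_trace \<beta> \<rho> \<le> e\<^sup>2 * (\<Sum>j\<in>UNIV. cell_trace \<beta> (\<lambda>x. \<psi> x $ j))"
    proof (rule cell_trace_contraction[OF i])
      fix p q assume "p \<in> vtx X \<beta>" "q \<in> vtx X \<beta>"
      then have "\<bar>\<rho> p - \<rho> q\<bar> \<le> e * norm (\<psi> p - \<psi> q)"
        using fine(2)[of p q] vtx_cell[OF i] by (auto simp: \<rho>_def t_def inner_diff_right algebra_simps)
      then have "(\<rho> p - \<rho> q)\<^sup>2 \<le> (e * norm (\<psi> p - \<psi> q))\<^sup>2"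
        using e by (intro abs_le_square_iff[THEN iffD1]) simp
      then show "(\<rho> p - \<rho> q)\<^sup>2 \<le> e\<^sup>2 * (\<Sum>j\<in>UNIV. (\<psi> p $ j - \<psi> q $ j)\<^sup>2)"
        by (simp add: power_mult_distrib norm_vec_sq)
    qed simp
    also have "\<dots> \<le> e\<^sup>2 * (\<Sum>j\<in>(UNIV::'m set). C * ?m)"
      by (intro mult_left_mono sum_mono C(2) i) simp
    finally show ?thesis by (simp add: R_def)
  qed
  have Tt_int: "cell_trace \<beta> (\<lambda>x. t \<bullet> \<psi> x) = cell_integral \<beta> (\<lambda>x. t \<bullet> (Z x *v t))"
    by (rule Z_integral[OF b, symmetric])
  have Tt: "cell_trace \<beta> (\<lambda>x. t \<bullet> \<psi> x) \<le> P * ?m"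
  proof -
    have "cell_integral \<beta> (\<lambda>x. t \<bullet> (Z x *v t)) \<le> cell_integral \<beta> (\<lambda>_. P)"
    proof (rule integral_mono_AE)
      show "AE x in N. indicator (cell X \<beta>) x * (t \<bullet> (Z x *v t)) \<le> indicator (cell X \<beta>) x * P"
        using K(2)
      proof eventually_elim
        case (elim x)
        have "t \<bullet> (Z x *v t) \<le> K * norm t * norm t" using elim by (auto simp: psd_bounded_def abs_le_iff)
        also have "\<dots> \<le> P" unfolding P_def power2_eq_square mult.assoc
          using t K(1) L(1) by (intro mult_left_mono mult_mono) auto
        finally show ?case by (auto simp: indicator_def)
      qed
    qed (use integrable_cell[OF i tZ] integrable_cell[OF i, of "\<lambda>_. P"] in auto)
    then show ?thesis by (simp only: Tt_int cell_integral_const[OF i])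
  qed
  have B: "\<bar>cell_bilinear \<beta> (\<lambda>x. t \<bullet> \<psi> x) \<rho>\<bar> \<le> e * (P + R) * ?m"
  proof -
    have "(cell_bilinear \<beta> (\<lambda>x. t \<bullet> \<psi> x) \<rho>)\<^sup>2 \<le> (P * ?m) * (e\<^sup>2 * (R * ?m))"
      by (rule order_trans[OF cell_bilinear_le[OF i]])
         (intro mult_mono Tt T\<rho> cell_trace_nonneg i mult_nonneg_nonneg PR; simp)
    also have "\<dots> = (P * R) * (e * ?m)\<^sup>2" by (simp add: power2_eq_square)
    also have "\<dots> \<le> (P + R)\<^sup>2 * (e * ?m)\<^sup>2"
    proof (rule mult_right_mono[OF _ zero_le_power2])
      show "P * R \<le> (P + R)\<^sup>2" using PR mult_nonneg_nonneg[OF PR] by (simp add: power2_sum)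
    qed
    finally have "(cell_bilinear \<beta> (\<lambda>x. t \<bullet> \<psi> x) \<rho>)\<^sup>2 \<le> (e * (P + R) * ?m)\<^sup>2"
      by (simp add: power_mult_distrib mult_ac)
    then have "\<bar>cell_bilinear \<beta> (\<lambda>x. t \<bullet> \<psi> x) \<rho>\<bar> \<le> \<bar>e * (P + R) * ?m\<bar>" by (simp only: abs_le_square_iff)
    then show ?thesis using PR e by simp
  qed
  have "cell_trace \<beta> (\<phi> \<circ> \<psi>) = cell_trace \<beta> (\<lambda>x. t \<bullet> \<psi> x + \<rho> x)"
    by (simp add: \<rho>_def comp_def)
  also have "\<dots> = cell_trace \<beta> (\<lambda>x. t \<bullet> \<psi> x) + 2 * cell_bilinear \<beta> (\<lambda>x. t \<bullet> \<psi> x) \<rho> + cell_trace \<beta> \<rho>"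
    by (rule cell_trace_add[OF i])
  finally have 1: "\<bar>cell_trace \<beta> (\<phi> \<circ> \<psi>) - cell_trace \<beta> (\<lambda>x. t \<bullet> \<psi> x)\<bar> \<le> 2 * (e * (P + R) * ?m) + e * (R * ?m)"
  proof -
    assume eq: "cell_trace \<beta> (\<phi> \<circ> \<psi>) = cell_trace \<beta> (\<lambda>x. t \<bullet> \<psi> x) + 2 * cell_bilinear \<beta> (\<lambda>x. t \<bullet> \<psi> x) \<rho> + cell_trace \<beta> \<rho>"
    have "e\<^sup>2 * (R * ?m) \<le> e * (R * ?m)"
      using e PR by (intro mult_right_mono) (auto simp: power2_eq_square mult_left_le)
    then show ?thesis using B T\<rho> cell_trace_nonneg[OF i, of \<rho>] unfolding eq by linarith
  qed
  have 2: "\<bar>cell_trace \<beta> (\<lambda>x. t \<bullet> \<psi> x) - cell_integral \<beta> (\<lambda>x. w x \<bullet> (Z x *v w x))\<bar> \<le> 2 * K * L * e * ?m"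
  proof -
    have "cell_trace \<beta> (\<lambda>x. t \<bullet> \<psi> x) - cell_integral \<beta> (\<lambda>x. w x \<bullet> (Z x *v w x))
        = cell_integral \<beta> (\<lambda>x. t \<bullet> (Z x *v t) - w x \<bullet> (Z x *v w x))"
      unfolding Tt_int right_diff_distrib
      by (rule Bochner_Integration.integral_diff[symmetric]) (intro integrable_cell i tZ wZ)+
    also have "\<bar>\<dots>\<bar> \<le> cell_integral \<beta> (\<lambda>_. 2 * K * L * e)"
    proof (rule order_trans[OF integral_abs_bound integral_mono_AE])
      show "integrable N (\<lambda>x. \<bar>indicator (cell X \<beta>) x * (t \<bullet> (Z x *v t) - w x \<bullet> (Z x *v w x))\<bar>)"
        by (intro Bochner_Integration.integrable_abs integrable_cell i Bochner_Integration.integrable_diff tZ wZ)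
      show "integrable N (\<lambda>x. indicator (cell X \<beta>) x * (2 * K * L * e))"
        by (intro integrable_cell i) simp
      show "AE x in N. \<bar>indicator (cell X \<beta>) x * (t \<bullet> (Z x *v t) - w x \<bullet> (Z x *v w x))\<bar>
          \<le> indicator (cell X \<beta>) x * (2 * K * L * e)"
        using K(2)
      proof eventually_elim
        case (elim x)
        show ?case
        proof (cases "x \<in> cell X \<beta>")
          case True
          have wx: "norm (w x) \<le> L" "norm (t - w x) \<le> e"
            using fine(1)[OF True] L(2) True pts by (auto simp: w_def t_def norm_minus_commute)
          have "t \<bullet> (Z x *v t) - w x \<bullet> (Z x *v w x) = (t - w x) \<bullet> (Z x *v t) + w x \<bullet> (Z x *v (t - w x))"
            by (simp add: matrix_vector_mult_diff_distrib inner_diff_left inner_diff_right)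
          also have "\<bar>\<dots>\<bar> \<le> K * norm (t - w x) * norm t + K * norm (w x) * norm (t - w x)"
            by (rule order_trans[OF abs_triangle_ineq]) (intro add_mono psd_boundedD(1) elim)
          also have "\<dots> \<le> K * e * L + K * L * e"
            using wx t K(1) L(1) e by (intro add_mono mult_mono mult_nonneg_nonneg) auto
          finally show ?thesis using True by simp
        qed simp
      qed
    qed
    also have "\<dots> = 2 * K * L * e * ?m" by (rule cell_integral_const[OF i])
    finally show ?thesis .
  qed
  show ?thesis
    using 1 2 unfolding w_def P_def R_def by (simp add: algebra_simps)
qed

text \<open>
  The sum of the errors in \<open>cell_energy_estimate\<close> is at most a constant times
  \<open>e\<close>, because the masses of the subcells add up; so the trace energies converge,
  and the limit of traces is the form.
\<close>

theorem C1_cell_energy: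
  assumes c1: "C1 \<phi>" and a: "\<alpha> \<in> level X m"
  shows "\<phi> \<circ> \<psi> \<in> form_dom X \<alpha>
    \<and> form X \<alpha> (\<phi> \<circ> \<psi>) (\<phi> \<circ> \<psi>) = cell_integral \<alpha> (\<lambda>x. nabla \<phi> (\<psi> x) \<bullet> (Z x *v nabla \<phi> (\<psi> x)))"
proof -
  obtain K where K: "K \<ge> 0" "AE x in N. psd_bounded K x" using Z_psd_bounded by blast
  obtain C where C: "C \<ge> 0" "\<And>\<alpha> i. \<alpha> \<in> indices X \<Longrightarrow> cell_trace \<alpha> (\<lambda>x. \<psi> x $ i) \<le> C * mass \<alpha>"
    by (rule coord_energy_dominated) blast
  obtain L where L: "L \<ge> 0" "\<And>x. x \<in> points X \<Longrightarrow> norm (nabla \<phi> (\<psi> x)) \<le> L"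
    by (rule nabla_bounded[OF c1]) blast
  define A where "A = 2 * (K * L\<^sup>2 + CARD('m) * C) + CARD('m) * C + 2 * K * L"
  have A: "A \<ge> 0" unfolding A_def using K C L by (intro add_nonneg_nonneg mult_nonneg_nonneg) auto
  let ?q = "\<lambda>x. nabla \<phi> (\<psi> x) \<bullet> (Z x *v nabla \<phi> (\<psi> x))"
  let ?S = "\<lambda>n. \<Sum>\<beta>\<in>sub (m + n) \<alpha>. cell_trace \<beta> (\<phi> \<circ> \<psi>)"
  have lim: "?S \<longlonglongrightarrow> cell_integral \<alpha> ?q"
  proof (rule LIMSEQ_I)
    fix r :: real assume r: "r > 0"
    \<comment> \<open>the summand 1 avoids a division by zero and makes the final inequality strict\<close>
    define e where "e = min 1 (r / (A * mass \<alpha> + 1))"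
    have den: "A * mass \<alpha> + 1 > 0" using A by (simp add: add_nonneg_pos)
    then have e: "0 < e" "e \<le> 1" using r by (auto simp: e_def)
    have small: "e * A * mass \<alpha> < r"
    proof -
      have "e \<le> r / (A * mass \<alpha> + 1)" by (simp add: e_def)
      then have "e * (A * mass \<alpha> + 1) \<le> r" by (simp only: pos_le_divide_eq[OF den])
      then show ?thesis using e by (simp add: algebra_simps)
    qed
    obtain n0 where n0: "\<And>n \<beta> x0. n \<ge> n0 \<Longrightarrow> \<beta> \<in> level X n \<Longrightarrow> x0 \<in> cell X \<beta> \<Longrightarrow>
      (\<forall>x\<in>cell X \<beta>. norm (nabla \<phi> (\<psi> x) - nabla \<phi> (\<psi> x0)) \<le> e) \<and>
      (\<forall>p\<in>cell X \<beta>. \<forall>q\<in>cell X \<beta>. \<bar>\<phi> (\<psi> p) - \<phi> (\<psi> q) - nabla \<phi> (\<psi> x0) \<bullet> (\<psi> p - \<psi> q)\<bar> \<le> e * norm (\<psi> p - \<psi> q))"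
      using fine_cells[OF c1 e(1)] by blast
    have "norm (?S n - cell_integral \<alpha> ?q) < r" if n: "n \<ge> n0" for n
    proof -
      have est: "\<bar>cell_trace \<beta> (\<phi> \<circ> \<psi>) - cell_integral \<beta> ?q\<bar> \<le> e * A * mass \<beta>" if b: "\<beta> \<in> sub (m + n) \<alpha>" for \<beta>
      proof -
        note bl = subD(1)[OF b]
        obtain x0 where x0: "x0 \<in> cell X \<beta>" using vtx_nonempty[OF idx[OF bl]] vtx_cell[OF idx[OF bl]] by blast
        have "n0 \<le> m + n" using n by simp
        note f = n0[OF this bl x0]
        show ?thesis
          unfolding A_def
          by (rule cell_energy_estimate[OF c1 K C L e bl x0]) (use f in blast)+
      qed
      have "cell_integral \<alpha> ?q = (\<Sum>\<beta>\<in>sub (m + n) \<alpha>. cell_integral \<beta> ?q)"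
        by (rule cell_integral_decompose[OF a _ nabla_form_integrable[OF c1]]) simp
      then have "?S n - cell_integral \<alpha> ?q = (\<Sum>\<beta>\<in>sub (m + n) \<alpha>. cell_trace \<beta> (\<phi> \<circ> \<psi>) - cell_integral \<beta> ?q)"
        by (simp add: sum_subtractf)
      also have "\<bar>\<dots>\<bar> \<le> (\<Sum>\<beta>\<in>sub (m + n) \<alpha>. e * A * mass \<beta>)"
        by (rule order_trans[OF sum_abs]) (intro sum_mono est)
      also have "\<dots> = e * A * mass \<alpha>"
        using mass_decompose[OF a, of "m + n"] by (simp add: sum_distrib_left)
      finally show ?thesis using small by simp
    qed
    then show "\<exists>no. \<forall>n\<ge>no. norm (?S n - cell_integral \<alpha> ?q) < r" by blast
  qed
  then have "Bseq ?S" by (intro convergent_imp_Bseq convergentI)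
  then obtain B where B: "\<forall>n. norm (?S n) \<le> B" unfolding Bseq_def by blast
  have "(\<Sum>\<beta>\<in>sub n \<alpha>. cell_trace \<beta> (\<phi> \<circ> \<psi>)) \<le> B" if "m \<le> n" for n
    using spec[OF B, of "n - m"] that by simp
  from cell_energy_bounded[OF a this] have "\<phi> \<circ> \<psi> \<in> form_dom X \<alpha>" "?S \<longlonglongrightarrow> form X \<alpha> (\<phi> \<circ> \<psi>) (\<phi> \<circ> \<psi>)" by blast+
  then show ?thesis using LIMSEQ_unique[OF lim, of "form X \<alpha> (\<phi> \<circ> \<psi>) (\<phi> \<circ> \<psi>)"] by simp
qed

end

section \<open>Cut-offs and gluing of continuously differentiable functions\<close>

lemma C1_const: "C1 (\<lambda>_. c)"
  by (rule C1I(1)[where G = "\<lambda>_. 0"]) auto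

lemma
  fixes t :: "real ^ 'm::finite"
  shows C1_inner: "C1 (\<lambda>y. t \<bullet> y)" and nabla_inner: "nabla (\<lambda>y. t \<bullet> y) = (\<lambda>_. t)"
proof -
  have "((\<lambda>y. t \<bullet> y) has_derivative (\<lambda>h. t \<bullet> h)) (at y)" for y :: "real ^ 'm"
    by (intro derivative_intros)
  then show "C1 (\<lambda>y. t \<bullet> y)" "nabla (\<lambda>y. t \<bullet> y) = (\<lambda>_. t)"
    by (intro C1I[where G = "\<lambda>_. t"]; simp)+
qed

lemma
  assumes "C1 \<phi>" "C1 \<eta>"
  shows C1_add: "C1 (\<lambda>y. \<phi> y + \<eta> y)"
    and C1_diff: "C1 (\<lambda>y. \<phi> y - \<eta> y)"
    and nabla_diff: "nabla (\<lambda>y. \<phi> y - \<eta> y) = (\<lambda>y. nabla \<phi> y - nabla \<eta> y)"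
    and C1_mult: "C1 (\<lambda>y. \<phi> y * \<eta> y)"
proof -
  note d = nabla_has_derivative[OF assms(1)] nabla_has_derivative[OF assms(2)]
  have c [continuous_intros]: "continuous_on UNIV (nabla \<phi>)" "continuous_on UNIV (nabla \<eta>)"
    "continuous_on UNIV \<phi>" "continuous_on UNIV \<eta>"
    using assms by (auto simp: C1_def intro: C1_isCont)
  have "((\<lambda>y. \<phi> y + \<eta> y) has_derivative (\<lambda>h. (nabla \<phi> y + nabla \<eta> y) \<bullet> h)) (at y)" for y
    unfolding inner_add_left by (intro derivative_intros d)
  then show "C1 (\<lambda>y. \<phi> y + \<eta> y)" by (rule C1I(1)) (intro continuous_intros)
  have D: "((\<lambda>y. \<phi> y - \<eta> y) has_derivative (\<lambda>h. (nabla \<phi> y - nabla \<eta> y) \<bullet> h)) (at y)" for y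
    unfolding inner_diff_left by (intro derivative_intros d)
  show "C1 (\<lambda>y. \<phi> y - \<eta> y)" by (rule C1I(1)[OF D]) (intro continuous_intros)
  show "nabla (\<lambda>y. \<phi> y - \<eta> y) = (\<lambda>y. nabla \<phi> y - nabla \<eta> y)"
    by (rule C1I(2)[OF D]) (intro continuous_intros)
  have "((\<lambda>y. \<phi> y * \<eta> y) has_derivative (\<lambda>h. (\<phi> y *\<^sub>R nabla \<eta> y + \<eta> y *\<^sub>R nabla \<phi> y) \<bullet> h)) (at y)" for y
    by (rule has_derivative_eq_rhs[OF has_derivative_mult[OF d]])
       (simp add: fun_eq_iff inner_add_left mult.commute)
  then show "C1 (\<lambda>y. \<phi> y * \<eta> y)" by (rule C1I(1)) (intro continuous_intros)
qed

lemma C1_sum: "finite I \<Longrightarrow> (\<And>i. i \<in> I \<Longrightarrow> C1 (\<phi> i)) \<Longrightarrow> C1 (\<lambda>y. \<Sum>i\<in>I. \<phi> i y)"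
  by (induction I rule: finite_induct) (auto intro: C1_const C1_add)

lemma C1_compose:
  assumes c1: "C1 \<phi>" and S: "\<And>s. (S has_real_derivative S' s) (at s)" and S': "continuous_on UNIV S'"
  shows "C1 (\<lambda>y. S (\<phi> y))"
proof (rule C1I(1))
  show "((\<lambda>y. S (\<phi> y)) has_derivative (\<lambda>h. (S' (\<phi> y) *\<^sub>R nabla \<phi> y) \<bullet> h)) (at y)" for y
    by (rule has_derivative_eq_rhs[OF has_derivative_compose[OF nabla_has_derivative[OF c1] S[unfolded has_field_derivative_def]]])
       (simp add: fun_eq_iff)
  have "continuous_on UNIV (\<lambda>y. S' (\<phi> y))"
    by (rule continuous_on_compose2[OF S' C1_isCont[OF c1]]) simp
  then show "continuous_on UNIV (\<lambda>y. S' (\<phi> y) *\<^sub>R nabla \<phi> y)"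
    using c1 by (intro continuous_intros) (auto simp: C1_def)
qed

text \<open>
  The simplest nonlinear \<open>C1\<close> function that vanishes on a half-line; all cut-offs
  are built from it.
\<close>

definition pos_sq :: "real \<Rightarrow> real" where
  "pos_sq x = (max 0 x)\<^sup>2"

lemma pos_sq_derivative: "(pos_sq has_real_derivative 2 * max 0 x) (at x)"
proof -
  consider "x < 0" | "x = 0" | "x > 0" by linarith
  then show ?thesis
  proof cases
    case 1
    have "((\<lambda>_. 0) has_real_derivative 0) (at x)" by (rule DERIV_const)
    then have "(pos_sq has_real_derivative 0) (at x)"
      by (rule has_field_derivative_transform_within_open[of _ _ _ "{..<0}"]) (use 1 in \<open>auto simp: pos_sq_def\<close>)
    then show ?thesis using 1 by simp
  next
    case 2
    have "((\<lambda>h. (pos_sq (0 + h) - pos_sq 0) / h) \<longlongrightarrow> 0) (at 0)"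
    proof (rule Lim_null_comparison)
      show "\<forall>\<^sub>F h in at 0. norm ((pos_sq (0 + h) - pos_sq 0) / h) \<le> \<bar>h\<bar>"
        by (intro always_eventually allI) (auto simp: pos_sq_def max_def power2_eq_square)
      show "((\<lambda>h::real. \<bar>h\<bar>) \<longlongrightarrow> 0) (at 0)" using tendsto_rabs[OF tendsto_ident_at[of "0::real" UNIV]] by simp
    qed
    then show ?thesis using 2 by (simp add: DERIV_def)
  next
    case 3
    have "((\<lambda>x. x\<^sup>2) has_real_derivative 2 * x) (at x)" by (auto intro!: derivative_eq_intros)
    then have "(pos_sq has_real_derivative 2 * x) (at x)"
      by (rule has_field_derivative_transform_within_open[of _ _ _ "{0<..}"]) (use 3 in \<open>auto simp: pos_sq_def\<close>)
    then show ?thesis using 3 by simp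
  qed
qed

lemmas pos_sq_has_derivative [derivative_intros] = DERIV_chain2[OF pos_sq_derivative]

lemma C1_pos_sq: "C1 \<phi> \<Longrightarrow> C1 (\<lambda>y. pos_sq (\<phi> y))"
  by (rule C1_compose[OF _ pos_sq_derivative]) (auto intro!: continuous_intros)

text \<open>
  A sum of bumps is positive on \<open>A\<close>, hence bounded below there; a smooth step turns it into 1.
\<close>

lemma C1_Urysohn:
  fixes A B :: "(real ^ 'm::finite) set"
  assumes A: "compact A" and B: "closed B" and AB: "A \<inter> B = {}"
  shows "\<exists>\<eta>. C1 \<eta> \<and> (\<forall>y\<in>A. \<eta> y = 1) \<and> (\<forall>y\<in>B. \<eta> y = 0)"
proof (cases "A = {}")
  case True
  then show ?thesis by (intro exI[of _ "\<lambda>_. 0"]) (auto intro: C1_const)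
next
  case False
  have "\<exists>r>0. ball c r \<inter> B = {}" if "c \<in> A" for c
  proof -
    have "open (- B)" "c \<in> - B" using B AB that by auto
    then obtain r where "r > 0" "ball c r \<subseteq> - B" by (rule openE)
    then show ?thesis by blast
  qed
  then obtain r where r: "\<And>c. c \<in> A \<Longrightarrow> r c > 0" "\<And>c. c \<in> A \<Longrightarrow> ball c (r c) \<inter> B = {}"
    using bchoice[of A "\<lambda>c r. r > 0 \<and> ball c r \<inter> B = {}"] by blast
  have cover: "A \<subseteq> (\<Union>c\<in>A. ball c (r c))"
  proof
    fix y assume y: "y \<in> A"
    then have "y \<in> ball y (r y)" using r(1)[of y] by simp
    then show "y \<in> (\<Union>c\<in>A. ball c (r c))" using y by blast
  qed
  obtain T where T: "T \<subseteq> A" "finite T" "A \<subseteq> (\<Union>c\<in>T. ball c (r c))"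
    using compactE_image[OF A _ cover] by auto
  define b where "b = (\<lambda>c y. pos_sq ((r c)\<^sup>2 - (y - c) \<bullet> (y - c)))"
  have b_pos: "b c y > 0" if "c \<in> T" "y \<in> ball c (r c)" for c y
  proof -
    have "norm (y - c) < r c" using that(2) by (simp add: dist_norm norm_minus_commute)
    then have "(norm (y - c))\<^sup>2 < (r c)\<^sup>2" by (intro power_strict_mono) auto
    then show ?thesis by (simp add: b_def pos_sq_def power2_norm_eq_inner max_def)
  qed
  have b_zero: "b c y = 0" if "c \<in> T" "y \<notin> ball c (r c)" for c y
  proof -
    have "r c \<le> norm (y - c)" using that(2) by (simp add: dist_norm norm_minus_commute)
    then have "(r c)\<^sup>2 \<le> (norm (y - c))\<^sup>2" using r(1)[of c] that T by (intro power_mono) auto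
    then show ?thesis by (simp add: b_def pos_sq_def power2_norm_eq_inner max_def)
  qed
  have b_nonneg: "b c y \<ge> 0" for c y by (simp add: b_def pos_sq_def)
  have C1_b: "C1 (b c)" for c
    unfolding b_def
  proof (intro C1_pos_sq C1I(1))
    show "((\<lambda>y. (r c)\<^sup>2 - (y - c) \<bullet> (y - c)) has_derivative (\<lambda>h. ((-2) *\<^sub>R (y - c)) \<bullet> h)) (at y)" for y
      by (rule has_derivative_eq_rhs, (rule derivative_intros)+)
         (simp add: fun_eq_iff inner_commute inner_diff_left inner_diff_right algebra_simps)
  qed (intro continuous_intros)
  define G where "G = (\<lambda>y. \<Sum>c\<in>T. b c y)"
  have C1_G: "C1 G" unfolding G_def by (intro C1_sum T C1_b)
  have G_pos: "G y > 0" if y: "y \<in> A" for y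
  proof -
    obtain c where "c \<in> T" "y \<in> ball c (r c)" using subsetD[OF T(3) y] by (rule UN_E)
    then show ?thesis unfolding G_def using b_pos b_nonneg T(2) by (intro sum_pos2) auto
  qed
  have G_zero: "G y = 0" if "y \<in> B" for y
    unfolding G_def
  proof (rule sum.neutral, rule ballI)
    fix c assume c: "c \<in> T"
    then have "y \<notin> ball c (r c)" using r(2)[of c] T(1) that by blast
    then show "b c y = 0" by (rule b_zero[OF c])
  qed
  obtain y0 where y0: "y0 \<in> A" "\<And>y. y \<in> A \<Longrightarrow> G y0 \<le> G y"
    using continuous_attains_inf[OF A False] continuous_on_subset[OF C1_isCont[OF C1_G]] by blast
  have m: "G y0 > 0" by (rule G_pos[OF y0(1)])
  let ?\<eta> = "\<lambda>y. 1 - pos_sq (1 - (1 / G y0) * G y)"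
  have "C1 ?\<eta>" by (intro C1_diff C1_const C1_pos_sq C1_mult C1_G)
  moreover have "?\<eta> y = 1" if "y \<in> A" for y
    using y0(2)[OF that] m by (simp add: pos_sq_def max_def field_simps)
  moreover have "?\<eta> y = 0" if "y \<in> B" for y
    using G_zero[OF that] by (simp add: pos_sq_def)
  ultimately show ?thesis by blast
qed

lemma C1_interpolation:
  fixes W :: "(real ^ 'm::finite) set"
  assumes W: "finite W"
  shows "\<exists>\<phi>. C1 \<phi> \<and> (\<forall>y\<in>W. \<phi> y = b y)"
proof -
  have "\<exists>\<eta>. C1 \<eta> \<and> (\<forall>z\<in>{y}. \<eta> z = 1) \<and> (\<forall>z\<in>W - {y}. \<eta> z = 0)" for y
    using W by (intro C1_Urysohn) (auto intro: finite_imp_closed)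
  then have "\<forall>y. \<exists>\<eta>. C1 \<eta> \<and> (\<forall>z\<in>{y}. \<eta> z = 1) \<and> (\<forall>z\<in>W - {y}. \<eta> z = 0)" by blast
  from choice[OF this] obtain \<eta> where "\<forall>y. C1 (\<eta> y) \<and> (\<forall>z\<in>{y}. \<eta> y z = 1) \<and> (\<forall>z\<in>W - {y}. \<eta> y z = 0)" ..
  then have \<eta>: "\<And>y. C1 (\<eta> y)" "\<And>y. \<eta> y y = 1" "\<And>y z. z \<in> W - {y} \<Longrightarrow> \<eta> y z = 0" by blast+
  let ?\<phi> = "\<lambda>z. \<Sum>y\<in>W. b y * \<eta> y z"
  have "C1 ?\<phi>" by (intro C1_sum W C1_mult C1_const \<eta>)
  moreover have "?\<phi> z = b z" if z: "z \<in> W" for z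
  proof -
    have "?\<phi> z = (\<Sum>y\<in>W. if y = z then b z else 0)"
      using z \<eta>(2,3) by (intro sum.cong refl) auto
    then show ?thesis using z W by simp
  qed
  ultimately show ?thesis by blast
qed

text \<open>
  The odd primitive of a piecewise linear function: 0 up to \<open>d\<close>, 1 from \<open>2
  d\<close> on, in absolute value of the argument.
\<close>

definition threshold :: "real \<Rightarrow> real \<Rightarrow> real" where
  "threshold d s = (pos_sq (s - d) - pos_sq (s - 2 * d) - pos_sq (- s - d) + pos_sq (- s - 2 * d)) / (2 * d)"

lemma
  assumes d: "d > 0"
  shows threshold_derivative: "(threshold d has_real_derivative
      (max 0 (s - d) - max 0 (s - 2 * d) + max 0 (- s - d) - max 0 (- s - 2 * d)) / d) (at s)"
    and threshold_zero: "\<bar>s\<bar> \<le> d \<Longrightarrow> threshold d s = 0"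
    and threshold_near: "\<bar>threshold d s - s\<bar> \<le> 2 * d"
proof -
  show "(threshold d has_real_derivative
      (max 0 (s - d) - max 0 (s - 2 * d) + max 0 (- s - d) - max 0 (- s - 2 * d)) / d) (at s)"
  proof -
    have "((\<lambda>s. pos_sq (s - d) - pos_sq (s - 2 * d) - pos_sq (- s - d) + pos_sq (- s - 2 * d)) has_real_derivative
      2 * (max 0 (s - d) - max 0 (s - 2 * d) + max 0 (- s - d) - max 0 (- s - 2 * d))) (at s)"
      by (auto intro!: derivative_eq_intros)
    moreover have "2 * a / (2 * d) = a / d" for a by simp
    ultimately show ?thesis
      unfolding threshold_def[abs_def] by (intro DERIV_cong[OF DERIV_cdivide])
  qed
  show "\<bar>s\<bar> \<le> d \<Longrightarrow> threshold d s = 0"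
    using d by (simp add: threshold_def pos_sq_def)
  show "\<bar>threshold d s - s\<bar> \<le> 2 * d"
  proof -
    have pos: "\<bar>(pos_sq (s - d) - pos_sq (s - 2 * d)) / (2 * d) - s\<bar> \<le> 2 * d" if s: "s \<ge> 0" for s
    proof -
      consider "s \<le> d" | "d \<le> s" "s \<le> 2 * d" | "2 * d \<le> s" by linarith
      then show ?thesis
      proof cases
        case 1
        then show ?thesis using d s by (simp add: pos_sq_def)
      next
        case 2
        have "(s - d)\<^sup>2 \<le> d\<^sup>2" using 2 d by (intro power_mono) auto
        then have "(s - d)\<^sup>2 / (2 * d) \<le> d / 2"
          using d by (simp add: field_simps power2_eq_square)
        moreover have "0 \<le> (s - d)\<^sup>2 / (2 * d)" using d by simp
        moreover have "(pos_sq (s - d) - pos_sq (s - 2 * d)) / (2 * d) = (s - d)\<^sup>2 / (2 * d)"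
          using 2 by (simp add: pos_sq_def)
        ultimately show ?thesis using 2 d by linarith
      next
        case 3
        have "pos_sq (s - d) - pos_sq (s - 2 * d) = 2 * d * (s - 3 / 2 * d)"
          using 3 d by (simp add: pos_sq_def power2_eq_square algebra_simps)
        then show ?thesis using d by simp
      qed
    qed
    show ?thesis
    proof (cases "s \<ge> 0")
      case True
      then have "threshold d s = (pos_sq (s - d) - pos_sq (s - 2 * d)) / (2 * d)"
        using d by (simp add: threshold_def pos_sq_def)
      then show ?thesis using pos[OF True] by simp
    next
      case False
      then have "threshold d s = - ((pos_sq (- s - d) - pos_sq (- s - 2 * d)) / (2 * d))"
        using d by (simp add: threshold_def pos_sq_def field_simps)
      then show ?thesis using pos[of "- s"] False by linarith
    qed
  qed
qed

text \<open>
  The slope lies between 0 and 1.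
\<close>

lemma threshold_contraction:
  assumes d: "d > 0"
  shows "\<bar>threshold d s - threshold d s'\<bar> \<le> \<bar>s - s'\<bar>"
proof -
  have "norm (threshold d s - threshold d s') \<le> 1 * norm (s - s')"
  proof (rule field_differentiable_bound[OF convex_UNIV])
    show "(threshold d has_field_derivative
      (max 0 (s - d) - max 0 (s - 2 * d) + max 0 (- s - d) - max 0 (- s - 2 * d)) / d) (at s within UNIV)" for s
      using threshold_derivative[OF d] by simp
    show "norm ((max 0 (s - d) - max 0 (s - 2 * d) + max 0 (- s - d) - max 0 (- s - 2 * d)) / d) \<le> 1" for s
      using d by (auto simp: max_def field_simps)
  qed auto
  then show ?thesis by simp
qed

lemma C1_threshold: "d > 0 \<Longrightarrow> C1 \<phi> \<Longrightarrow> C1 (\<lambda>y. threshold d (\<phi> y))"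
  by (rule C1_compose[OF _ threshold_derivative]) (auto intro!: continuous_intros)

section \<open>Density\<close>

context harmonic_fractal
begin

interpretation root: resform "all_vertices X" "Dom X" "energy X"
  by (rule root_form)

lemma Dom_convergence:
  assumes "f \<in> Dom X" "\<And>k. fs k \<in> Dom X" "\<And>k. energy X (fs k) (fs k) \<le> energy X f f"
    "\<And>p. p \<in> all_vertices X \<Longrightarrow> (\<lambda>k::nat. fs k p) \<longlonglongrightarrow> f p"
  shows "(\<lambda>k. energy X (\<lambda>x. fs k x - f x) (\<lambda>x. fs k x - f x)) \<longlonglongrightarrow> 0"
  by (rule root.energy_convergence[of "level_vertices X"]) (use level_vertices_exhaust assms in auto)

lemma Dom_contraction:
  assumes "f \<in> Dom X" "\<And>p q. \<bar>u p - u q\<bar> \<le> \<bar>f p - f q\<bar>"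
  shows "u \<in> Dom X \<and> energy X u u \<le> energy X f f"
  by (rule root.energy_contraction[of "level_vertices X"]) (use level_vertices_exhaust assms in auto)

lemma pw_linear:
  assumes "level_pw_harmonic X n f" "\<alpha> \<in> level X n"
  shows "\<exists>t. \<forall>x\<in>all_vertices X \<inter> cell X \<alpha>. f x = t \<bullet> \<psi> x"
proof -
  obtain h where h: "harmonic X h" "agree_on (all_vertices X \<inter> cell X \<alpha>) h f"
    using assms by (auto simp: level_pw_harmonic_def)
  show ?thesis
    using harmonic_is_linear[OF h(1)] h(2)
    by (intro exI[of _ "\<chi> i. h (v i)"]) (auto simp: agree_on_def)
qed

lemma C1_Dom: "C1 \<phi> \<Longrightarrow> \<phi> \<circ> \<psi> \<in> Dom X"
  using C1_cell_energy[OF _ root_idx] by blast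

text \<open>
  A piecewise \<open>C1\<close> function vanishing at the vertices becomes \<open>C1\<close> once small values
  are cut off: the pieces are then supported away from each other.
\<close>

lemma threshold_is_C1:
  assumes inj: "inj_on \<psi> (points X)" and d: "d > 0"
    and C1: "\<And>\<alpha>. \<alpha> \<in> level X n \<Longrightarrow> C1 (\<phi> \<alpha>)"
    and f: "\<And>\<alpha> x. \<alpha> \<in> level X n \<Longrightarrow> x \<in> all_vertices X \<inter> cell X \<alpha> \<Longrightarrow> f x = \<phi> \<alpha> (\<psi> x)"
    and zero: "\<And>p. p \<in> level_vertices X n \<Longrightarrow> f p = 0"
  shows "\<exists>\<eta>. C1 \<eta> \<and> (\<forall>x\<in>all_vertices X. threshold d (f x) = \<eta> (\<psi> x))"
proof -
  define big where "big = (\<lambda>\<alpha>. {y. d \<le> \<bar>\<phi> \<alpha> y\<bar>})"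
  \<comment> \<open>the piece \<open>\<phi> \<alpha>\<close> has to be kept on \<open>A \<alpha>\<close> and switched off on \<open>B \<alpha>\<close>; elsewhere on the fractal its
    threshold vanishes anyway\<close>
  define A where "A = (\<lambda>\<alpha>. \<psi> ` cell X \<alpha> \<inter> big \<alpha>)"
  define B where "B = (\<lambda>\<alpha>. (\<Union>\<beta>\<in>level X n - {\<alpha>}. \<psi> ` cell X \<beta>) \<inter> big \<alpha>)"
  have comp: "compact (\<psi> ` cell X \<alpha>)" if "\<alpha> \<in> level X n" for \<alpha>
    using cell_points[OF idx[OF that]]
    by (intro compact_continuous_image cell_compact[OF idx[OF that]] continuous_on_subset[OF psi_continuous])
  have big: "closed (big \<alpha>)" if "\<alpha> \<in> level X n" for \<alpha>
    unfolding big_def by (intro closed_Collect_le continuous_intros C1_isCont C1 that)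
  have "\<exists>\<eta>. C1 \<eta> \<and> (\<forall>y\<in>A \<alpha>. \<eta> y = 1) \<and> (\<forall>y\<in>B \<alpha>. \<eta> y = 0)" if a: "\<alpha> \<in> level X n" for \<alpha>
  proof (rule C1_Urysohn)
    show "compact (A \<alpha>)" unfolding A_def by (intro compact_Int_closed comp big a)
    have "closed (\<Union>\<beta>\<in>level X n - {\<alpha>}. \<psi> ` cell X \<beta>)"
      using level_finite comp by (intro closed_UN) (auto intro: compact_imp_closed)
    then show "closed (B \<alpha>)" unfolding B_def by (intro closed_Int big a)
    show "A \<alpha> \<inter> B \<alpha> = {}"
    proof (rule ccontr)
      assume "A \<alpha> \<inter> B \<alpha> \<noteq> {}"
      then obtain y where y: "y \<in> A \<alpha>" "y \<in> B \<alpha>" by blast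
      obtain x where x: "x \<in> cell X \<alpha>" "\<psi> x \<in> big \<alpha>" "y = \<psi> x" using y(1) unfolding A_def by blast
      obtain \<beta> x' where b: "\<beta> \<in> level X n" "\<beta> \<noteq> \<alpha>" and x': "x' \<in> cell X \<beta>" "\<psi> x' = \<psi> x"
        using y(2) unfolding B_def x(3) by fastforce
      have "x' = x"
        using inj x(1) x' cell_points[OF idx[OF a]] cell_points[OF idx[OF b(1)]] by (auto dest: inj_onD)
      then have xv: "x \<in> vtx X \<alpha>" using cell_inter[OF a b(1)] b(2) x x' by blast
      then have "f x = 0" using zero a by (auto simp: level_vertices_def)
      moreover have "f x = \<phi> \<alpha> (\<psi> x)" using f[OF a] xv x vtx_all[OF idx[OF a]] by blast
      ultimately show False using x(2) d by (simp add: big_def)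
    qed
  qed
  then have "\<forall>\<alpha>\<in>level X n. \<exists>\<eta>. C1 \<eta> \<and> (\<forall>y\<in>A \<alpha>. \<eta> y = 1) \<and> (\<forall>y\<in>B \<alpha>. \<eta> y = 0)" by blast
  from bchoice[OF this] obtain \<eta> where
    "\<forall>\<alpha>\<in>level X n. C1 (\<eta> \<alpha>) \<and> (\<forall>y\<in>A \<alpha>. \<eta> \<alpha> y = 1) \<and> (\<forall>y\<in>B \<alpha>. \<eta> \<alpha> y = 0)" ..
  then have \<eta>: "\<And>\<alpha>. \<alpha> \<in> level X n \<Longrightarrow> C1 (\<eta> \<alpha>)"
    "\<And>\<alpha> y. \<alpha> \<in> level X n \<Longrightarrow> y \<in> A \<alpha> \<Longrightarrow> \<eta> \<alpha> y = 1" "\<And>\<alpha> y. \<alpha> \<in> level X n \<Longrightarrow> y \<in> B \<alpha> \<Longrightarrow> \<eta> \<alpha> y = 0"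
    by blast+
  let ?\<eta> = "\<lambda>y. \<Sum>\<alpha>\<in>level X n. \<eta> \<alpha> y * threshold d (\<phi> \<alpha> y)"
  have "C1 ?\<eta>" by (intro C1_sum level_finite C1_mult C1_threshold \<eta> C1 d)
  moreover have "threshold d (f x) = ?\<eta> (\<psi> x)" if x: "x \<in> all_vertices X" for x
  proof -
    obtain \<alpha> where a: "\<alpha> \<in> level X n" "x \<in> cell X \<alpha>"
      using x all_vertices_points level_cover[of n] by blast
    have small: "threshold d (\<phi> \<beta> (\<psi> x)) = 0" if "\<psi> x \<notin> big \<beta>" for \<beta>
      using that by (intro threshold_zero d) (simp add: big_def)
    have "?\<eta> (\<psi> x) = (\<Sum>\<beta>\<in>level X n. if \<beta> = \<alpha> then threshold d (f x) else 0)"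
    proof (rule sum.cong[OF refl])
      fix \<beta> assume b: "\<beta> \<in> level X n"
      show "\<eta> \<beta> (\<psi> x) * threshold d (\<phi> \<beta> (\<psi> x)) = (if \<beta> = \<alpha> then threshold d (f x) else 0)"
      proof (cases "\<beta> = \<alpha>")
        case True
        have "\<eta> \<alpha> (\<psi> x) * threshold d (\<phi> \<alpha> (\<psi> x)) = threshold d (\<phi> \<alpha> (\<psi> x))"
          using \<eta>(2)[OF a(1), of "\<psi> x"] a(2) small[of \<alpha>] by (cases "\<psi> x \<in> big \<alpha>") (auto simp: A_def)
        then show ?thesis using True f[OF a(1), of x] x a(2) by simp
      next
        case False
        then show ?thesis
          using \<eta>(3)[OF b, of "\<psi> x"] a small[of \<beta>] by (cases "\<psi> x \<in> big \<beta>") (auto simp: B_def)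
      qed
    qed
    then show ?thesis using a(1) level_finite by simp
  qed
  ultimately show ?thesis by blast
qed

text \<open>
  Subtracting a \<open>C1\<close> interpolant makes the function vanish at the vertices, so that
  its thresholds are \<open>C1\<close>; they converge in energy since they are contractions.
\<close>

theorem pw_harmonic_approximation:
  assumes inj: "inj_on \<psi> (points X)" and f: "pw_harmonic X f" and e: "e > 0"
  shows "\<exists>\<phi>. C1 \<phi> \<and> energy X (\<lambda>x. f x - (\<phi> \<circ> \<psi>) x) (\<lambda>x. f x - (\<phi> \<circ> \<psi>) x) < e"
proof -
  obtain n where n: "level_pw_harmonic X n f" using f by (auto simp: pw_harmonic_def)
  have fD: "f \<in> Dom X" using n by (simp add: level_pw_harmonic_def)
  have finV: "finite (level_vertices X n)" by (rule level_vertices_exhaust(1))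
  obtain \<phi>0 where \<phi>0: "C1 \<phi>0" "\<And>p. p \<in> level_vertices X n \<Longrightarrow> \<phi>0 (\<psi> p) = f p"
  proof -
    have "level_vertices X n \<subseteq> points X" using all_vertices_points by (auto simp: all_vertices_def)
    then have "inv_into (points X) \<psi> (\<psi> p) = p" if "p \<in> level_vertices X n" for p
      using inj that by (intro inv_into_f_f) auto
    moreover obtain \<phi> where "C1 \<phi>" "\<And>y. y \<in> \<psi> ` level_vertices X n \<Longrightarrow> \<phi> y = f (inv_into (points X) \<psi> y)"
      using C1_interpolation[of "\<psi> ` level_vertices X n" "\<lambda>y. f (inv_into (points X) \<psi> y)"] finV by blast
    ultimately show thesis by (intro that[of \<phi>]) auto
  qed
  define f0 where "f0 = (\<lambda>x. f x - (\<phi>0 \<circ> \<psi>) x)"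
  have f0D: "f0 \<in> Dom X" unfolding f0_def by (intro root.D_diff fD C1_Dom \<phi>0)
  have "\<forall>\<alpha>\<in>level X n. \<exists>t. \<forall>x\<in>all_vertices X \<inter> cell X \<alpha>. f x = t \<bullet> \<psi> x" using pw_linear[OF n] by blast
  from bchoice[OF this] obtain t where "\<forall>\<alpha>\<in>level X n. \<forall>x\<in>all_vertices X \<inter> cell X \<alpha>. f x = t \<alpha> \<bullet> \<psi> x" ..
  then have t: "\<And>\<alpha> x. \<alpha> \<in> level X n \<Longrightarrow> x \<in> all_vertices X \<inter> cell X \<alpha> \<Longrightarrow> f x = t \<alpha> \<bullet> \<psi> x" by blast
  let ?d = "\<lambda>k. 1 / real (Suc k)"
  let ?fs = "\<lambda>k x. threshold (?d k) (f0 x)"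
  have fs: "?fs k \<in> Dom X \<and> energy X (?fs k) (?fs k) \<le> energy X f0 f0" for k
    by (rule Dom_contraction[OF f0D]) (intro threshold_contraction, simp)
  have "(\<lambda>k. energy X (\<lambda>x. ?fs k x - f0 x) (\<lambda>x. ?fs k x - f0 x)) \<longlonglongrightarrow> 0"
  proof (rule Dom_convergence[OF f0D])
    fix p
    have "(\<lambda>k. ?fs k p - f0 p) \<longlonglongrightarrow> 0"
    proof (rule Lim_null_comparison)
      show "\<forall>\<^sub>F k in sequentially. norm (?fs k p - f0 p) \<le> 2 * ?d k"
        by (intro always_eventually allI) (simp only: real_norm_def, rule threshold_near, simp)
      show "(\<lambda>k. 2 * ?d k) \<longlonglongrightarrow> 0"
        using tendsto_mult_right_zero[OF LIMSEQ_inverse_real_of_nat, of 2] by (simp add: inverse_eq_divide)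
    qed
    then show "(\<lambda>k. ?fs k p) \<longlonglongrightarrow> f0 p" by (simp add: LIM_zero_iff)
  qed (use fs in auto)
  then have "eventually (\<lambda>k. energy X (\<lambda>x. ?fs k x - f0 x) (\<lambda>x. ?fs k x - f0 x) < e) sequentially"
    by (rule order_tendstoD) (rule e)
  then obtain k where k: "energy X (\<lambda>x. ?fs k x - f0 x) (\<lambda>x. ?fs k x - f0 x) < e"
    by (auto simp: eventually_sequentially)
  have "\<exists>\<eta>. C1 \<eta> \<and> (\<forall>x\<in>all_vertices X. ?fs k x = \<eta> (\<psi> x))"
  proof (rule threshold_is_C1[OF inj])
    show "C1 (\<lambda>y. t \<alpha> \<bullet> y - \<phi>0 y)" for \<alpha> by (intro C1_diff C1_inner \<phi>0)
    show "f0 x = t \<alpha> \<bullet> \<psi> x - \<phi>0 (\<psi> x)" if "\<alpha> \<in> level X n" "x \<in> all_vertices X \<inter> cell X \<alpha>" for \<alpha> x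
      using t[OF that] by (simp add: f0_def)
    show "f0 p = 0" if "p \<in> level_vertices X n" for p
      using \<phi>0(2)[OF that] by (simp add: f0_def)
  qed simp
  then obtain \<eta> where \<eta>: "C1 \<eta>" "\<And>x. x \<in> all_vertices X \<Longrightarrow> ?fs k x = \<eta> (\<psi> x)" by blast
  let ?\<phi> = "\<lambda>y. \<phi>0 y + \<eta> y"
  have C1: "C1 ?\<phi>" by (intro C1_add \<phi>0 \<eta>)
  have fkD: "?fs k \<in> Dom X" using fs[of k] by blast
  have D: "(\<lambda>x. f x - (?\<phi> \<circ> \<psi>) x) \<in> Dom X" "(\<lambda>x. f0 x - ?fs k x) \<in> Dom X"
    by (rule root.D_diff[OF fD C1_Dom[OF C1]], rule root.D_diff[OF f0D fkD])
  have ag: "agree_on (all_vertices X) (\<lambda>x. f x - (?\<phi> \<circ> \<psi>) x) (\<lambda>x. f0 x - ?fs k x)"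
    unfolding agree_on_def
  proof
    fix x assume "x \<in> all_vertices X"
    then show "f x - (?\<phi> \<circ> \<psi>) x = f0 x - ?fs k x" using \<eta>(2)[of x] by (simp add: f0_def)
  qed
  have "energy X (\<lambda>x. f x - (?\<phi> \<circ> \<psi>) x) (\<lambda>x. f x - (?\<phi> \<circ> \<psi>) x)
      = energy X (\<lambda>x. f0 x - ?fs k x) (\<lambda>x. f0 x - ?fs k x)"
    by (rule root.E_agree[OF D(1) D(1) D(2) D(2) ag ag])
  also have "\<dots> < e" using k root.E_diff_commute[OF f0D fkD] by simp
  finally show ?thesis using C1 by blast
qed

theorem C1_dense:
  assumes inj: "inj_on \<psi> (points X)" and dense: "energy_dense X {f. pw_harmonic X f}"
  shows "energy_dense X {\<phi> \<circ> \<psi> | \<phi>. C1 \<phi>}"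
  unfolding energy_dense_def
proof (intro conjI ballI allI impI)
  show "{\<phi> \<circ> \<psi> | \<phi>. C1 \<phi>} \<subseteq> Dom X" using C1_Dom by blast
  fix u and e :: real assume u: "u \<in> Dom X" and e: "e > 0"
  obtain f where f: "pw_harmonic X f" "energy X (\<lambda>x. u x - f x) (\<lambda>x. u x - f x) < e / 4"
    using dense u e unfolding energy_dense_def by (metis mem_Collect_eq zero_less_divide_iff zero_less_numeral)
  obtain \<phi> where \<phi>: "C1 \<phi>" "energy X (\<lambda>x. f x - (\<phi> \<circ> \<psi>) x) (\<lambda>x. f x - (\<phi> \<circ> \<psi>) x) < e / 4"
    using pw_harmonic_approximation[OF inj f(1), of "e/4"] e by auto
  have fD: "f \<in> Dom X" using f(1) by (auto simp: pw_harmonic_def level_pw_harmonic_def)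
  let ?a = "\<lambda>x. u x - f x" and ?b = "\<lambda>x. f x - (\<phi> \<circ> \<psi>) x"
  have D: "?a \<in> Dom X" "?b \<in> Dom X" by (intro root.D_diff u fD C1_Dom \<phi>)+
  have "energy X (\<lambda>x. ?a x + ?b x) (\<lambda>x. ?a x + ?b x) \<le> 2 * energy X ?a ?a + 2 * energy X ?b ?b"
    using root.E_nonneg[OF root.D_diff[OF D]] root.E_diff_sq[OF D] root.E_add_sq[OF D] by simp
  also have "\<dots> < e" using f(2) \<phi>(2) by simp
  finally have "energy X (\<lambda>x. u x - (\<phi> \<circ> \<psi>) x) (\<lambda>x. u x - (\<phi> \<circ> \<psi>) x) < e" by simp
  then show "\<exists>s\<in>{\<phi> \<circ> \<psi> | \<phi>. C1 \<phi>}. energy X (\<lambda>x. u x - s x) (\<lambda>x. u x - s x) < e"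
    using \<phi>(1) by blast
qed

end

section \<open>Minimising a seminorm over an affine subspace\<close>

text \<open>
  If the seminorm is definite on the directions of the affine set, compactness of the unit sphere
  makes it coercive there.
\<close>

lemma affine_seminorm_min:
  fixes q :: "'e::euclidean_space \<Rightarrow> real"
  assumes cont: "continuous_on UNIV q" and q0: "\<And>x. q x \<ge> 0"
    and tri: "\<And>x y. q (x + y) \<le> q x + q y" and scale: "\<And>c x. q (c *\<^sub>R x) = \<bar>c\<bar> * q x"
    and L: "subspace L" and def: "\<And>x. x \<in> L \<Longrightarrow> q x = 0 \<Longrightarrow> x = 0"
  shows "\<exists>s\<in>L. \<forall>s'\<in>L. q (t + s) \<le> q (t + s')"
proof -
  have clL: "closed L" by (rule closed_subspace[OF L])
  obtain c where c: "c > 0" "\<And>s. s \<in> L \<Longrightarrow> q s \<ge> c * norm s"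
  proof (cases "L \<inter> sphere 0 1 = {}")
    case True
    have zero: "s = 0" if "s \<in> L" for s
    proof (rule ccontr)
      assume "s \<noteq> 0"
      then have "(1 / norm s) *\<^sub>R s \<in> L \<inter> sphere 0 1"
        using that L by (auto intro: subspace_scale)
      then show False using True by blast
    qed
    have "1 * norm s \<le> q s" if "s \<in> L" for s using zero[OF that] q0[of s] by simp
    then show thesis by (intro that[of 1]) auto
  next
    case False
    have "compact (L \<inter> sphere 0 1)" using clL by (intro closed_Int_compact) auto
    then obtain s0 where s0: "s0 \<in> L \<inter> sphere 0 1" "\<And>s. s \<in> L \<inter> sphere 0 1 \<Longrightarrow> q s0 \<le> q s"
      using continuous_attains_inf[OF _ False] continuous_on_subset[OF cont] by blast
    have "q s0 \<noteq> 0" using def[of s0] s0(1) by auto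
    then have pos: "q s0 > 0" using q0[of s0] by simp
    have "q s \<ge> q s0 * norm s" if s: "s \<in> L" for s
    proof (cases "s = 0")
      case False
      then have "(1 / norm s) *\<^sub>R s \<in> L \<inter> sphere 0 1"
        using s L by (auto intro: subspace_scale)
      from s0(2)[OF this] show ?thesis using False by (simp add: scale field_simps)
    qed (use q0 in simp)
    then show thesis using pos by (intro that[of "q s0"])
  qed
  \<comment> \<open>outside the ball of this radius the value at \<open>s = 0\<close> is not beaten\<close>
  define R where "R = 2 * q t / c"
  have "compact (L \<inter> cball 0 R)" using clL by (intro closed_Int_compact) auto
  moreover have ne: "0 \<in> L \<inter> cball 0 R" using L q0[of t] c by (simp add: R_def subspace_0)
  moreover have "continuous_on (L \<inter> cball 0 R) (\<lambda>s. q (t + s))"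
    by (rule continuous_on_compose2[OF cont]) (auto intro!: continuous_intros)
  ultimately obtain s where s: "s \<in> L \<inter> cball 0 R" "\<And>s'. s' \<in> L \<inter> cball 0 R \<Longrightarrow> q (t + s) \<le> q (t + s')"
    using continuous_attains_inf[of "L \<inter> cball 0 R" "\<lambda>s. q (t + s)"] by blast
  have "q (t + s) \<le> q (t + s')" if s': "s' \<in> L" for s'
  proof (cases "norm s' \<le> R")
    case True
    then show ?thesis using s(2)[of s'] s' by simp
  next
    case False
    then have "2 * q t < c * norm s'" using c(1) by (simp add: R_def field_simps)
    also have "\<dots> \<le> q s'" by (rule c(2)[OF s'])
    also have "q s' \<le> q (t + s') + q t"
      using tri[of "t + s'" "- t"] scale[of "-1" t] by simp
    finally show ?thesis using s(2)[OF ne] by simp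
  qed
  then show ?thesis using s(1) by blast
qed

section \<open>The weak gradient\<close>

context harmonic_fractal
begin

interpretation root: resform "all_vertices X" "Dom X" "energy X"
  by (rule root_form)

definition lin_energy :: "real ^ 'm \<Rightarrow> real" where
  "lin_energy t = energy X (\<lambda>x. t \<bullet> \<psi> x) (\<lambda>x. t \<bullet> \<psi> x)"

lemma lin_D: "(\<lambda>x. t \<bullet> \<psi> x) \<in> Dom X"
  by (rule harmonic_Dom[OF harmonic_linear])

text \<open>
  It is a quadratic polynomial, for the energy of a harmonic function is its trace energy on the
  root cell.
\<close>

lemma lin_energy_continuous: "continuous_on UNIV lin_energy"
proof -
  have "lin_energy t = (\<Sum>i\<in>UNIV. \<Sum>j\<in>UNIV. t $ i * coord_energy (root X) i j * t $ j)" for t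
  proof -
    have i: "root X \<in> indices X" by (rule idx[OF root_idx])
    have "root.minimiser (level_vertices X 0) (\<lambda>x. t \<bullet> \<psi> x) (\<lambda>x. t \<bullet> \<psi> x)"
      using harmonic_linear[of t] by (simp add: harmonic_minimiser)
    from root.trace_on_eq[OF this] have "lin_energy t = cell_trace (root X) (\<lambda>x. t \<bullet> \<psi> x)"
      by (simp add: trace_energy_tr[OF i] lin_energy_def level_vertices_def level_0)
    then show ?thesis by (simp add: cell_trace_bilinear[OF i] cell_bilinear_linear[OF i])
  qed
  then show ?thesis
    by (simp only: continuous_on_cong[OF refl, of UNIV lin_energy]) (intro continuous_intros)
qed

text \<open>
  A linear functional of zero energy is constant; if it also vanishes on a cell it is 0. This is why
  the tangent of a piecewise harmonic function is well defined.
\<close>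

lemma lin_energy_definite:
  assumes a: "\<alpha> \<in> indices X" and zero: "\<And>x. x \<in> all_vertices X \<inter> cell X \<alpha> \<Longrightarrow> s \<bullet> \<psi> x = 0"
    and E: "lin_energy s = 0"
  shows "s = 0"
proof -
  obtain c where c: "\<And>x. x \<in> all_vertices X \<Longrightarrow> s \<bullet> \<psi> x = c"
    using E root.E_zero_iff[OF lin_D[of s]] by (auto simp: lin_energy_def agree_on_def)
  obtain p where p: "p \<in> all_vertices X \<inter> cell X \<alpha>" using vtx_nonempty[OF a] vtx_in_form[OF a] by blast
  then have "c = 0" using c[of p] zero[OF p] by simp
  then have "s \<bullet> \<psi> (v i) = 0" for i using c[OF v_all] by simp
  then have "s $ i = 0" for i by (simp add: inner_psi psi_v if_distrib[of "(*) _"] cong: if_cong)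
  then show ?thesis by (simp add: vec_eq_iff)
qed

text \<open>
  The minimisation in the definition of \<open>Tan\<close> is solvable by
  \<open>affine_seminorm_min\<close>, and uniquely so by the parallelogram law; hence the
  definite description denotes a functional that coincides with \<open>f\<close> on the cell.
\<close>

lemma Tan_coincides:
  assumes n: "level_pw_harmonic X n f" and a: "\<alpha> \<in> level X n" and x: "x \<in> all_vertices X \<inter> cell X \<alpha>"
  shows "Tan X v \<alpha> f \<bullet> \<psi> x = f x"
proof -
  let ?V = "all_vertices X \<inter> cell X \<alpha>"
  define co where "co = (\<lambda>t. \<forall>x\<in>?V. t \<bullet> \<psi> x = f x)"
  have coincides: "agree_on ?V (harmonic_ext X v t) f \<longleftrightarrow> co t" for t
    by (simp add: agree_on_def co_def harmonic_ext_linear)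
  have en: "energy X (harmonic_ext X v t) (harmonic_ext X v t) = lin_energy t" for t
    unfolding lin_energy_def using harmonic_ext[of t]
    by (intro root.E_agree lin_D harmonic_Dom) (auto simp: agree_on_def harmonic_ext_linear)
  have Tan: "Tan X v \<alpha> f = (THE t. co t \<and> (\<forall>s. co s \<longrightarrow> lin_energy t \<le> lin_energy s))"
    by (simp add: Tan_def coincides en Let_def)
  obtain t0 where t0: "co t0" using pw_linear[OF n a] by (force simp: co_def)
  define L where "L = {s. \<forall>x\<in>?V. s \<bullet> \<psi> x = 0}"
  have L: "subspace L" unfolding subspace_def L_def by (auto simp: inner_add_left)
  have coL: "co (t + s)" if "co t" "s \<in> L" for t s
    using that by (auto simp: co_def L_def inner_add_left)
  have diffL: "t - s \<in> L" if "co t" "co s" for t s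
    using that by (auto simp: co_def L_def inner_diff_left)
  have E0: "lin_energy t \<ge> 0" for t unfolding lin_energy_def by (rule root.E_nonneg[OF lin_D])
  have "\<exists>s\<in>L. \<forall>s'\<in>L. sqrt (lin_energy (t0 + s)) \<le> sqrt (lin_energy (t0 + s'))"
  proof (rule affine_seminorm_min[OF _ _ _ _ L])
    show "continuous_on UNIV (\<lambda>t. sqrt (lin_energy t))"
      by (rule continuous_on_compose2[OF continuous_on_real_sqrt[OF continuous_on_id] lin_energy_continuous]) auto
    show "sqrt (lin_energy (s + t)) \<le> sqrt (lin_energy s) + sqrt (lin_energy t)" for s t
      unfolding lin_energy_def inner_add_left by (rule root.E_triangle[OF lin_D lin_D])
    show "sqrt (lin_energy (c *\<^sub>R s)) = \<bar>c\<bar> * sqrt (lin_energy s)" for c s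
      using root.E_scale_left[OF lin_D[of s] root.D_scale[OF lin_D[of s]], of c c]
        root.E_scale_right[OF lin_D[of s] lin_D[of s], of c]
      by (simp add: lin_energy_def real_sqrt_mult)
    show "s = 0" if "s \<in> L" "sqrt (lin_energy s) = 0" for s
      by (rule lin_energy_definite[OF idx[OF a]]) (use that in \<open>auto simp: L_def\<close>)
  qed (use E0 in auto)
  then obtain s where s: "s \<in> L" "\<And>s'. s' \<in> L \<Longrightarrow> lin_energy (t0 + s) \<le> lin_energy (t0 + s')" by auto
  define t where "t = t0 + s"
  have ct: "co t" unfolding t_def by (rule coL[OF t0 s(1)])
  have min: "lin_energy t \<le> lin_energy r" if "co r" for r
    using s(2)[OF diffL[OF that t0]] by (simp add: t_def)
  have uniq: "r = t" if r: "co r" "\<And>r'. co r' \<Longrightarrow> lin_energy r \<le> lin_energy r'" for r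
  proof -
    let ?mid = "\<lambda>x. (1/2) * (r \<bullet> \<psi> x + t \<bullet> \<psi> x)"
    have "co ((1/2) *\<^sub>R (r + t))" using r(1) ct by (simp add: co_def inner_add_left)
    from min[OF this] have "lin_energy t \<le> energy X ?mid ?mid"
      by (simp add: lin_energy_def inner_add_left)
    moreover have "energy X ?mid ?mid = (lin_energy r + 2 * energy X (\<lambda>x. r \<bullet> \<psi> x) (\<lambda>x. t \<bullet> \<psi> x) + lin_energy t) / 4"
      unfolding lin_energy_def using lin_D[of r] lin_D[of t]
      by (simp only: root.E_bilinear root.D_intros root.E_sym[of "\<lambda>x. t \<bullet> \<psi> x" "\<lambda>x. r \<bullet> \<psi> x"]) (simp add: field_simps)
    moreover have "lin_energy r \<le> lin_energy t" by (rule r(2)[OF ct])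
    moreover have "lin_energy (r - t) = lin_energy r - 2 * energy X (\<lambda>x. r \<bullet> \<psi> x) (\<lambda>x. t \<bullet> \<psi> x) + lin_energy t"
      unfolding lin_energy_def inner_diff_left by (rule root.E_diff_sq[OF lin_D lin_D])
    ultimately have "lin_energy (r - t) \<le> 0" by simp
    then have "lin_energy (r - t) = 0" using E0[of "r - t"] by simp
    then have "r - t = 0"
      using diffL[OF r(1) ct] by (intro lin_energy_definite[OF idx[OF a]]) (auto simp: L_def)
    then show ?thesis by simp
  qed
  have "Tan X v \<alpha> f = t" unfolding Tan by (rule the_equality) (use ct min uniq in blast)+
  then show ?thesis using ct x by (simp add: co_def)
qed

subsection \<open>The Hilbert space\<close>

lemma L2Z_diff:
  assumes u: "u \<in> L2Z X v N" and w: "w \<in> L2Z X v N"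
  shows "(\<lambda>x. u x - w x) \<in> L2Z X v N"
    and "L2Z_norm_sq X v N (\<lambda>x. u x - w x) \<le> 2 * L2Z_norm_sq X v N u + 2 * L2Z_norm_sq X v N w"
proof -
  obtain K where K: "K \<ge> 0" "AE x in N. psd_bounded K x" using Z_psd_bounded by blast
  have meas: "u \<in> borel_measurable N" "w \<in> borel_measurable N"
    and int: "integrable N (\<lambda>x. u x \<bullet> (Z x *v u x))" "integrable N (\<lambda>x. w x \<bullet> (Z x *v w x))"
    using u w by (auto simp: L2Z_def)
  have le: "AE x in N. 0 \<le> (u x - w x) \<bullet> (Z x *v (u x - w x)) \<and>
      (u x - w x) \<bullet> (Z x *v (u x - w x)) \<le> 2 * (u x \<bullet> (Z x *v u x)) + 2 * (w x \<bullet> (Z x *v w x))"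
    using K(2)
  proof eventually_elim
    case (elim x)
    have "0 \<le> (u x + w x) \<bullet> (Z x *v (u x + w x))" by (rule psd_boundedD(3)[OF elim])
    then show ?case
      using psd_boundedD(3)[OF elim, of "u x - w x"] psd_boundedD(2)[OF elim, of "u x" "w x"]
      by (simp add: matrix_vector_right_distrib matrix_vector_mult_diff_distrib inner_add_left inner_add_right
          inner_diff_left inner_diff_right)
  qed
  have m: "(\<lambda>x. u x - w x) \<in> borel_measurable N" using meas by (rule borel_measurable_diff)
  have b: "integrable N (\<lambda>x. 2 * (u x \<bullet> (Z x *v u x)) + 2 * (w x \<bullet> (Z x *v w x)))"
    using int by (intro Bochner_Integration.integrable_add integrable_mult_right)
  have i: "integrable N (\<lambda>x. (u x - w x) \<bullet> (Z x *v (u x - w x)))"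
  proof (rule Bochner_Integration.integrable_bound[OF b Z_form_measurable[OF m m]])
    show "AE x in N. norm ((u x - w x) \<bullet> (Z x *v (u x - w x)))
      \<le> norm (2 * (u x \<bullet> (Z x *v u x)) + 2 * (w x \<bullet> (Z x *v w x)))"
      using le by eventually_elim (unfold real_norm_def, linarith)
  qed
  show "(\<lambda>x. u x - w x) \<in> L2Z X v N" using m i by (simp add: L2Z_def)
  have "L2Z_norm_sq X v N (\<lambda>x. u x - w x) \<le> (LINT x|N. 2 * (u x \<bullet> (Z x *v u x)) + 2 * (w x \<bullet> (Z x *v w x)))"
    unfolding L2Z_norm_sq_def by (rule integral_mono_AE[OF i b]) (use le in \<open>eventually_elim, linarith\<close>)
  also have "\<dots> = 2 * L2Z_norm_sq X v N u + 2 * L2Z_norm_sq X v N w"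
    unfolding L2Z_norm_sq_def using int by simp
  finally show "L2Z_norm_sq X v N (\<lambda>x. u x - w x) \<le> 2 * L2Z_norm_sq X v N u + 2 * L2Z_norm_sq X v N w" .
qed

lemma L2Z_norm_nonneg: "L2Z_norm_sq X v N u \<ge> 0"
proof -
  obtain K where "AE x in N. psd_bounded K x" using Z_psd_bounded by blast
  then have "AE x in N. 0 \<le> u x \<bullet> (Z x *v u x)" by eventually_elim (rule psd_boundedD(3))
  then show ?thesis unfolding L2Z_norm_sq_def by (rule integral_nonneg_AE)
qed

lemma L2Z_norm_minus: "L2Z_norm_sq X v N (\<lambda>x. u x - w x) = L2Z_norm_sq X v N (\<lambda>x. w x - u x)"
proof -
  have "(u x - w x) \<bullet> (Z x *v (u x - w x)) = (w x - u x) \<bullet> (Z x *v (w x - u x))" for x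
    by (simp add: matrix_vector_mult_diff_distrib inner_diff_left inner_diff_right)
  then show ?thesis unfolding L2Z_norm_sq_def by simp
qed

text \<open>
  Comparison through a third element; the constant 2 spares square roots.
\<close>

lemma L2Z_norm_via:
  assumes "u \<in> L2Z X v N" "w \<in> L2Z X v N" "z \<in> L2Z X v N"
  shows "L2Z_norm_sq X v N (\<lambda>x. u x - w x)
    \<le> 2 * L2Z_norm_sq X v N (\<lambda>x. u x - z x) + 2 * L2Z_norm_sq X v N (\<lambda>x. w x - z x)"
  using L2Z_diff(2)[OF L2Z_diff(1)[OF assms(1,3)] L2Z_diff(1)[OF assms(2,3)]] by simp

lemma nabla_L2Z: "C1 \<phi> \<Longrightarrow> nabla \<phi> \<circ> \<psi> \<in> L2Z X v N"
  unfolding L2Z_def comp_def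
  using nabla_form_integrable continuous_measurable[OF nabla_continuous] by blast

lemma root_integral: "cell_integral (root X) f = (LINT x|N. f x)"
  by (rule Bochner_Integration.integral_cong) (auto simp: cell_root space_N)

theorem C1_energy:
  assumes "C1 \<phi>"
  shows "energy X (\<phi> \<circ> \<psi>) (\<phi> \<circ> \<psi>) = L2Z_norm_sq X v N (nabla \<phi> \<circ> \<psi>)"
  using C1_cell_energy[OF assms root_idx] root_integral by (simp add: L2Z_norm_sq_def)

lemma pw_grad_exists:
  assumes n: "level_pw_harmonic X n f"
  shows "\<exists>u. is_pw_grad X v N f u"
proof -
  define u where "u = (\<lambda>x. \<Sum>\<alpha>\<in>level X n. indicator (cell X \<alpha>) x *\<^sub>R Tan X v \<alpha> f)"
  have [measurable]: "u \<in> borel_measurable N"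
    unfolding u_def using idx by (intro borel_measurable_sum borel_measurable_scaleR borel_measurable_indicator cell_sets) auto
  have u_eq: "u x = Tan X v \<alpha> f" if a: "\<alpha> \<in> level X n" and x: "x \<in> cell X \<alpha>" "x \<notin> all_vertices X" for \<alpha> x
  proof -
    have "u x = (\<Sum>\<beta>\<in>level X n. if \<beta> = \<alpha> then Tan X v \<alpha> f else 0)"
      unfolding u_def
    proof (rule sum.cong[OF refl])
      fix \<beta> assume b: "\<beta> \<in> level X n"
      show "indicator (cell X \<beta>) x *\<^sub>R Tan X v \<beta> f = (if \<beta> = \<alpha> then Tan X v \<alpha> f else 0)"
      proof (cases "\<beta> = \<alpha>")
        case False
        then have "x \<notin> cell X \<beta>" using cell_of_point[OF a b x(1) _ x(2)] by blast
        then show ?thesis using False by simp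
      qed (use x in simp)
    qed
    then show ?thesis using a level_finite by simp
  qed
  have bound: "norm (u x) \<le> (\<Sum>\<alpha>\<in>level X n. norm (Tan X v \<alpha> f))" for x
    unfolding u_def by (rule order_trans[OF norm_sum]) (intro sum_mono, simp add: indicator_def)
  have "integrable N (\<lambda>x. u x \<bullet> (Z x *v u x))"
    by (rule Z_form_integrable[OF _ _ AE_I2 AE_I2]) (auto intro: bound)
  then have "u \<in> L2Z X v N" by (simp add: L2Z_def)
  moreover have "AE x in N. x \<in> cell X \<alpha> \<longrightarrow> (u x - Tan X v \<alpha> f) \<bullet> (Z x *v (u x - Tan X v \<alpha> f)) = 0"
    if a: "\<alpha> \<in> level X n" for \<alpha>
    using AE_not_vertex by eventually_elim (simp add: u_eq[OF a])
  ultimately show ?thesis unfolding is_pw_grad_def using n by blast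
qed

text \<open>
  A null vector of a positive semidefinite form is orthogonal to every vector.
\<close>

lemma psd_bounded_null:
  assumes x: "psd_bounded K x" and a: "a \<bullet> (Z x *v a) = 0"
  shows "(a + b) \<bullet> (Z x *v (a + b)) = b \<bullet> (Z x *v b)"
proof -
  have ex: "(c *\<^sub>R a + b) \<bullet> (Z x *v (c *\<^sub>R a + b)) = 2 * c * (a \<bullet> (Z x *v b)) + b \<bullet> (Z x *v b)" for c
    using a psd_boundedD(2)[OF x, of b a]
    by (simp add: matrix_vector_right_distrib matrix_vector_mult_scaleR inner_add_left inner_add_right algebra_simps)
  have "a \<bullet> (Z x *v b) = 0"
  proof (rule ccontr)
    assume nz: "a \<bullet> (Z x *v b) \<noteq> 0"
    \<comment> \<open>chosen to make the form equal to \<open>-1\<close>\<close>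
    let ?c = "- (b \<bullet> (Z x *v b) + 1) / (2 * (a \<bullet> (Z x *v b)))"
    have "0 \<le> (?c *\<^sub>R a + b) \<bullet> (Z x *v (?c *\<^sub>R a + b))" by (rule psd_boundedD(3)[OF x])
    moreover have "2 * ?c * (a \<bullet> (Z x *v b)) = - (b \<bullet> (Z x *v b) + 1)" using nz by simp
    ultimately show False unfolding ex by linarith
  qed
  then show ?thesis using ex[of 1] by simp
qed

text \<open>
  The isometry property of the gradient, for the difference of a piecewise harmonic and a \<open>C1\<close>
  function: on each cell the former is linear in harmonic coordinates.
\<close>

theorem pw_grad_isometry:
  assumes f: "is_pw_grad X v N f u" and c1: "C1 \<phi>"
  shows "L2Z_norm_sq X v N (\<lambda>x. u x - (nabla \<phi> \<circ> \<psi>) x)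
    = energy X (\<lambda>x. f x - (\<phi> \<circ> \<psi>) x) (\<lambda>x. f x - (\<phi> \<circ> \<psi>) x)"
proof -
  obtain n where n: "level_pw_harmonic X n f" and u: "u \<in> L2Z X v N"
    and uT: "\<And>\<alpha>. \<alpha> \<in> level X n \<Longrightarrow> AE x in N. x \<in> cell X \<alpha> \<longrightarrow>
      (u x - Tan X v \<alpha> f) \<bullet> (Z x *v (u x - Tan X v \<alpha> f)) = 0"
    using f unfolding is_pw_grad_def by blast
  obtain K where K: "AE x in N. psd_bounded K x" using Z_psd_bounded by blast
  let ?w = "\<lambda>x. nabla \<phi> (\<psi> x)" and ?f = "\<lambda>x. f x - (\<phi> \<circ> \<psi>) x"
  let ?q = "\<lambda>x. (u x - ?w x) \<bullet> (Z x *v (u x - ?w x))"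
  have fD: "?f \<in> Dom X" using n by (intro root.D_diff C1_Dom c1) (simp add: level_pw_harmonic_def)
  have int: "integrable N ?q"
    using L2Z_diff(1)[OF u nabla_L2Z[OF c1]] by (simp add: L2Z_def comp_def)
  have cell_eq: "cell_integral \<alpha> ?q = form X \<alpha> ?f ?f" if a: "\<alpha> \<in> level X n" for \<alpha>
  proof -
    interpret A: resform "all_vertices X \<inter> cell X \<alpha>" "form_dom X \<alpha>" "form X \<alpha>"
      by (rule cell_form[OF idx[OF a]])
    define t where "t = Tan X v \<alpha> f"
    define \<eta> where "\<eta> = (\<lambda>y. t \<bullet> y - \<phi> y)"
    have \<eta>: "C1 \<eta>" "nabla \<eta> = (\<lambda>y. t - nabla \<phi> y)"
      unfolding \<eta>_def using C1_diff[OF C1_inner c1] nabla_diff[OF C1_inner c1] by (simp_all add: nabla_inner)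
    have "cell_integral \<alpha> ?q = cell_integral \<alpha> (\<lambda>x. nabla \<eta> (\<psi> x) \<bullet> (Z x *v nabla \<eta> (\<psi> x)))"
    proof (rule integral_cong_AE)
      show "(\<lambda>x. indicator (cell X \<alpha>) x * ?q x) \<in> borel_measurable N"
        by (intro borel_measurable_integrable integrable_cell idx[OF a] int)
      show "(\<lambda>x. indicator (cell X \<alpha>) x * (nabla \<eta> (\<psi> x) \<bullet> (Z x *v nabla \<eta> (\<psi> x)))) \<in> borel_measurable N"
        by (intro borel_measurable_integrable integrable_cell idx[OF a] nabla_form_integrable \<eta>)
      show "AE x in N. indicator (cell X \<alpha>) x * ?q x
          = indicator (cell X \<alpha>) x * (nabla \<eta> (\<psi> x) \<bullet> (Z x *v nabla \<eta> (\<psi> x)))"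
        using uT[OF a] K
      proof eventually_elim
        case (elim x)
        show ?case
        proof (cases "x \<in> cell X \<alpha>")
          case True
          have "?q x = (t - ?w x) \<bullet> (Z x *v (t - ?w x))"
            using psd_bounded_null[OF elim(2), of "u x - t" "t - ?w x"] elim(1) True by (simp add: t_def)
          then show ?thesis by (simp add: \<eta>(2))
        qed simp
      qed
    qed
    also have "\<dots> = form X \<alpha> (\<eta> \<circ> \<psi>) (\<eta> \<circ> \<psi>)"
      using C1_cell_energy[OF \<eta>(1) a] by simp
    also have "\<dots> = form X \<alpha> ?f ?f"
    proof -
      have ag: "agree_on (all_vertices X \<inter> cell X \<alpha>) (\<eta> \<circ> \<psi>) ?f"
        unfolding agree_on_def using Tan_coincides[OF n a] by (simp add: \<eta>_def t_def)
      have D: "\<eta> \<circ> \<psi> \<in> form_dom X \<alpha>" using C1_cell_energy[OF \<eta>(1) a] by blast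
      show ?thesis by (rule A.E_agree[OF D D A.D_agree[OF D ag] A.D_agree[OF D ag] ag ag])
    qed
    finally show ?thesis .
  qed
  have "L2Z_norm_sq X v N (\<lambda>x. u x - (nabla \<phi> \<circ> \<psi>) x) = cell_integral (root X) ?q"
    by (simp add: L2Z_norm_sq_def root_integral)
  also have "\<dots> = (\<Sum>\<alpha>\<in>level X n. cell_integral \<alpha> ?q)"
    using cell_integral_decompose[OF root_idx _ int, of n] by (simp add: sub_root)
  also have "\<dots> = (\<Sum>\<alpha>\<in>level X n. form X \<alpha> ?f ?f)" by (rule sum.cong[OF refl cell_eq])
  also have "\<dots> = energy X ?f ?f"
    using splitting(2)[OF root_idx _ fD, of n] by (simp add: sub_root)
  finally show ?thesis .
qed

text \<open>
  By the isometry, gradients of piecewise harmonic functions approximating \<open>\<phi> \<circ>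
  \<psi>\<close> in energy converge to \<open>nabla \<phi> \<circ> \<psi>\<close>, and limits
  are unique up to null vectors. Density provides the approximating sequence.
\<close>

theorem Grad_C1:
  assumes dense: "energy_dense X {f. pw_harmonic X f}" and c1: "C1 \<phi>"
  shows "Grad X v N (\<phi> \<circ> \<psi>) = L2Z_class X v N (nabla \<phi> \<circ> \<psi>)"
proof
  let ?w = "nabla \<phi> \<circ> \<psi>" and ?g = "\<phi> \<circ> \<psi>"
  have w: "?w \<in> L2Z X v N" by (rule nabla_L2Z[OF c1])
  have g: "?g \<in> Dom X" by (rule C1_Dom[OF c1])
  show "Grad X v N ?g \<subseteq> L2Z_class X v N ?w"
  proof
    fix u assume "u \<in> Grad X v N ?g"
    then obtain fs us where u: "u \<in> L2Z X v N" and fs: "\<forall>k::nat. is_pw_grad X v N (fs k) (us k)"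
      and lim: "(\<lambda>k. energy X (\<lambda>x. fs k x - ?g x) (\<lambda>x. fs k x - ?g x)) \<longlonglongrightarrow> 0"
        "(\<lambda>k. L2Z_norm_sq X v N (\<lambda>x. us k x - u x)) \<longlonglongrightarrow> 0"
      unfolding Grad_def by blast
    have "L2Z_norm_sq X v N (\<lambda>x. u x - ?w x) \<le> 2 * L2Z_norm_sq X v N (\<lambda>x. us k x - u x)
        + 2 * energy X (\<lambda>x. fs k x - ?g x) (\<lambda>x. fs k x - ?g x)" for k
    proof -
      have k: "is_pw_grad X v N (fs k) (us k)" using fs by blast
      then have us: "us k \<in> L2Z X v N" by (simp add: is_pw_grad_def)
      show ?thesis
        using L2Z_norm_via[OF u w us] L2Z_norm_minus[of u "us k"] L2Z_norm_minus[of ?w "us k"] pw_grad_isometry[OF k c1]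
        by simp
    qed
    moreover have "(\<lambda>k. 2 * L2Z_norm_sq X v N (\<lambda>x. us k x - u x)
        + 2 * energy X (\<lambda>x. fs k x - ?g x) (\<lambda>x. fs k x - ?g x)) \<longlonglongrightarrow> 2 * 0 + 2 * 0"
      by (intro tendsto_intros lim)
    ultimately have "L2Z_norm_sq X v N (\<lambda>x. u x - ?w x) \<le> 2 * 0 + 2 * 0"
      by (intro LIMSEQ_le_const) auto
    then show "u \<in> L2Z_class X v N ?w"
      using u L2Z_norm_nonneg[of "\<lambda>x. u x - ?w x"] by (simp add: L2Z_class_def)
  qed
  show "L2Z_class X v N ?w \<subseteq> Grad X v N ?g"
  proof
    fix u assume "u \<in> L2Z_class X v N ?w"
    then have u: "u \<in> L2Z X v N" and uw: "L2Z_norm_sq X v N (\<lambda>x. u x - ?w x) = 0"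
      by (auto simp: L2Z_class_def)
    have "\<exists>f u'. is_pw_grad X v N f u' \<and> energy X (\<lambda>x. f x - ?g x) (\<lambda>x. f x - ?g x) \<le> 1 / Suc k" for k
    proof -
      have "\<forall>e>0. \<exists>f\<in>{f. pw_harmonic X f}. energy X (\<lambda>x. ?g x - f x) (\<lambda>x. ?g x - f x) < e"
        using dense g unfolding energy_dense_def by blast
      then have "\<exists>f\<in>{f. pw_harmonic X f}. energy X (\<lambda>x. ?g x - f x) (\<lambda>x. ?g x - f x) < 1 / Suc k"
        by (rule allE[of _ "1 / Suc k"]) simp
      then obtain f where f: "pw_harmonic X f" "energy X (\<lambda>x. ?g x - f x) (\<lambda>x. ?g x - f x) < 1 / Suc k" by blast
      obtain u' where u': "is_pw_grad X v N f u'" using f(1) pw_grad_exists by (auto simp: pw_harmonic_def)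
      have fD: "f \<in> Dom X" using f(1) by (auto simp: pw_harmonic_def level_pw_harmonic_def)
      have "energy X (\<lambda>x. f x - ?g x) (\<lambda>x. f x - ?g x) \<le> 1 / Suc k"
        using f(2) root.E_diff_commute[OF fD g] by simp
      then show ?thesis using u' by blast
    qed
    then obtain fs us where k: "\<And>k. is_pw_grad X v N (fs k) (us k)"
      and le: "\<And>k. energy X (\<lambda>x. fs k x - ?g x) (\<lambda>x. fs k x - ?g x) \<le> 1 / Suc k" by metis
    have fD: "fs k \<in> Dom X" for k using k[of k] by (auto simp: is_pw_grad_def level_pw_harmonic_def)
    have us: "us k \<in> L2Z X v N" for k using k[of k] by (simp add: is_pw_grad_def)
    have 0: "(\<lambda>k. 1 / real (Suc k)) \<longlonglongrightarrow> 0"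
      using LIMSEQ_inverse_real_of_nat by (simp add: inverse_eq_divide)
    have lim: "(\<lambda>k. energy X (\<lambda>x. fs k x - ?g x) (\<lambda>x. fs k x - ?g x)) \<longlonglongrightarrow> 0"
      using le root.E_nonneg[OF root.D_diff[OF fD g]]
      by (intro tendsto_sandwich[OF _ _ tendsto_const 0] always_eventually allI)
    have "(\<lambda>k. L2Z_norm_sq X v N (\<lambda>x. us k x - u x)) \<longlonglongrightarrow> 0"
    proof (rule tendsto_sandwich[OF _ _ tendsto_const])
      show "\<forall>\<^sub>F k in sequentially. L2Z_norm_sq X v N (\<lambda>x. us k x - u x)
          \<le> 2 * energy X (\<lambda>x. fs k x - ?g x) (\<lambda>x. fs k x - ?g x)"
        using L2Z_norm_via[OF us u w] pw_grad_isometry[OF k c1] uw by (intro always_eventually allI) simp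
      show "(\<lambda>k. 2 * energy X (\<lambda>x. fs k x - ?g x) (\<lambda>x. fs k x - ?g x)) \<longlonglongrightarrow> 0"
        using tendsto_mult_right_zero[OF lim, of 2] by simp
    qed (intro always_eventually allI L2Z_norm_nonneg)
    then show "u \<in> Grad X v N ?g"
      unfolding Grad_def using u g k lim by blast
  qed
qed

end

theorem theorem7:
  fixes X :: "('a::metric_space, 'i) form_fractal"
    and v :: "'m::finite \<Rightarrow> 'a"
    and \<nu> :: "('a \<Rightarrow> real) \<Rightarrow> 'a measure"
    and g :: "nat \<Rightarrow> 'a \<Rightarrow> real"
    and N :: "'a measure"
    and \<psi> :: "'a \<Rightarrow> real ^ 'm"
  assumes fractal: "finitely_ramified X"
    and form: "splitting_form X"
    and harmonic_cont: "harmonic_continuous X"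
    and enum: "bij_betw v UNIV (level_vertices X 0)"
    and energy_measures: "\<And>h. harmonic X h \<Longrightarrow> is_energy_measure X h (\<nu> h)"
    and basis: "orthonormal_harmonic_basis X (CARD('m) - 1) g"
    and N_def: "N = kusuoka_measure X (CARD('m) - 1) (\<lambda>i. \<nu> (g i))"
    and psi_def: "\<psi> = harmonic_coords X v"
    and HC: "\<exists>\<psi>'. homeomorphism (points X) (\<psi> ` points X) \<psi> \<psi>'"
  shows "(\<forall>\<phi>. C1 \<phi> \<longrightarrow> \<phi> \<circ> \<psi> \<in> Dom X)
       \<and> (\<forall>\<phi>. C1 \<phi> \<longrightarrow> nabla \<phi> \<circ> \<psi> \<in> L2Z X v N
            \<and> energy X (\<phi> \<circ> \<psi>) (\<phi> \<circ> \<psi>) = L2Z_norm_sq X v N (nabla \<phi> \<circ> \<psi>))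
       \<and> (energy_dense X {f. pw_harmonic X f} \<longrightarrow>
            energy_dense X {\<phi> \<circ> \<psi> | \<phi>. C1 \<phi>}
            \<and> (\<forall>\<phi>. C1 \<phi> \<longrightarrow> Grad X v N (\<phi> \<circ> \<psi>) = L2Z_class X v N (nabla \<phi> \<circ> \<psi>)))"
proof -
  interpret harmonic_fractal X v \<nu> g N \<psi>
    by (intro harmonic_fractal.intro harmonic_fractal_axioms.intro form_cells.intro form_cells_axioms.intro cells.intro
        fractal form harmonic_cont enum energy_measures basis N_def psi_def)
  have inj: "inj_on \<psi> (points X)"
    using HC homeomorphism_apply1 by (metis inj_on_inverseI)
  show ?thesis
    using C1_Dom nabla_L2Z C1_energy C1_dense[OF inj] Grad_C1 by blast
qed

end
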